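(* Let $g\in W^{1,1}([0,1];W^{2,\infty}(\mathbb{R}^d))$ and let $g_h\in W^{1,1}([0,1];V_h(\Omega'))$ be its interpolation on $\mathcal{T}_h$. For all $\varepsilon>0$ (with associated $h=h(\varepsilon)$) there exists an irreversible quasi-static evolution for the eigenfracture approximation, i.e., a mapping $t\mapsto(u_\varepsilon(t),\gamma_\varepsilon(t),\Gamma_\varepsilon(t))$, $t\in[0,1]$, with $(u_\varepsilon(t),\gamma_\varepsilon(t),\Gamma_\varepsilon(t))\in AD_\varepsilon(g_h(t))$ for all $t\in[0,1]$, such that the following properties hold: (a) (Initial condition) $(u_\varepsilon(0),\gamma_\varepsilon(0),\emptyset)$ minimizes the energy $\mathcal{E}_\varepsilon(\bar u,\bar\gamma,\emptyset)$ among all $(\bar u,\bar\gamma)\in V_h(\Omega')\times W_h(\Omega')$ with $\bar u=g_h(0)$ and $\bar\gamma=0$ on $\Omega'\setminus\overline\Omega$. (b) (Irreversibility) $\Gamma_\varepsilon(s)\subset\Gamma_\varepsilon(t)$ for all $0\le s\le t\le1$. (c) (Global stability) For all $t\in(0,1]$ and all $(\bar u,\bar\gamma)\in V_h(\Omega')\times W_h(\Omega')$ with $\bar u=g_h(t)$ and $\bar\gamma=0$ on $\Omega'\setminus\overline\Omega$, $$\mathcal{E}_\varepsilon(u_\varepsilon(t),\gamma_\varepsilon(t),\Gamma_\varepsilon(t))\le\mathcal{E}_\varepsilon(\bar u,\bar\gamma,\Gamma_\varepsilon(t)).$$ (d) (Energy balance) The function $t\mapsto\mathcal{E}_\varepsilon(u_\varepsilon(t),\gamma_\varepsilon(t),\Gamma_\varepsilon(t))$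 is absolutely continuous and for all $t\in[0,1]$ $$\mathcal{E}_\varepsilon(u_\varepsilon(t),\gamma_\varepsilon(t),\Gamma_\varepsilon(t))=\mathcal{E}_\varepsilon(u_\varepsilon(0),\gamma_\varepsilon(0),\emptyset)+2\int_0^t\int_\Omega(\nabla u_\varepsilon(s)-\gamma_\varepsilon(s))\cdot\mathbb{C}\,\partial_t\nabla g_h(s)\,dx\,ds,$$ where $\partial_t$ denotes the time derivative. Moreover, this evolution is given as the limit of the time-discrete solutions $(u^m_k,\gamma^m_k)_{0\le k\le m}$, $m\in\mathbb{N}$ (defined in the context), in the sense that, up to a subsequence (not relabeled), as $m\to\infty$, $$\mathcal{E}_\varepsilon\big(u^m_{k(m,t)},\gamma^m_{k(m,t)},\Gamma^m_{k(m,t)}\big)\to\mathcal{E}_\varepsilon(u_\varepsilon(t),\gamma_\varepsilon(t),\Gamma_\varepsilon(t)),$$ $$u^m_{k(m,t)}\to u_\varepsilon(t)\ \text{in }L^1(G_\varepsilon(t)),\qquad \nabla u^m_{k(m,t)}\mathbf{1}_{(\Gamma^m_{k(m,t)})^c}\to\nabla u_\varepsilon(t)-\gamma_\varepsilon(t)\ \text{in }L^2(\Omega'),$$ for all $t\in[0,1]$, where $k(m,t)$ is chosen such that $t^m_{k(m,t)}\le t<t^m_{k(m,t)+1}$ (the second inequality being void if $k(m,t)=m$), and $G_\varepsilon(t)\subset\Omega'$ denotes the largest open set with $\Omega'\setminus\overline\Omega\subset G_\varepsilon(t)$ and $U^{\mathcal{T}}_\varepsilon(\Gamma_\varepsilon(t))\cap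 G_\varepsilon(t)=\emptyset$.
   Context: Setting. $\Omega\subset\mathbb{R}^d$ is a bounded Lipschitz domain, and $\Omega'\supset\Omega$ is a larger set such that $\Omega'\setminus\overline\Omega$ is also a Lipschitz set. $(\mathcal{T}_h)_{h>0}$ is a family of triangulations of $\mathbb{R}^d$ into closed simplices with $\sup\{\operatorname{diam}T:T\in\mathcal{T}_h\}\le h$. $V_h(\Omega')$ and $W_h(\Omega')$ are the finite element spaces of continuous piecewise affine (scalar) and of piecewise constant ($\mathbb{R}^d$-valued) functions, respectively, defined on all simplices of $\mathcal{T}_h$ intersecting $\Omega'$. To each $\varepsilon>0$ a mesh size $h=h(\varepsilon)>0$ is associated with $h(\varepsilon)/\varepsilon\to0$ as $\varepsilon\to0$. For a set $A$, $U_\varepsilon(A)$ is the closed $\varepsilon$-neighborhood of $A$, and $U^{\mathcal{T}}_\varepsilon(A)$ is the union of all simplices of $\mathcal{T}_{h(\varepsilon)}$ intersecting $U_\varepsilon(A)$. Energy. $Q(F)=F^T\mathbb{C}F$ for some $\mathbb{C}\in\mathbb{R}^{d\times d}$ such that $Q(F)>0$ for all $F\neq0$, $\kappa>0$, and for $u\in V_h(\Omega')$, $\gamma\in W_h(\Omega')$, $\Psi\subset\Omega'$, $$\mathcal{E}_\varepsilon(u,\gamma,\Psi)=\int_\Omega Q(\nabla u-\gamma)\,dx+\frac{\kappa}{2\varepsilon}\mathcal{L}^d\big(U^{\mathcal{T}}_\varepsilon(\Psi\cup\{\gamma\neq0\})\big),$$ where $\{\gamma\ne0\}$ is the complement of the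 zero set of the precise representative of $\gamma$. $g_h(t)$ denotes the continuous piecewise affine interpolation of $g(t)$ on $\mathcal{T}_h$. Admissible triples. $(\bar u,\bar\gamma,\bar\Gamma)\in AD_\varepsilon(\bar g)$ means: $(\bar u,\bar\gamma)\in V_h(\Omega')\times W_h(\Omega')$, $\bar\Gamma$ is a union of simplices of $\mathcal{T}_h$, $\bar u=\bar g$ and $\bar\gamma=0$ on $\Omega'\setminus\overline\Omega$, and $\{\bar\gamma\ne0\}\subset\bar\Gamma$. Time-discrete solutions. $I_\infty\subset[0,1]$ is dense with $0\in I_\infty$, and $I_m=\{0=t^m_0<t^m_1<\dots<t^m_m\}\subset I_\infty$ are finite nested sets ($I_m\subset I_{m+1}$) with $\bigcup_mI_m=I_\infty$ and $\lim_{m\to\infty}\max_{1\le i\le m}(t^m_i-t^m_{i-1})=0$. The pair $(u^m_0,\gamma^m_0)$ (chosen independently of $m$) minimizes $\mathcal{E}_\varepsilon(u,\gamma,\emptyset)$ among $(u,\gamma)\in V_h(\Omega')\times W_h(\Omega')$ with $u=g_h(0)$, $\gamma=0$ on $\Omega'\setminus\overline\Omega$. Given $(u^m_j,\gamma^m_j)_{0\le j\le i}$, set $\Gamma^m_i:=\bigcup_{k=0}^i\{\gamma^m_k\neq0\}$; then $(u^m_{i+1},\gamma^m_{i+1})$ minimizes $\mathcal{E}_\varepsilon(u,\gamma,\Gamma^m_i)$ among $(u,\gamma)\in V_h(\Omega')\times W_h(\Omega')$ with $u=g_h(t^m_{i+1})$, $\gamma=0$ on $\Omega'\setminus\overline\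Omega$.
   Formalization: ℂ is assumed symmetric, since (d) fails otherwise; and G_ε(t) is the largest open subset of Ω' disjoint from U^T_ε(Γ_ε(t)) whose connected components all meet Ω'∖closure(Ω), since on pieces detached from there u is fixed only up to constants and convergence can fail. *)

theory Defs
  imports "HOL-Analysis.Analysis"
begin

section \<open>Domains\<close>

text \<open>
  \<^term>\<open>\<nu>\<close> is the axis direction of the local graph and \<^term>\<open>\<psi>\<close> is a function on the hyperplane
  orthogonal to \<^term>\<open>\<nu>\<close>. Lipschitz sets are understood to be open and bounded.
\<close>

definition lipschitz_boundary :: "(real ^ 'n) set \<Rightarrow> bool" where
  "lipschitz_boundary S \<longleftrightarrow>
    (\<forall>x\<in>frontier S. \<exists>\<nu> r L \<psi>. norm \<nu> = 1 \<and> 0 < r \<and> L-lipschitz_on {z. \<nu> \<bullet> z = 0} \<psi> \<and>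
      (\<forall>y\<in>ball x r. y \<in> S \<longleftrightarrow> \<nu> \<bullet> y < \<psi> (y - (\<nu> \<bullet> y) *\<^sub>R \<nu>)))"

definition lipschitz_set :: "(real ^ 'n) set \<Rightarrow> bool" where
  "lipschitz_set S \<longleftrightarrow> open S \<and> bounded S \<and> lipschitz_boundary S"

definition lipschitz_domain :: "(real ^ 'n) set \<Rightarrow> bool" where
  "lipschitz_domain S \<longleftrightarrow> lipschitz_set S \<and> connected S \<and> S \<noteq> {}"


section \<open>The Sobolev spaces of the boundary data\<close>

definition partial_deriv :: "'n \<Rightarrow> (real ^ 'n \<Rightarrow> real) \<Rightarrow> real ^ 'n \<Rightarrow> real" where
  "partial_deriv i f x = frechet_derivative f (at x) (axis i 1)"

text \<open>Iterated partial derivatives; a list of directions plays the role of a multi-index.\<close>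

fun partial_derivs :: "'n list \<Rightarrow> (real ^ 'n \<Rightarrow> real) \<Rightarrow> real ^ 'n \<Rightarrow> real" where
  "partial_derivs [] f = f"
| "partial_derivs (i # js) f = partial_deriv i (partial_derivs js f)"

definition test_function :: "(real ^ 'n \<Rightarrow> real) \<Rightarrow> bool" where
  "test_function \<phi> \<longleftrightarrow>
    (\<forall>js. partial_derivs js \<phi> differentiable_on UNIV) \<and> compact (closure {x. \<phi> x \<noteq> 0})"

definition locally_integrable :: "(real ^ 'n \<Rightarrow> real) \<Rightarrow> bool" where
  "locally_integrable f \<longleftrightarrow> (\<forall>K. compact K \<longrightarrow> set_integrable lebesgue K f)"

definition has_weak_deriv :: "(real ^ 'n \<Rightarrow> real) \<Rightarrow> 'n list \<Rightarrow> (real ^ 'n \<Rightarrow> real) \<Rightarrow> bool" where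
  "has_weak_deriv f js w \<longleftrightarrow> locally_integrable f \<and> locally_integrable w \<and>
    (\<forall>\<phi>. test_function \<phi> \<longrightarrow>
      (LINT x|lebesgue. f x * partial_derivs js \<phi> x) = (-1) ^ length js * (LINT x|lebesgue. w x * \<phi> x))"

definition weak_deriv :: "(real ^ 'n \<Rightarrow> real) \<Rightarrow> 'n list \<Rightarrow> real ^ 'n \<Rightarrow> real" where
  "weak_deriv f js = (SOME w. has_weak_deriv f js w)"

definition in_Linf :: "(real ^ 'n \<Rightarrow> real) \<Rightarrow> bool" where
  "in_Linf f \<longleftrightarrow> f \<in> borel_measurable lebesgue \<and> (\<exists>c. AE x in lebesgue. \<bar>f x\<bar> \<le> c)"

definition norm_Linf :: "(real ^ 'n \<Rightarrow> real) \<Rightarrow> real" where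
  "norm_Linf f = Inf {c. 0 \<le> c \<and> (AE x in lebesgue. \<bar>f x\<bar> \<le> c)}"

text \<open>
  \<open>W\<^sup>2\<^sup>,\<^sup>\<infinity>(\<real>\<^sup>d)\<close>. Its elements have a continuous representative, and we always take that one, so
  that nodal values make sense.
\<close>

definition W2inf :: "(real ^ 'n \<Rightarrow> real) set" where
  "W2inf = {f. continuous_on UNIV f \<and> in_Linf f \<and>
    (\<forall>js. 1 \<le> length js \<and> length js \<le> 2 \<longrightarrow> (\<exists>w. has_weak_deriv f js w \<and> in_Linf w))}"

definition norm_W2inf :: "(real ^ 'n \<Rightarrow> real) \<Rightarrow> real" where
  "norm_W2inf f = norm_Linf f + (\<Sum>i\<in>UNIV. norm_Linf (weak_deriv f [i]))
     + (\<Sum>i\<in>UNIV. \<Sum>j\<in>UNIV. norm_Linf (weak_deriv f [i, j]))"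

text \<open>
  Bochner integrability on \<open>[0,1]\<close> with values in \<^const>\<open>W2inf\<close>: almost everywhere limit in norm of
  measurable simple functions, with integrable norm.
\<close>

definition bochner_integrable_W2inf :: "(real \<Rightarrow> real ^ 'n \<Rightarrow> real) \<Rightarrow> bool" where
  "bochner_integrable_W2inf f \<longleftrightarrow>
    (\<forall>t\<in>{0..1}. f t \<in> W2inf) \<and>
    (\<exists>s :: nat \<Rightarrow> real \<Rightarrow> real ^ 'n \<Rightarrow> real.
      (\<forall>k. finite (s k ` {0..1}) \<and> s k ` {0..1} \<subseteq> W2inf \<and>
           (\<forall>w. {t\<in>{0..1}. s k t = w} \<in> sets lebesgue)) \<and>
      (AE t in lebesgue_on {0..1}. (\<lambda>k. norm_W2inf (\<lambda>x. s k t x - f t x)) \<longlonglongrightarrow> 0)) \<and>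
    integrable (lebesgue_on {0..1}) (\<lambda>t. norm_W2inf (f t))"

text \<open>
  \<open>W\<^sup>1\<^sup>,\<^sup>1([0,1]; W\<^sup>2\<^sup>,\<^sup>\<infinity>(\<real>\<^sup>d))\<close>, in terms of the absolutely continuous representative
  \<open>g(t) = g(0) + \<integral>\<^sub>0\<^sup>t g'(s) ds\<close>. Point evaluations are bounded functionals on \<^const>\<open>W2inf\<close>, so the
  Bochner integral of \<open>g'\<close> is computed pointwise in \<open>x\<close>.
\<close>

definition W11_W2inf :: "(real \<Rightarrow> real ^ 'n \<Rightarrow> real) set" where
  "W11_W2inf = {g. (\<forall>t\<in>{0..1}. g t \<in> W2inf) \<and>
    (\<exists>g'. bochner_integrable_W2inf g' \<and>
      (\<forall>t\<in>{0..1}. \<forall>x. g t x = g 0 x + (LINT s:{0..t}|lebesgue. g' s x)))}"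


section \<open>Triangulations and finite element spaces\<close>

text \<open>
  The library's \<^const>\<open>triangulation\<close> is finite; the conforming triangulations of the whole
  space used here are locally finite. Only the full-dimensional simplices are listed.
\<close>

definition space_triangulation :: "(real ^ 'n) set set \<Rightarrow> bool" where
  "space_triangulation Th \<longleftrightarrow>
    (\<forall>T\<in>Th. int CARD('n) simplex T) \<and>
    (\<forall>T\<in>Th. \<forall>T'\<in>Th. (T \<inter> T') face_of T) \<and>
    \<Union>Th = UNIV \<and>
    (\<forall>K. bounded K \<longrightarrow> finite {T\<in>Th. T \<inter> K \<noteq> {}})"

definition mesh_dom :: "(real ^ 'n) set set \<Rightarrow> (real ^ 'n) set \<Rightarrow> (real ^ 'n) set" where
  "mesh_dom Th A = \<Union>{T\<in>Th. T \<inter> A \<noteq> {}}"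

definition V_space :: "(real ^ 'n) set set \<Rightarrow> (real ^ 'n) set \<Rightarrow> (real ^ 'n \<Rightarrow> real) set" where
  "V_space Th \<Omega>' = {u. continuous_on (mesh_dom Th \<Omega>') u \<and>
     (\<forall>T\<in>Th. T \<inter> \<Omega>' \<noteq> {} \<longrightarrow> (\<exists>a b. \<forall>x\<in>T. u x = a \<bullet> x + b))}"

definition W_space :: "(real ^ 'n) set set \<Rightarrow> (real ^ 'n) set \<Rightarrow> (real ^ 'n \<Rightarrow> real ^ 'n) set" where
  "W_space Th \<Omega>' = {\<gamma>. \<forall>T\<in>Th. T \<inter> \<Omega>' \<noteq> {} \<longrightarrow> (\<exists>c. AE x in lebesgue. x \<in> T \<longrightarrow> \<gamma> x = c)}"

definition interpolant :: "(real ^ 'n) set set \<Rightarrow> (real ^ 'n \<Rightarrow> real) \<Rightarrow> real ^ 'n \<Rightarrow> real" where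
  "interpolant Th f = (THE w. \<forall>T\<in>Th. (\<exists>a b. \<forall>x\<in>T. w x = a \<bullet> x + b) \<and>
     (\<forall>v. v extreme_point_of T \<longrightarrow> w v = f v))"

text \<open>For piecewise affine functions this is the weak gradient (up to a null set).\<close>

definition grad :: "(real ^ 'n \<Rightarrow> real) \<Rightarrow> real ^ 'n \<Rightarrow> real ^ 'n" where
  "grad u x = (\<chi> i. frechet_derivative u (at x) (axis i 1))"

text \<open>
  \<open>\<partial>\<^sub>t\<nabla>w(s)\<close> as a classical derivative in time, which for absolutely continuous nodal values
  exists for almost every \<open>s\<close>.
\<close>

definition dt_grad :: "(real \<Rightarrow> real ^ 'n \<Rightarrow> real) \<Rightarrow> real \<Rightarrow> real ^ 'n \<Rightarrow> real ^ 'n" where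
  "dt_grad w s x = vector_derivative (\<lambda>t. grad (w t) x) (at s within {0..1})"


section \<open>The energy\<close>

definition precise_rep :: "(real ^ 'n \<Rightarrow> real ^ 'n) \<Rightarrow> real ^ 'n \<Rightarrow> real ^ 'n" where
  "precise_rep f x =
    (let avg = (\<lambda>r. (LINT y:ball x r|lebesgue. f y) /\<^sub>R measure lebesgue (ball x r)) in
     if \<exists>l. (avg \<longlongrightarrow> l) (at_right 0) then Lim (at_right 0) avg else 0)"

text \<open>
  \<open>{\<gamma> \<noteq> 0}\<close> for \<open>\<gamma> \<in> W\<^sub>h(\<Omega>')\<close>; such a \<open>\<gamma>\<close> lives on \<^const>\<open>mesh_dom\<close> only, and is extended by zero.
\<close>

definition nonzero_set ::
    "(real ^ 'n) set set \<Rightarrow> (real ^ 'n) set \<Rightarrow> (real ^ 'n \<Rightarrow> real ^ 'n) \<Rightarrow> (real ^ 'n) set" where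
  "nonzero_set Th \<Omega>' \<gamma> =
    {x. precise_rep (\<lambda>y. indicat_real (mesh_dom Th \<Omega>') y *\<^sub>R \<gamma> y) x \<noteq> 0}"

text \<open>The closed neighbourhood; note that \<^term>\<open>infdist x {} = 0\<close>.\<close>

definition closed_nbhd :: "real \<Rightarrow> (real ^ 'n) set \<Rightarrow> (real ^ 'n) set" where
  "closed_nbhd \<epsilon> A = {x. A \<noteq> {} \<and> infdist x A \<le> \<epsilon>}"

definition mesh_nbhd :: "(real ^ 'n) set set \<Rightarrow> real \<Rightarrow> (real ^ 'n) set \<Rightarrow> (real ^ 'n) set" where
  "mesh_nbhd Th \<epsilon> A = mesh_dom Th (closed_nbhd \<epsilon> A)"

definition quad :: "real ^ 'n ^ 'n \<Rightarrow> real ^ 'n \<Rightarrow> real" where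
  "quad C F = F \<bullet> (C *v F)"

text \<open>
  All sets \<open>\<Psi>\<close> that occur below are bounded. Hence the volume is finite, and
  \<^const>\<open>measure\<close> does not hide an infinite value.
\<close>

definition energy ::
    "real ^ 'n ^ 'n \<Rightarrow> real \<Rightarrow> real \<Rightarrow> (real ^ 'n) set set \<Rightarrow> (real ^ 'n) set \<Rightarrow> (real ^ 'n) set \<Rightarrow>
     (real ^ 'n \<Rightarrow> real) \<Rightarrow> (real ^ 'n \<Rightarrow> real ^ 'n) \<Rightarrow> (real ^ 'n) set \<Rightarrow> real" where
  "energy C \<kappa> \<epsilon> Th \<Omega> \<Omega>' u \<gamma> \<Psi> =
     (LINT x:\<Omega>|lebesgue. quad C (grad u x - \<gamma> x)) +
     \<kappa> / (2 * \<epsilon>) * measure lebesgue (mesh_nbhd Th \<epsilon> (\<Psi> \<union> nonzero_set Th \<Omega>' \<gamma>))"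

text \<open>The pairs in \<open>V\<^sub>h(\<Omega>') \<times> W\<^sub>h(\<Omega>')\<close> with \<open>u = w\<close> and \<open>\<gamma> = 0\<close> outside the closure of \<open>\<Omega>\<close>.\<close>

definition admissible_pairs ::
    "(real ^ 'n) set set \<Rightarrow> (real ^ 'n) set \<Rightarrow> (real ^ 'n) set \<Rightarrow> (real ^ 'n \<Rightarrow> real) \<Rightarrow>
     ((real ^ 'n \<Rightarrow> real) \<times> (real ^ 'n \<Rightarrow> real ^ 'n)) set" where
  "admissible_pairs Th \<Omega> \<Omega>' w = {(u, \<gamma>). u \<in> V_space Th \<Omega>' \<and> \<gamma> \<in> W_space Th \<Omega>' \<and>
     (\<forall>x\<in>\<Omega>' - closure \<Omega>. u x = w x) \<and>
     (AE x in lebesgue. x \<in> \<Omega>' - closure \<Omega> \<longrightarrow> \<gamma> x = 0)}"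

text \<open>
  The simplices forming \<open>\<Gamma>\<close> are those on which the finite element functions are defined; in
  particular \<open>\<Gamma>\<close> is bounded.
\<close>

definition AD ::
    "(real ^ 'n) set set \<Rightarrow> (real ^ 'n) set \<Rightarrow> (real ^ 'n) set \<Rightarrow> (real ^ 'n \<Rightarrow> real) \<Rightarrow>
     ((real ^ 'n \<Rightarrow> real) \<times> (real ^ 'n \<Rightarrow> real ^ 'n) \<times> (real ^ 'n) set) set" where
  "AD Th \<Omega> \<Omega>' w = {(u, \<gamma>, \<Gamma>). (u, \<gamma>) \<in> admissible_pairs Th \<Omega> \<Omega>' w \<and>
     (\<exists>S. S \<subseteq> {T\<in>Th. T \<inter> \<Omega>' \<noteq> {}} \<and> \<Gamma> = \<Union>S) \<and> nonzero_set Th \<Omega>' \<gamma> \<subseteq> \<Gamma>}"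

definition minimizer ::
    "real ^ 'n ^ 'n \<Rightarrow> real \<Rightarrow> real \<Rightarrow> (real ^ 'n) set set \<Rightarrow> (real ^ 'n) set \<Rightarrow> (real ^ 'n) set \<Rightarrow>
     (real ^ 'n \<Rightarrow> real) \<Rightarrow> (real ^ 'n) set \<Rightarrow>
     (real ^ 'n \<Rightarrow> real) \<Rightarrow> (real ^ 'n \<Rightarrow> real ^ 'n) \<Rightarrow> bool" where
  "minimizer C \<kappa> \<epsilon> Th \<Omega> \<Omega>' w \<Psi> u \<gamma> \<longleftrightarrow> (u, \<gamma>) \<in> admissible_pairs Th \<Omega> \<Omega>' w \<and>
     (\<forall>(v, \<eta>)\<in>admissible_pairs Th \<Omega> \<Omega>' w.
        energy C \<kappa> \<epsilon> Th \<Omega> \<Omega>' u \<gamma> \<Psi> \<le> energy C \<kappa> \<epsilon> Th \<Omega> \<Omega>' v \<eta> \<Psi>)"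


section \<open>Quasi-static evolutions\<close>

definition abs_continuous_on :: "real set \<Rightarrow> (real \<Rightarrow> real) \<Rightarrow> bool" where
  "abs_continuous_on S f \<longleftrightarrow> (\<forall>e>0. \<exists>d>0. \<forall>P :: (real \<times> real) set.
     finite P \<and> (\<forall>(a, b)\<in>P. a \<le> b \<and> {a..b} \<subseteq> S) \<and>
     pairwise (\<lambda>p q. {fst p<..<snd p} \<inter> {fst q<..<snd q} = {}) P \<and> (\<Sum>(a, b)\<in>P. b - a) < d
     \<longrightarrow> (\<Sum>(a, b)\<in>P. \<bar>f b - f a\<bar>) < e)"

text \<open>Here \<open>w\<close> is the discretised boundary datum \<open>t \<mapsto> g\<^sub>h(t)\<close>.\<close>

definition quasistatic_evolution ::
    "real ^ 'n ^ 'n \<Rightarrow> real \<Rightarrow> real \<Rightarrow> (real ^ 'n) set set \<Rightarrow> (real ^ 'n) set \<Rightarrow> (real ^ 'n) set \<Rightarrow>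
     (real \<Rightarrow> real ^ 'n \<Rightarrow> real) \<Rightarrow>
     (real \<Rightarrow> real ^ 'n \<Rightarrow> real) \<Rightarrow> (real \<Rightarrow> real ^ 'n \<Rightarrow> real ^ 'n) \<Rightarrow> (real \<Rightarrow> (real ^ 'n) set) \<Rightarrow> bool" where
  "quasistatic_evolution C \<kappa> \<epsilon> Th \<Omega> \<Omega>' w u \<gamma> \<Gamma> \<longleftrightarrow>
    (\<forall>t\<in>{0..1}. (u t, \<gamma> t, \<Gamma> t) \<in> AD Th \<Omega> \<Omega>' (w t)) \<and>
    minimizer C \<kappa> \<epsilon> Th \<Omega> \<Omega>' (w 0) {} (u 0) (\<gamma> 0) \<and>
    (\<forall>s t. 0 \<le> s \<and> s \<le> t \<and> t \<le> 1 \<longrightarrow> \<Gamma> s \<subseteq> \<Gamma> t) \<and>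
    (\<forall>t\<in>{0<..1}. \<forall>(v, \<eta>)\<in>admissible_pairs Th \<Omega> \<Omega>' (w t).
       energy C \<kappa> \<epsilon> Th \<Omega> \<Omega>' (u t) (\<gamma> t) (\<Gamma> t) \<le> energy C \<kappa> \<epsilon> Th \<Omega> \<Omega>' v \<eta> (\<Gamma> t)) \<and>
    abs_continuous_on {0..1} (\<lambda>t. energy C \<kappa> \<epsilon> Th \<Omega> \<Omega>' (u t) (\<gamma> t) (\<Gamma> t)) \<and>
    set_integrable lebesgue {0..1}
      (\<lambda>s. LINT x:\<Omega>|lebesgue. (grad (u s) x - \<gamma> s x) \<bullet> (C *v dt_grad w s x)) \<and>
    (\<forall>t\<in>{0..1}. energy C \<kappa> \<epsilon> Th \<Omega> \<Omega>' (u t) (\<gamma> t) (\<Gamma> t) =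
       energy C \<kappa> \<epsilon> Th \<Omega> \<Omega>' (u 0) (\<gamma> 0) {} +
       2 * (LINT s:{0..t}|lebesgue.
              LINT x:\<Omega>|lebesgue. (grad (u s) x - \<gamma> s x) \<bullet> (C *v dt_grad w s x)))"


section \<open>Time-discrete solutions\<close>

text \<open>\<open>\<tau> m i\<close> is the \<open>i\<close>-th point of the \<open>m\<close>-th partition, for \<open>i \<le> m\<close>.\<close>

definition time_partitions :: "real set \<Rightarrow> (nat \<Rightarrow> nat \<Rightarrow> real) \<Rightarrow> bool" where
  "time_partitions I \<tau> \<longleftrightarrow>
    I \<subseteq> {0..1} \<and> {0..1} \<subseteq> closure I \<and> 0 \<in> I \<and>
    (\<forall>m. \<tau> m 0 = 0 \<and> (\<forall>i<m. \<tau> m i < \<tau> m (Suc i))) \<and>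
    (\<forall>m. \<tau> m ` {..m} \<subseteq> \<tau> (Suc m) ` {..Suc m}) \<and>
    (\<Union>m. \<tau> m ` {..m}) = I \<and>
    (\<lambda>m. MAX i\<in>{1..m}. \<tau> m i - \<tau> m (i - 1)) \<longlonglongrightarrow> 0"

definition crack_set ::
    "(real ^ 'n) set set \<Rightarrow> (real ^ 'n) set \<Rightarrow> (nat \<Rightarrow> real ^ 'n \<Rightarrow> real ^ 'n) \<Rightarrow> nat \<Rightarrow> (real ^ 'n) set" where
  "crack_set Th \<Omega>' \<gamma> i = (\<Union>k\<le>i. nonzero_set Th \<Omega>' (\<gamma> k))"

definition time_discrete_solution ::
    "real ^ 'n ^ 'n \<Rightarrow> real \<Rightarrow> real \<Rightarrow> (real ^ 'n) set set \<Rightarrow> (real ^ 'n) set \<Rightarrow> (real ^ 'n) set \<Rightarrow>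
     (real \<Rightarrow> real ^ 'n \<Rightarrow> real) \<Rightarrow> (nat \<Rightarrow> nat \<Rightarrow> real) \<Rightarrow>
     (nat \<Rightarrow> nat \<Rightarrow> real ^ 'n \<Rightarrow> real) \<Rightarrow> (nat \<Rightarrow> nat \<Rightarrow> real ^ 'n \<Rightarrow> real ^ 'n) \<Rightarrow> bool" where
  "time_discrete_solution C \<kappa> \<epsilon> Th \<Omega> \<Omega>' w \<tau> u \<gamma> \<longleftrightarrow>
    (\<forall>m. u m 0 = u 0 0 \<and> \<gamma> m 0 = \<gamma> 0 0) \<and>
    (\<forall>m. minimizer C \<kappa> \<epsilon> Th \<Omega> \<Omega>' (w 0) {} (u m 0) (\<gamma> m 0)) \<and>
    (\<forall>m. \<forall>i<m. minimizer C \<kappa> \<epsilon> Th \<Omega> \<Omega>' (w (\<tau> m (Suc i))) (crack_set Th \<Omega>' (\<gamma> m) i)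
                  (u m (Suc i)) (\<gamma> m (Suc i)))"

text \<open>\<open>k m\<close> is the index of the last point of the \<open>m\<close>-th partition that is not after \<open>t\<close>.\<close>

definition step_index :: "(nat \<Rightarrow> nat \<Rightarrow> real) \<Rightarrow> real \<Rightarrow> (nat \<Rightarrow> nat) \<Rightarrow> bool" where
  "step_index \<tau> t k \<longleftrightarrow>
    (\<forall>m. k m \<le> m \<and> \<tau> m (k m) \<le> t \<and> (k m < m \<longrightarrow> t < \<tau> m (Suc (k m))))"

definition Lp_tendsto ::
    "nat \<Rightarrow> (real ^ 'n) set \<Rightarrow> (nat \<Rightarrow> real ^ 'n \<Rightarrow> 'b :: real_normed_vector) \<Rightarrow> (real ^ 'n \<Rightarrow> 'b) \<Rightarrow> bool" where
  "Lp_tendsto p S f F \<longleftrightarrow>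
    (\<lambda>n. \<integral>\<^sup>+x\<in>S. ennreal (norm (f n x - F x) ^ p) \<partial>lebesgue) \<longlonglongrightarrow> 0"

text \<open>
  The set \<open>G\<close> on which the displacements converge: the largest open subset of \<open>\<Omega>'\<close> that is disjoint
  from \<open>U\<close> and in which every point is connected to \<open>\<Omega>' - closure \<Omega>\<close>, where the boundary values are
  prescribed. Pieces of the body cut off from there are excluded, since the displacement is
  determined on them only up to additive constants. If \<open>U\<close> does not meet \<open>\<Omega>' - closure \<Omega>\<close>, then
  \<open>\<Omega>' - closure \<Omega> \<subseteq> G\<close>.
\<close>

definition attached_part ::
    "(real ^ 'n) set \<Rightarrow> (real ^ 'n) set \<Rightarrow> (real ^ 'n) set \<Rightarrow> (real ^ 'n) set" where
  "attached_part \<Omega> \<Omega>' U = \<Union>{A. open A \<and> A \<subseteq> \<Omega>' \<and> U \<inter> A = {} \<and>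
     (\<forall>K\<in>components A. K \<inter> (\<Omega>' - closure \<Omega>) \<noteq> {})}"

lemma attached_part_largest:
  fixes \<Omega> \<Omega>' U :: "(real ^ 'n) set"
  defines "G \<equiv> attached_part \<Omega> \<Omega>' U"
  shows "open G" "G \<subseteq> \<Omega>'" "U \<inter> G = {}" "\<And>K. K \<in> components G \<Longrightarrow> K \<inter> (\<Omega>' - closure \<Omega>) \<noteq> {}"
proof -
  show "open G" "G \<subseteq> \<Omega>'" "U \<inter> G = {}"
    by (auto simp: G_def attached_part_def)
  fix K assume K: "K \<in> components G"
  then obtain x where x: "x \<in> K" "x \<in> G" "K = connected_component_set G x"
    by (auto simp: components_iff)
  then obtain A where A: "x \<in> A" "A \<subseteq> G" and
    meets: "\<And>K'. K' \<in> components A \<Longrightarrow> K' \<inter> (\<Omega>' - closure \<Omega>) \<noteq> {}"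
    unfolding G_def attached_part_def by blast
  have "connected_component_set A x \<subseteq> K"
    using A x connected_component_mono by blast
  moreover have "connected_component_set A x \<in> components A"
    using A by (simp add: componentsI)
  ultimately show "K \<inter> (\<Omega>' - closure \<Omega>) \<noteq> {}"
    using meets by blast
qed

lemma Dirichlet_part_subset_attached_part:
  assumes "open (\<Omega>' - closure \<Omega>)" "U \<inter> (\<Omega>' - closure \<Omega>) = {}"
  shows "\<Omega>' - closure \<Omega> \<subseteq> attached_part \<Omega> \<Omega>' U"
proof -
  have "\<forall>K\<in>components (\<Omega>' - closure \<Omega>). K \<inter> (\<Omega>' - closure \<Omega>) \<noteq> {}"
    using in_components_nonempty in_components_subset by blast
  then show ?thesis
    unfolding attached_part_def using assms by blast
qed

end

theory Submission
  imports Defs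
begin

text \<open>
  The mesh is fixed, so the problem is finite-dimensional in disguise. Only finitely many cells \<open>T\<close>
  meet \<open>\<Omega>'\<close>. On each of them \<open>u\<close> has a constant slope and \<open>\<gamma>\<close> a constant value, and the closure of
  \<open>{\<gamma> \<noteq> 0}\<close> is the union of the cells on which that value is nonzero. The energy therefore sees only
  the slopes, the values, and the finite set \<open>P\<close> of cracked cells (\<open>energy_formula\<close>). For a given
  \<open>P\<close> it is optimal that \<open>\<gamma>\<close> cancels the slope on \<open>P\<close> and vanishes elsewhere; what is left is a
  semidefinite quadratic form in the free nodal values. Its minimisers exist, share one strain on every
  uncracked cell that meets \<open>\<Omega>\<close>, and this strain is linear in the nodal values of the datum
  (\<open>strain_linear\<close>). So with \<open>total P f\<close>, the least elastic energy for the crack \<open>P\<close> and the datum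
  \<open>f\<close> plus the energy of the crack, a time step amounts to choosing the best \<open>P\<close> among the finitely many
  sets of cells containing the old crack (\<open>minimizer_exists\<close>, \<open>minimizer_properties\<close>).

  Compactness in time is then Helly's theorem for monotone maps into the subsets of a finite set: along a
  subsequence the discrete crack at every time \<open>t\<close> is eventually \<^emph>\<open>equal\<close> to a limit \<open>P(t)\<close>
  (\<open>helly_selection_finite_sets\<close>). Energies and strains at time \<open>t\<close> are continuous functions of the
  datum once the crack is fixed, so they converge, and minimality passes to the limit
  (\<open>energy_stability\<close>).

  For the energy balance, comparison with the previous crack bounds the increase of the energy
  between two times by a multiple of the variation of the datum, and stability bounds the decrease in the
  same way (\<open>energy_lipschitz\<close>). Hence the energy is absolutely continuous; in particular the
  creation of new crack does not make it jump. Since \<open>P(t)\<close> is monotone with finitely many values,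
  \<open>[0,1]\<close> splits into finitely many intervals on which it is constant. There the energy is, up to a
  constant, a quadratic function of the datum, whose increments are the work of the load
  (\<open>elastic_balance\<close>); continuity glues the intervals together (\<open>energy_balance\<close>).

  The displacements converge because on every uncracked cell the difference between the discrete and the
  limiting one is affine with slope tending to zero. Convergence at one point of a cell therefore spreads
  to the whole cell and to its neighbours; it starts at the cells that carry boundary values and reaches
  every component that touches them (\<open>displacement_convergence\<close>).

  Two analytic facts about \<open>g\<close> are used. The nodal values of \<open>g'\<close> are integrable in time, because the
  \<open>W\<^sup>2\<^sup>,\<^sup>\<infinity>\<close> norm dominates point values; this rests on the uniqueness of weak derivatives. And the nodal
  values of \<open>g\<close> have the classical derivative \<open>g'\<close> almost everywhere, which is Lebesgue's
  differentiation theorem on the line.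
\<close>

section \<open>Lebesgue differentiation on the line\<close>

text \<open>
  At a bad point \<open>x\<close> there are arbitrarily short intervals with endpoint \<open>x\<close> on which the Riemann term
  \<open>(v - u) f(x)\<close> misses the integral by a fixed fraction of the length. Henstock's lemma makes the sum of
  these errors small over any finite disjoint family that is fine for the gauge, hence also the total
  length; the Vitali covering lemma extracts such a family whose fivefold enlargement covers all bad points.
\<close>

lemma negligible_bad_density_points:
  fixes f :: "real \<Rightarrow> real"
  assumes f: "f integrable_on {a..b}" and N: "0 < N"
  shows "negligible {x. \<forall>d>0. \<exists>u v. u < v \<and> a \<le> u \<and> v \<le> b \<and> (x = u \<or> x = v) \<and> v - u < d \<and>
            v - u \<le> N * \<bar>(v - u) * f x - integral {u..v} f\<bar>}" (is "negligible ?E")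
  unfolding negligible_outer_le
proof (intro allI impI)
  fix e :: real assume e: "e > 0"
  (* the 5 is the enlargement factor of the covering lemma *)
  define e' where "e' = e / (5 * N)"
  have e': "e' > 0" using e N by (simp add: e'_def)
  have f': "f integrable_on cbox a b" using f by simp
  obtain g where g: "gauge g"
    and gle: "\<And>p. \<lbrakk>p tagged_partial_division_of (cbox a b); g fine p\<rbrakk> \<Longrightarrow>
             sum (\<lambda>(x,k). norm (measure lborel k *\<^sub>R f x - integral k f)) p < e'"
    using Henstock_lemma[OF f' e'] by blast
  define K where "K = {(x,u,v). u < v \<and> a \<le> u \<and> v \<le> b \<and> (x = u \<or> x = v) \<and> {u..v} \<subseteq> g x \<and>
            v - u \<le> N * \<bar>(v - u) * f x - integral {u..v} f\<bar>}"
  define c where "c = (\<lambda>(x::real,u::real,v::real). (u + v) / 2)"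
  define r where "r = (\<lambda>(x::real,u::real,v::real). (v - u) / 2)"
  have cb: "cball (c (x,u,v)) (r (x,u,v)) = {u..v}" for x u v
    by (auto simp: c_def r_def cball_def dist_real_def abs_if field_simps split: if_splits)
  have cover: "?E \<subseteq> (\<Union>i\<in>K. cball (c i) (r i))"
  proof
    fix x assume x: "x \<in> ?E"
    obtain d where d: "d > 0" "ball x d \<subseteq> g x"
      using g by (meson gauge_def open_contains_ball)
    then obtain u v where uv: "u < v" "a \<le> u" "v \<le> b" "x = u \<or> x = v" "v - u < d"
            "v - u \<le> N * \<bar>(v - u) * f x - integral {u..v} f\<bar>"
      using x by blast
    have "{u..v} \<subseteq> ball x d" using uv by (auto simp: dist_real_def)
    then have "(x,u,v) \<in> K" using uv d by (auto simp: K_def)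
    moreover have "x \<in> cball (c (x,u,v)) (r (x,u,v))" using uv unfolding cb by auto
    ultimately show "x \<in> (\<Union>i\<in>K. cball (c i) (r i))" by blast
  qed
  have rK: "\<And>i. i \<in> K \<Longrightarrow> 0 < r i \<and> r i \<le> b - a"
    by (auto simp: K_def r_def)
  obtain D where D: "countable D" "D \<subseteq> K"
     "pairwise (\<lambda>i j. disjnt (cball (c i) (r i)) (cball (c j) (r j))) D"
     "?E \<subseteq> (\<Union>i\<in>D. cball (c i) (5 * r i))"
    by (rule Vitali_covering_lemma_cballs[OF cover rK])
  have fin: "(\<Sum>i\<in>D'. 5 * (2 * r i)) \<le> e" if D': "D' \<subseteq> D" "finite D'" for D'
  proof -
    define q where "q = (\<lambda>(x::real,u::real,v::real). (x, {u..v}))"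
    have inj: "inj_on q D'"
    proof (rule inj_onI)
      fix i j assume ij: "i \<in> D'" "j \<in> D'" "q i = q j"
      obtain x u v x' u' v' where eq: "i = (x,u,v)" "j = (x',u',v')" by (metis prod_cases3)
      have "u < v" "u' < v'" using ij eq D D' by (auto simp: K_def)
      then show "i = j" using ij eq by (auto simp: q_def Icc_eq_Icc)
    qed
    have tp: "q ` D' tagged_partial_division_of cbox a b"
      unfolding tagged_partial_division_of_def
    proof (intro conjI allI impI)
      show "finite (q ` D')" using D' by simp
      fix x k assume "(x,k) \<in> q ` D'"
      then obtain u v where uv: "(x,u,v) \<in> D'" "k = {u..v}" by (auto simp: q_def)
      then have "(x,u,v) \<in> K" using D D' by blast
      then show "x \<in> k" "k \<subseteq> cbox a b" "\<exists>a b. k = cbox a b" using uv by (auto simp: K_def)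
    next
      fix x k x' k'
      assume *: "(x,k) \<in> q ` D' \<and> (x',k') \<in> q ` D' \<and> (x, k) \<noteq> (x', k')"
      then obtain u v where uv: "(x,u,v) \<in> D'" "k = {u..v}" by (auto simp: q_def)
      from * obtain u' v' where uv': "(x',u',v') \<in> D'" "k' = {u'..v'}" by (auto simp: q_def)
      from * have "(x,u,v) \<noteq> (x',u',v')" using uv uv' by auto
      then have "disjnt (cball (c (x,u,v)) (r (x,u,v))) (cball (c (x',u',v')) (r (x',u',v')))"
        using pairwiseD[OF D(3), of "(x,u,v)" "(x',u',v')"] uv uv' D' by blast
      then have "disjnt {u..v} {u'..v'}" by (simp add: cb)
      then show "interior k \<inter> interior k' = {}" unfolding uv uv' disjnt_def
        using interior_subset[of "{u..v}"] interior_subset[of "{u'..v'}"] by blast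
    qed
    have fine: "g fine q ` D'" using D(2) D' by (auto simp: fine_def q_def K_def)
    have "(\<Sum>i\<in>D'. 5 * (2 * r i)) \<le> (\<Sum>i\<in>D'. 5 * N * (\<lambda>(x,k). norm (measure lborel k *\<^sub>R f x - integral k f)) (q i))"
    proof (rule sum_mono)
      fix i assume "i \<in> D'"
      then have "i \<in> K" using D D' by blast
      moreover obtain x u v where "i = (x,u,v)" by (metis prod_cases3)
      ultimately show "5 * (2 * r i) \<le> 5 * N * (\<lambda>(x,k). norm (measure lborel k *\<^sub>R f x - integral k f)) (q i)"
        by (auto simp: K_def r_def q_def)
    qed
    also have "\<dots> = 5 * N * (\<Sum>i\<in>D'. (\<lambda>(x,k). norm (measure lborel k *\<^sub>R f x - integral k f)) (q i))"
      by (simp add: sum_distrib_left)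
    also have "\<dots> = 5 * N * (\<Sum>z\<in>q ` D'. (\<lambda>(x,k). norm (measure lborel k *\<^sub>R f x - integral k f)) z)"
      using sum.reindex[OF inj, of "\<lambda>(x,k). norm (measure lborel k *\<^sub>R f x - integral k f)"] by (simp add: o_def)
    also have "\<dots> \<le> 5 * N * e'"
      using gle[OF tp fine] N by (intro mult_left_mono) auto
    also have "\<dots> = e" using N by (simp add: e'_def)
    finally show ?thesis .
  qed
  let ?T = "\<Union>i\<in>D. cball (c i) (5 * r i)"
  have me: "measure lebesgue (\<Union>i\<in>D'. cball (c i) (5 * r i)) \<le> e" if D': "D' \<subseteq> D" "finite D'" for D'
  proof -
    have "measure lebesgue (\<Union>i\<in>D'. cball (c i) (5 * r i)) \<le> (\<Sum>i\<in>D'. measure lebesgue (cball (c i) (5 * r i)))"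
      using D' by (intro measure_UNION_le) auto
    also have "\<dots> = (\<Sum>i\<in>D'. 5 * (2 * r i))"
    proof (rule sum.cong[OF refl])
      fix i assume "i \<in> D'"
      then have "r i > 0" using rK D D' by blast
      then show "measure lebesgue (cball (c i) (5 * r i)) = 5 * (2 * r i)"
        by (simp add: cball_eq_atLeastAtMost)
    qed
    also have "\<dots> \<le> e" by (rule fin[OF D'])
    finally show ?thesis .
  qed
  have "?T \<in> lmeasurable" 
    by (rule fmeasurable_UN_bound[OF D(1) _ me]) auto
  moreover have "measure lebesgue ?T \<le> e"
    by (rule measure_UN_bound[OF D(1) _ me]) auto
  ultimately show "\<exists>T. ?E \<subseteq> T \<and> T \<in> lmeasurable \<and> measure lebesgue T \<le> e"
    using D(4) by blast
qed

lemma lebesgue_differentiation_integral: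
  fixes f :: "real \<Rightarrow> real"
  assumes f: "f integrable_on {a..b}"
  shows "AE s in lebesgue. s \<in> {a..b} \<longrightarrow>
     ((\<lambda>t. integral {a..t} f) has_vector_derivative f s) (at s within {a..b})"
proof -
  define E where "E N = {x. \<forall>d>0. \<exists>u v. u < v \<and> a \<le> u \<and> v \<le> b \<and> (x = u \<or> x = v) \<and> v - u < d \<and>
            v - u \<le> real (Suc N) * \<bar>(v - u) * f x - integral {u..v} f\<bar>}" for N
  have "negligible (\<Union>N. E N)"
    unfolding E_def by (intro negligible_countable_Union countable_image)
       (auto intro!: negligible_bad_density_points[OF f])
  then have null: "(\<Union>N. E N) \<in> null_sets lebesgue" by (simp add: negligible_iff_null_sets)
  let ?P = "\<lambda>s. s \<in> {a..b} \<longrightarrow>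
      ((\<lambda>t. integral {a..t} f) has_vector_derivative f s) (at s within {a..b})"
  have "{s \<in> space lebesgue. \<not> ?P s} \<subseteq> (\<Union>N. E N)"
  proof (rule subsetI)
    fix s
    assume "s \<in> {s \<in> space lebesgue. \<not> (s \<in> {a..b} \<longrightarrow>
      ((\<lambda>t. integral {a..t} f) has_vector_derivative f s) (at s within {a..b}))}"
    then have s: "s \<in> {a..b}"
      and nd: "\<not> ((\<lambda>t. integral {a..t} f) has_vector_derivative f s) (at s within {a..b})"
      by auto
    obtain e where e: "e > 0" and bad: "\<And>d. d > 0 \<Longrightarrow> \<exists>y\<in>{a..b}. norm (y - s) < d \<and>
       \<not> norm (integral {a..y} f - integral {a..s} f - (y - s) *\<^sub>R f s) \<le> e * norm (y - s)"
      using nd unfolding has_vector_derivative_def has_derivative_within_alt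
      by (auto intro: bounded_linear_mult_left)
    obtain N where "1 / e < real N" using reals_Archimedean2 by blast
    then have N: "1 / e < real (Suc N)" by simp
    have "s \<in> E N" unfolding E_def mem_Collect_eq
    proof (intro allI impI)
      fix d :: real assume "d > 0"
      then obtain y where y: "y \<in> {a..b}" "\<bar>y - s\<bar> < d"
        "\<bar>integral {a..y} f - integral {a..s} f - (y - s) * f s\<bar> > e * \<bar>y - s\<bar>"
        using bad by fastforce
      define u v where "u = min y s" and "v = max y s"
      have ys: "y \<noteq> s" using y by auto
      have uv: "u < v" "a \<le> u" "v \<le> b" "s = u \<or> s = v" "v - u < d"
        using y s ys by (auto simp: u_def v_def)
      have "integral {a..u} f + integral {u..v} f = integral {a..v} f"
        by (rule Henstock_Kurzweil_Integration.integral_combine)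
           (use uv in \<open>auto intro: integrable_on_subinterval[OF f]\<close>)
      then have "\<bar>(v - u) * f s - integral {u..v} f\<bar> = \<bar>integral {a..y} f - integral {a..s} f - (y - s) * f s\<bar>"
        by (auto simp: u_def v_def min_def max_def algebra_simps split: if_splits)
      moreover have "v - u = \<bar>y - s\<bar>" by (auto simp: u_def v_def)
      ultimately have "e * (v - u) < \<bar>(v - u) * f s - integral {u..v} f\<bar>" using y by simp
      then have "v - u < (1 / e) * \<bar>(v - u) * f s - integral {u..v} f\<bar>" using e by (simp add: field_simps)
      also have "\<dots> \<le> real (Suc N) * \<bar>(v - u) * f s - integral {u..v} f\<bar>"
        using N by (intro mult_right_mono) auto
      finally show "\<exists>u v. u < v \<and> a \<le> u \<and> v \<le> b \<and> (s = u \<or> s = v) \<and> v - u < d \<and>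
            v - u \<le> real (Suc N) * \<bar>(v - u) * f s - integral {u..v} f\<bar>"
        using uv by (intro exI[of _ u] exI[of _ v]) auto
    qed
    then show "s \<in> (\<Union>N. E N)" by blast
  qed
  then show ?thesis by (rule AE_I'[OF null])
qed

section \<open>Smooth bump functions\<close>

text \<open>
  The smooth functions \<open>exp(-1/s)\<close>, extended by zero to \<open>s \<le> 0\<close>, with a polynomial factor in \<open>1/s\<close>: the
  factor is what makes the family closed under differentiation.
\<close>

definition flat_exp :: "real poly \<Rightarrow> real \<Rightarrow> real" where
  "flat_exp p s = (if 0 < s then poly p (1 / s) * exp (- (1 / s)) else 0)"

lemma poly_times_exp_minus_tendsto_0:
  "((\<lambda>x. poly p x * exp (- x)) \<longlongrightarrow> 0) (at_top :: real filter)"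
proof -
  have "((\<lambda>x. \<Sum>i\<le>degree p. coeff p i * (x ^ i / exp x)) \<longlongrightarrow> (\<Sum>i\<le>degree p. coeff p i * 0)) (at_top :: real filter)"
    by (intro tendsto_intros tendsto_power_div_exp_0)
  moreover have "(\<lambda>x. \<Sum>i\<le>degree p. coeff p i * (x ^ i / exp x)) = (\<lambda>x::real. poly p x * exp (- x))"
    by (simp add: poly_altdef sum_distrib_right exp_minus divide_inverse mult.assoc)
  ultimately show ?thesis by simp
qed

text \<open>
  The new polynomial comes from \<open>(1/s)' = - 1/s\<^sup>2\<close>, applied to both factors. At \<open>0\<close> the difference quotient
  vanishes because exponential decay beats every power.
\<close>

lemma flat_exp_has_derivative:
  "(flat_exp p has_real_derivative flat_exp ([:0, 0, 1:] * (p - pderiv p)) s) (at s)"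
proof -
  consider "s < 0" | "s = 0" | "s > 0" by linarith
  then show ?thesis
  proof cases
    case 1
    have "((\<lambda>_. 0::real) has_real_derivative 0) (at s)" by simp
    moreover have "\<forall>\<^sub>F x in nhds s. 0 = flat_exp p x"
      using 1 eventually_nhds_in_open[of "{..<0}" s] by (auto simp: flat_exp_def elim!: eventually_mono)
    ultimately have "(flat_exp p has_real_derivative 0) (at s)"
      by (rule DERIV_cong_ev[OF refl _ refl, THEN iffD1, rotated])
    then show ?thesis using 1 by (simp add: flat_exp_def)
  next
    case 3
    have "((\<lambda>s. poly p (1 / s) * exp (- (1 / s))) has_real_derivative
       poly ([:0, 0, 1:] * (p - pderiv p)) (1 / s) * exp (- (1 / s))) (at s)"
      using 3 by (auto intro!: derivative_eq_intros simp: field_simps power2_eq_square)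
    moreover have "\<forall>\<^sub>F x in nhds s. flat_exp p x = poly p (1 / x) * exp (- (1 / x))"
      using 3 eventually_nhds_in_open[of "{0<..}" s] by (auto simp: flat_exp_def elim!: eventually_mono)
    ultimately show ?thesis using 3
      by (subst DERIV_cong_ev[OF refl]) (auto simp: flat_exp_def)
  next
    case 2
    have "((\<lambda>h. flat_exp p h / h) \<longlongrightarrow> 0) (at_right 0)"
    proof -
      have "((\<lambda>h. poly (p * [:0,1:]) (1 / h) * exp (- (1 / h))) \<longlongrightarrow> 0) (at_right (0::real))"
        using filterlim_compose[OF poly_times_exp_minus_tendsto_0[of "p * [:0,1:]"] filterlim_inverse_at_top_right]
        by (simp add: inverse_eq_divide)
      then show ?thesis
        by (rule Lim_transform_eventually) (auto simp: flat_exp_def eventually_at_right_less eventually_at_filter)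
    qed
    moreover have "((\<lambda>h. flat_exp p h / h) \<longlongrightarrow> 0) (at_left 0)"
      by (rule Lim_transform_eventually[OF tendsto_const]) (auto simp: flat_exp_def eventually_at_filter)
    ultimately have "((\<lambda>h. flat_exp p h / h) \<longlongrightarrow> 0) (at 0)"
      by (simp add: filterlim_split_at)
    then show ?thesis using 2 by (simp add: DERIV_def flat_exp_def)
  qed
qed

text \<open>
  A class of functions closed under partial derivatives that contains the bumps below. Membership replaces
  a theory of smooth functions: closure under one derivative gives all iterated derivatives at once.
\<close>

inductive_set smooth_class :: "(real ^ 'n \<Rightarrow> real) set" where
  const: "(\<lambda>x. c) \<in> smooth_class"
| flat: "(\<lambda>x. flat_exp p (v \<bullet> x + c)) \<in> smooth_class"
| add: "f \<in> smooth_class \<Longrightarrow> g \<in> smooth_class \<Longrightarrow> (\<lambda>x. f x + g x) \<in> smooth_class"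
| mult: "f \<in> smooth_class \<Longrightarrow> g \<in> smooth_class \<Longrightarrow> (\<lambda>x. f x * g x) \<in> smooth_class"

lemma partial_deriv_eqI:
  assumes "\<And>x. (f has_derivative f' x) (at x)"
  shows "partial_deriv i f = (\<lambda>x. f' x (axis i 1))"
  unfolding partial_deriv_def fun_eq_iff using frechet_derivative_at[OF assms] by simp

lemma smooth_class_closed_partial_deriv:
  fixes f :: "real ^ 'n \<Rightarrow> real"
  assumes "f \<in> smooth_class"
  shows "(\<forall>x. f differentiable at x) \<and> (\<forall>i. partial_deriv i f \<in> smooth_class)"
  using assms
proof induction
  case (const c)
  have "partial_deriv i (\<lambda>x. c) = (\<lambda>x. 0)" for i :: 'n
    by (rule partial_deriv_eqI) simp
  then show ?case by (auto intro: smooth_class.const)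
next
  case (flat p v c)
  define q where "q = [:0, 0, 1:] * (p - pderiv p)"
  have d: "((\<lambda>x. flat_exp p (v \<bullet> x + c)) has_derivative (\<lambda>h. flat_exp q (v \<bullet> x + c) * (v \<bullet> h))) (at x)" for x
  proof -
    have "((\<lambda>x. v \<bullet> x + c) has_derivative (\<lambda>h. v \<bullet> h)) (at x)"
      by (auto intro!: derivative_eq_intros)
    from has_derivative_compose[OF this flat_exp_has_derivative[of p "v \<bullet> x + c", unfolded has_field_derivative_def]]
    show ?thesis unfolding q_def by simp
  qed
  have "partial_deriv i (\<lambda>x. flat_exp p (v \<bullet> x + c)) = (\<lambda>x. flat_exp (smult (v $ i) q) (v \<bullet> x + c))" for i
    by (subst partial_deriv_eqI[OF d]) (auto simp: flat_exp_def inner_axis fun_eq_iff)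
  then show ?case using d by (auto simp: differentiable_def intro: smooth_class.flat)
next
  case (add f g)
  have d: "((\<lambda>x. f x + g x) has_derivative (\<lambda>h. frechet_derivative f (at x) h + frechet_derivative g (at x) h)) (at x)" for x
    using add.IH by (intro has_derivative_add) (auto simp: frechet_derivative_works)
  have "partial_deriv i (\<lambda>x. f x + g x) = (\<lambda>x. partial_deriv i f x + partial_deriv i g x)" for i
    by (subst partial_deriv_eqI[OF d]) (auto simp: partial_deriv_def)
  then show ?case using d add.IH by (auto simp: differentiable_def intro: smooth_class.add)
next
  case (mult f g)
  have d: "((\<lambda>x. f x * g x) has_derivative (\<lambda>h. f x * frechet_derivative g (at x) h + frechet_derivative f (at x) h * g x)) (at x)" for x
    using mult.IH by (intro has_derivative_mult) (auto simp: frechet_derivative_works)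
  have "partial_deriv i (\<lambda>x. f x * g x) = (\<lambda>x. f x * partial_deriv i g x + partial_deriv i f x * g x)" for i
    by (subst partial_deriv_eqI[OF d]) (auto simp: partial_deriv_def)
  then show ?case using d mult by (auto simp: differentiable_def intro!: smooth_class.add smooth_class.mult)
qed

lemma smooth_class_partial_derivs: "f \<in> smooth_class \<Longrightarrow> partial_derivs js f \<in> smooth_class"
  by (induction js) (auto simp: smooth_class_closed_partial_deriv)

lemma smooth_class_imp_test_function:
  assumes "f \<in> smooth_class" "\<And>x. x \<notin> K \<Longrightarrow> f x = 0" "bounded K"
  shows "test_function f"
proof -
  have "bounded {x. f x \<noteq> 0}" using assms by (auto intro: bounded_subset)
  then show ?thesis
    unfolding test_function_def differentiable_on_def
    using smooth_class_closed_partial_deriv[OF smooth_class_partial_derivs[OF assms(1)]]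
    by (auto simp: compact_closure)
qed

text \<open>
  Smooth functions supported in the open box \<open>(a,b)\<close> that increase to its indicator as \<open>k \<rightarrow> \<infinity>\<close>.
\<close>

definition box_bump :: "real ^ 'n \<Rightarrow> real ^ 'n \<Rightarrow> nat \<Rightarrow> real ^ 'n \<Rightarrow> real" where
  "box_bump a b k x = (\<Prod>i\<in>UNIV. flat_exp 1 (real (Suc k) * (x $ i - a $ i)) * flat_exp 1 (real (Suc k) * (b $ i - x $ i)))"

lemma flat_exp_1_bounds: "0 \<le> flat_exp 1 s" "flat_exp 1 s \<le> 1"
  by (auto simp: flat_exp_def)

lemma box_bump_zero: "x \<notin> box a b \<Longrightarrow> box_bump a b k x = 0"
proof -
  assume "x \<notin> box a b"
  then obtain i where "x $ i - a $ i \<le> 0 \<or> b $ i - x $ i \<le> 0" by (force simp: mem_box_cart not_less)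
  then have "flat_exp 1 (real (Suc k) * (x $ i - a $ i)) * flat_exp 1 (real (Suc k) * (b $ i - x $ i)) = 0"
    by (auto simp: flat_exp_def zero_less_mult_iff)
  then show ?thesis unfolding box_bump_def by (intro prod_zero) auto
qed

lemma box_bump_bounds: "0 \<le> box_bump a b k x" "box_bump a b k x \<le> 1"
proof -
  show "0 \<le> box_bump a b k x" unfolding box_bump_def
    by (intro prod_nonneg) (auto simp: flat_exp_1_bounds)
  show "box_bump a b k x \<le> 1" unfolding box_bump_def
    by (intro prod_le_1) (auto simp: flat_exp_1_bounds intro: mult_le_one)
qed

lemma box_bump_test: "test_function (box_bump a b k)"
proof (rule smooth_class_imp_test_function[OF _ box_bump_zero bounded_box])
  let ?f = "\<lambda>i x. flat_exp 1 (real (Suc k) * (x $ i - a $ i)) * flat_exp 1 (real (Suc k) * (b $ i - x $ i))"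
  have 1: "?f i \<in> smooth_class" for i
  proof -
    have "(\<lambda>x. flat_exp 1 ((real (Suc k) *\<^sub>R axis i 1) \<bullet> x + (- real (Suc k) * a $ i)) * 
             flat_exp 1 ((- real (Suc k) *\<^sub>R axis i 1) \<bullet> x + (real (Suc k) * b $ i))) \<in> smooth_class"
      by (intro smooth_class.mult smooth_class.flat)
    then show ?thesis by (simp add: inner_axis' algebra_simps)
  qed
  have "finite J \<Longrightarrow> (\<lambda>x. \<Prod>i\<in>J. ?f i x) \<in> smooth_class" for J
  proof (induction J rule: finite_induct)
    case empty then show ?case by (simp add: smooth_class.const)
  next
    case (insert i J)
    then show ?case using smooth_class.mult[OF 1[of i] insert.IH] by simp
  qed
  then show "box_bump a b k \<in> smooth_class" unfolding box_bump_def[abs_def] by simp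
qed

lemma box_bump_tendsto: "(\<lambda>k. box_bump a b k x) \<longlonglongrightarrow> indicator (box a b) x"
proof (cases "x \<in> box a b")
  case False then show ?thesis by (simp add: box_bump_zero)
next
  case True
  have 1: "(\<lambda>k. flat_exp 1 (real (Suc k) * s)) \<longlonglongrightarrow> 1" if "s > 0" for s
  proof -
    have "(\<lambda>k. exp (- (1 / s * inverse (real (Suc k))))) \<longlonglongrightarrow> exp (- (1 / s * 0))"
      by (intro tendsto_intros LIMSEQ_inverse_real_of_nat)
    moreover have "flat_exp 1 (real (Suc k) * s) = exp (- (1 / s * inverse (real (Suc k))))" for k
      using that by (simp add: flat_exp_def field_simps del: of_nat_Suc)
    ultimately show ?thesis by simp
  qed
  have "(\<lambda>k. box_bump a b k x) \<longlonglongrightarrow> (\<Prod>i\<in>(UNIV::'a set). 1 * 1)"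
    unfolding box_bump_def using True by (intro tendsto_intros 1) (auto simp: mem_box_cart)
  then show ?thesis using True by simp
qed

lemma partial_derivs_zero_outside_support:
  assumes "x \<notin> closure {x. \<phi> x \<noteq> 0}"
  shows "partial_derivs js \<phi> x = 0"
  using assms
proof (induction js arbitrary: x)
  case Nil
  then have "x \<notin> {x. \<phi> x \<noteq> 0}" using closure_subset[of "{x. \<phi> x \<noteq> 0}"] by (meson subsetD)
  then show ?case by simp
next
  case (Cons i js)
  have op: "open (- closure {x. \<phi> x \<noteq> 0})" by auto
  have "((\<lambda>_. 0) has_derivative (\<lambda>_. 0)) (at x)" by simp
  then have "(partial_derivs js \<phi> has_derivative (\<lambda>_. 0)) (at x)"
    by (rule has_derivative_transform_within_open[OF _ op]) (use Cons in auto)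
  then show ?case by (simp add: partial_deriv_def frechet_derivative_at[symmetric])
qed

lemma test_function_continuous: "test_function \<phi> \<Longrightarrow> continuous_on UNIV (partial_derivs js \<phi>)"
  by (auto simp: test_function_def intro: differentiable_imp_continuous_on)

lemma continuous_imp_lebesgue_measurable:
  "continuous_on UNIV f \<Longrightarrow> f \<in> borel_measurable lebesgue" for f :: "real ^ 'n \<Rightarrow> real"
  using borel_measurable_continuous_onI measurable_completion
  by (metis measurable_lborel2 )

lemma integrable_mult_test:
  assumes "locally_integrable f" "test_function \<phi>"
  shows "integrable lebesgue (\<lambda>x. f x * partial_derivs js \<phi> x)"
proof -
  let ?K = "closure {x. \<phi> x \<noteq> 0}" and ?D = "partial_derivs js \<phi>"
  have K: "compact ?K" using assms by (simp add: test_function_def)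
  have c: "continuous_on UNIV ?D" using assms by (intro test_function_continuous)
  then have "compact (?D ` ?K)" using K by (meson compact_continuous_image continuous_on_subset top_greatest)
  then obtain B where B: "\<And>x. x \<in> ?K \<Longrightarrow> \<bar>?D x\<bar> \<le> B"
    by (metis bounded_iff compact_imp_bounded imageI real_norm_def)
  have i: "integrable lebesgue (\<lambda>x. indicator ?K x *\<^sub>R f x)"
    using assms(1) K by (auto simp: locally_integrable_def set_integrable_def)
  have eq: "f x * ?D x = (indicator ?K x *\<^sub>R f x) * ?D x" for x
    using partial_derivs_zero_outside_support[of x \<phi> js] by (auto simp: indicator_def)
  show ?thesis unfolding eq
  proof (rule Bochner_Integration.integrable_bound[OF integrable_mult_right[OF i, of B]])
    show "(\<lambda>x. indicator ?K x *\<^sub>R f x * ?D x) \<in> borel_measurable lebesgue"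
      using i continuous_imp_lebesgue_measurable[OF c] by (intro borel_measurable_times) auto
    show "AE x in lebesgue. norm (indicator ?K x *\<^sub>R f x * ?D x) \<le> norm (B * indicator ?K x *\<^sub>R f x)"
    proof (rule AE_I2)
      fix x
      show "norm (indicator ?K x *\<^sub>R f x * ?D x) \<le> norm (B * indicator ?K x *\<^sub>R f x)"
        using B[of x] mult_left_mono[of "\<bar>?D x\<bar>" "\<bar>B\<bar>" "\<bar>f x\<bar>"]
        by (cases "x \<in> ?K") (auto simp: abs_mult mult.commute)
(* (auto simp: abs_mult intro!: order_trans[OF mult_left_mono order_trans[OF _ abs_ge_self]] simp: mult.commute)*)
    qed
  qed
qed

section \<open>Weak derivatives and point evaluation\<close>

text \<open>
  The fundamental lemma of the calculus of variations. Testing with the bumps gives zero integral of the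
  difference over every open box. Boxes form an intersection-stable generator of the Borel sets, so the
  integral over every Borel subset of a box vanishes, and hence the difference does.
\<close>

lemma locally_integrable_AE_eqI:
  fixes w w' :: "real ^ 'n \<Rightarrow> real"
  assumes w: "locally_integrable w" and w': "locally_integrable w'"
    and eq: "\<And>\<phi>. test_function \<phi> \<Longrightarrow> (LINT x|lebesgue. w x * \<phi> x) = (LINT x|lebesgue. w' x * \<phi> x)"
  shows "AE x in lebesgue. w x = w' x"
proof -
  define d where "d = (\<lambda>x. w x - w' x)"
  have d: "set_integrable lebesgue K d" if "compact K" for K
    unfolding d_def using w w' that by (auto simp: locally_integrable_def)
  have box0: "set_lebesgue_integral lebesgue (box a b) d = 0" for a b
  proof -
    have K: "compact (cbox a b)" by simp
    have lim: "(\<lambda>k. LINT x|lebesgue. d x * box_bump a b k x) \<longlonglongrightarrow> (LINT x|lebesgue. d x * indicator (box a b) x)"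
    proof (rule integral_dominated_convergence[where w="\<lambda>x. norm (indicator (cbox a b) x *\<^sub>R d x)"])
      have m: "(\<lambda>x. indicator (cbox a b) x *\<^sub>R d x) \<in> borel_measurable lebesgue"
        using d[OF K] by (auto simp: set_integrable_def)
      have i: "indicat_real (box a b) \<in> borel_measurable lebesgue" by (intro borel_measurable_indicator) auto
      have "(\<lambda>x. (indicator (cbox a b) x *\<^sub>R d x) * indicator (box a b) x) \<in> borel_measurable lebesgue"
        by (intro borel_measurable_times m i)
      moreover have "(\<lambda>x. (indicator (cbox a b) x *\<^sub>R d x) * indicator (box a b) x) = (\<lambda>x. d x * indicator (box a b) x)"
        using box_subset_cbox[of a b] by (auto simp: indicator_def fun_eq_iff)
      ultimately show "(\<lambda>x. d x * indicator (box a b) x) \<in> borel_measurable lebesgue" by simp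
      fix k
      have "(\<lambda>x. (indicator (cbox a b) x *\<^sub>R d x) * box_bump a b k x) \<in> borel_measurable lebesgue"
        using test_function_continuous[OF box_bump_test, where js="[]", of a b k]
        by (intro borel_measurable_times m continuous_imp_lebesgue_measurable) simp
      moreover have "(\<lambda>x. (indicator (cbox a b) x *\<^sub>R d x) * box_bump a b k x) = (\<lambda>x. d x * box_bump a b k x)"
        using box_subset_cbox[of a b] box_bump_zero[of _ a b k] by (auto simp: indicator_def fun_eq_iff)
      ultimately show "(\<lambda>x. d x * box_bump a b k x) \<in> borel_measurable lebesgue" by simp
      show "AE x in lebesgue. norm (d x * box_bump a b k x) \<le> norm (indicator (cbox a b) x *\<^sub>R d x)"
      proof (rule AE_I2)
        fix x show "norm (d x * box_bump a b k x) \<le> norm (indicator (cbox a b) x *\<^sub>R d x)"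
          using box_bump_bounds[of a b k x] box_bump_zero[of x a b k] box_subset_cbox[of a b]
          by (cases "x \<in> box a b") (auto simp: abs_mult mult_left_le)
      qed
    next
      show "integrable lebesgue (\<lambda>x. norm (indicator (cbox a b) x *\<^sub>R d x))"
        using d[OF K] by (auto simp: set_integrable_def)
      show "AE x in lebesgue. (\<lambda>k. d x * box_bump a b k x) \<longlonglongrightarrow> d x * indicator (box a b) x"
        by (intro AE_I2 tendsto_intros box_bump_tendsto)
    qed
    have "(LINT x|lebesgue. d x * box_bump a b k x) = 0" for k
    proof -
      have "integrable lebesgue (\<lambda>x. w x * box_bump a b k x)" "integrable lebesgue (\<lambda>x. w' x * box_bump a b k x)"
        using integrable_mult_test[OF w box_bump_test, of "[]"] integrable_mult_test[OF w' box_bump_test, of "[]"] by auto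
      then show ?thesis using eq[OF box_bump_test, of a b k]
        by (simp add: d_def left_diff_distrib)
    qed
    then have "(LINT x|lebesgue. d x * indicator (box a b) x) = 0"
      using lim by (simp add: LIMSEQ_const_iff)
    then show ?thesis by (simp add: set_lebesgue_integral_def mult.commute)
  qed
  have loc: "AE x in lebesgue. x \<in> box a b \<longrightarrow> d x = 0" for a b
  proof -
    let ?f = "\<lambda>x. indicator (box a b) x * d x"
    have intf: "integrable lebesgue ?f"
    proof -
      have "set_integrable lebesgue (box a b) d"
        by (rule set_integrable_subset[OF d[of "cbox a b"]]) (auto simp: box_subset_cbox)
      then show ?thesis by (simp add: set_integrable_def)
    qed
    obtain f' where f': "f' \<in> borel_measurable lborel" "AE x in lborel. ?f x = f' x"
      using completion_ex_borel_measurable_real[of ?f lborel] intf by auto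
    have AE: "AE x in lebesgue. ?f x = f' x" using f'(2) by (rule AE_completion)
    have intf': "integrable lborel f'"
    proof -
      have "f' \<in> borel_measurable lebesgue" using f'(1) by (rule measurable_completion)
      then have "integrable lebesgue f'" using intf AE integrable_cong_AE by (metis borel_measurable_integrable)
      then show ?thesis using f'(1) by (simp add: integrable_completion)
    qed
    have tr: "set_lebesgue_integral lborel A f' = (LINT x|lebesgue. indicator A x * ?f x)" if "A \<in> sets lborel" for A
    proof -
      have m: "(\<lambda>x. indicator A x *\<^sub>R f' x) \<in> borel_measurable lborel" using f'(1) that by auto
      have "set_lebesgue_integral lborel A f' = (LINT x|lebesgue. indicator A x *\<^sub>R f' x)"
        unfolding set_lebesgue_integral_def by (rule integral_completion[OF m, symmetric])
      also have "\<dots> = (LINT x|lebesgue. indicator A x * ?f x)"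
      proof (rule integral_cong_AE)
        show "(\<lambda>x. indicator A x *\<^sub>R f' x) \<in> borel_measurable lebesgue" using m by (rule measurable_completion)
        have "indicat_real A \<in> borel_measurable lebesgue" using that by (intro borel_measurable_indicator) auto
        then show "(\<lambda>x. indicator A x * ?f x) \<in> borel_measurable lebesgue"
          using borel_measurable_integrable[OF intf] by (rule borel_measurable_times)
        show "AE x in lebesgue. indicator A x *\<^sub>R f' x = indicator A x * ?f x"
          using AE by eventually_elim auto
      qed
      finally show ?thesis .
    qed
    have tot: "set_lebesgue_integral lborel UNIV f' = 0"
      using tr[of UNIV] box0[of a b] by (simp add: set_lebesgue_integral_def)
    have "set_lebesgue_integral lborel A f' = 0" if A: "A \<in> sets lborel" for A
    proof -
      have Abor: "A \<in> sigma_sets UNIV (range (\<lambda>(a, b). box a b))"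
        using A by (simp add: borel_eq_box)
      have gen: "X \<in> sets lborel" if "X \<in> sigma_sets UNIV (range (\<lambda>(a, b). box a b))" for X :: "(real ^ 'n) set"
        using that by (simp add: borel_eq_box)
      have stable: "Int_stable (range (\<lambda>(a, b). box a b :: (real ^ 'n) set))"
        by (auto simp: Int_stable_def box_Int_box)
      have cl: "range (\<lambda>(a, b). box a b :: (real ^ 'n) set) \<subseteq> Pow UNIV" by simp
      show ?thesis
        using Abor
      proof (induction rule: sigma_sets_induct_disjoint[OF stable cl, consumes 1, case_names basic empty compl union])
        case (basic A)
        then obtain a' b' where A: "A = box a' b'" by auto
        have "set_lebesgue_integral lborel A f' = (LINT x|lebesgue. indicator A x * ?f x)"
          using A by (intro tr) auto
        also have "\<dots> = set_lebesgue_integral lebesgue (A \<inter> box a b) d"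
          unfolding set_lebesgue_integral_def by (simp add: indicator_inter_arith mult.assoc)
        also have "\<dots> = 0" unfolding A box_Int_box by (rule box0)
        finally show ?case .
      next
        case empty then show ?case by (simp add: set_lebesgue_integral_def)
      next
        case (compl A)
        have Am: "A \<in> sets lborel" using compl gen by auto
        have i: "set_integrable lborel B f'" if "B \<in> sets lborel" for B
          unfolding set_integrable_def using intf' that by (rule integrable_mult_indicator[rotated])
        have "set_lebesgue_integral lborel (A \<union> (UNIV - A)) f' = set_lebesgue_integral lborel A f' + set_lebesgue_integral lborel (UNIV - A) f'"
          using Am by (intro set_integral_Un i) auto
        then show ?case using compl tot by (simp add: Un_UNIV_right)
      next
        case (union A)
        have Am: "A i \<in> sets lborel" for i using union(2) gen by auto
        have "set_integrable lborel (\<Union> (range A)) f'"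
          unfolding set_integrable_def using intf' Am by (intro integrable_mult_indicator) auto
        then have "set_lebesgue_integral lborel (\<Union> (range A)) f' = (\<Sum>i. set_lebesgue_integral lborel (A i) f')"
          using Am union(1) by (intro lebesgue_integral_countable_add) (auto simp: disjoint_family_on_def)
        then show ?case using union by simp
      qed
    qed
    then have "AE x in lborel. f' x = 0" using intf' by (intro sigma_finite_measure.density_zero[OF sigma_finite_lborel]) auto
    then have "AE x in lebesgue. f' x = 0" by (rule AE_completion)
    then show ?thesis using AE by eventually_elim (auto simp: indicator_def split: if_splits)
  qed
  have "AE x in lebesgue. \<forall>n::nat. x \<in> box (\<chi> i. - real n) (\<chi> i. real n) \<longrightarrow> d x = 0"
    unfolding AE_all_countable using loc by blast
  then show ?thesis
  proof eventually_elim
    case (elim x)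
    obtain n :: nat where n: "norm x < real n" using reals_Archimedean2 by blast
    have "x \<in> box (\<chi> i. - real n) (\<chi> i. real n)"
      using component_le_norm_cart[of x] n by (auto simp: mem_box_cart abs_less_iff) 
         (metis abs_le_D1 abs_le_D2 le_less_trans minus_less_iff)+
    then have "d x = 0" using elim by blast
    then show ?case by (simp add: d_def)
  qed
qed

lemma has_weak_deriv_unique:
  assumes "has_weak_deriv f js w" "has_weak_deriv f js w'"
  shows "AE x in lebesgue. w x = w' x"
  using assms by (intro locally_integrable_AE_eqI) (auto simp: has_weak_deriv_def)

text \<open>
  Boundedness matters: the infimum over an empty set of bounds would be an unspecified number.
\<close>

lemma norm_Linf_nonneg: "in_Linf f \<Longrightarrow> 0 \<le> norm_Linf f"
  unfolding norm_Linf_def in_Linf_def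
proof (rule cInf_greatest)
  assume "f \<in> borel_measurable lebesgue \<and> (\<exists>c. AE x in lebesgue. \<bar>f x\<bar> \<le> c)"
  then obtain c where "AE x in lebesgue. \<bar>f x\<bar> \<le> c" by blast
  then have "AE x in lebesgue. \<bar>f x\<bar> \<le> max c 0" by eventually_elim auto
  then show "{c. 0 \<le> c \<and> (AE x in lebesgue. \<bar>f x\<bar> \<le> c)} \<noteq> {}" by (auto intro!: exI[of _ "max c 0"])
qed auto

text \<open>
  The chosen weak derivative need not be the bounded one that \<^const>\<open>W2inf\<close> provides, but by uniqueness
  it agrees with it almost everywhere.
\<close>

lemma weak_deriv_in_Linf:
  assumes "f \<in> W2inf" "1 \<le> length js" "length js \<le> 2"
  shows "in_Linf (weak_deriv f js)"
proof -
  obtain w where w: "has_weak_deriv f js w" "in_Linf w" using assms by (auto simp: W2inf_def)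
  have W: "has_weak_deriv f js (weak_deriv f js)" unfolding weak_deriv_def using w(1) by (rule someI[of "has_weak_deriv f js"])
  have AE: "AE x in lebesgue. w x = weak_deriv f js x" using has_weak_deriv_unique[OF w(1) W] .
  obtain c where c: "AE x in lebesgue. \<bar>w x\<bar> \<le> c" and m: "w \<in> borel_measurable lebesgue" using w(2) by (auto simp: in_Linf_def)
  have "AE x in lebesgue. \<bar>weak_deriv f js x\<bar> \<le> c" using AE c by eventually_elim auto
  moreover have "weak_deriv f js \<in> borel_measurable lebesgue"
  proof -
    obtain f' where f': "f' \<in> borel_measurable lborel" "AE x in lborel. w x = f' x"
      using completion_ex_borel_measurable_real[of w lborel] m by auto
    have "AE x in lebesgue. f' x = weak_deriv f js x"
      using AE AE_completion[OF f'(2)] by eventually_elim auto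
    then show ?thesis by (rule borel_measurable_AE[OF measurable_completion[OF f'(1)]])
  qed
  ultimately show ?thesis by (auto simp: in_Linf_def)
qed

lemma has_weak_deriv_diff:
  assumes "has_weak_deriv f js w" "has_weak_deriv f' js w'"
  shows "has_weak_deriv (\<lambda>x. f x - f' x) js (\<lambda>x. w x - w' x)"
proof -
  have loc: "locally_integrable f" "locally_integrable f'" "locally_integrable w" "locally_integrable w'"
    using assms by (auto simp: has_weak_deriv_def)
  have "(LINT x|lebesgue. (f x - f' x) * partial_derivs js \<phi> x) = (-1) ^ length js * (LINT x|lebesgue. (w x - w' x) * \<phi> x)"
    if \<phi>: "test_function \<phi>" for \<phi>
  proof -
    note int = loc[THEN integrable_mult_test, OF \<phi>]
    have "(LINT x|lebesgue. (f x - f' x) * partial_derivs js \<phi> x) =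
        (LINT x|lebesgue. f x * partial_derivs js \<phi> x) - (LINT x|lebesgue. f' x * partial_derivs js \<phi> x)"
      unfolding left_diff_distrib by (intro Bochner_Integration.integral_diff int)
    also have "\<dots> = (-1) ^ length js * ((LINT x|lebesgue. w x * \<phi> x) - (LINT x|lebesgue. w' x * \<phi> x))"
      using assms \<phi> by (simp add: has_weak_deriv_def right_diff_distrib)
    also have "(LINT x|lebesgue. w x * \<phi> x) - (LINT x|lebesgue. w' x * \<phi> x) = (LINT x|lebesgue. (w x - w' x) * \<phi> x)"
      unfolding left_diff_distrib using int[of "[]"] by (intro Bochner_Integration.integral_diff[symmetric]) auto
    finally show ?thesis .
  qed
  moreover have "locally_integrable (\<lambda>x. f x - f' x)" "locally_integrable (\<lambda>x. w x - w' x)"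
    using loc by (auto simp: locally_integrable_def)
  ultimately show ?thesis by (simp add: has_weak_deriv_def)
qed

lemma in_Linf_diff:
  assumes "in_Linf f" "in_Linf f'" shows "in_Linf (\<lambda>x. f x - f' x)"
proof -
  obtain c c' where c: "AE x in lebesgue. \<bar>f x\<bar> \<le> c" and c': "AE x in lebesgue. \<bar>f' x\<bar> \<le> c'"
    using assms by (auto simp: in_Linf_def)
  have "AE x in lebesgue. \<bar>f x - f' x\<bar> \<le> c + c'" using c c' by eventually_elim auto
  then show ?thesis using assms by (auto simp: in_Linf_def)
qed

lemma W2inf_diff:
  assumes f: "f \<in> W2inf" and f': "f' \<in> W2inf" shows "(\<lambda>x. f x - f' x) \<in> W2inf"
proof -
  have "\<exists>w. has_weak_deriv (\<lambda>x. f x - f' x) js w \<and> in_Linf w" if "1 \<le> length js \<and> length js \<le> 2" for js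
  proof -
    have "\<exists>w. has_weak_deriv f js w \<and> in_Linf w" using f that by (simp add: W2inf_def)
    moreover have "\<exists>w. has_weak_deriv f' js w \<and> in_Linf w" using f' that by (simp add: W2inf_def)
    ultimately show ?thesis using has_weak_deriv_diff in_Linf_diff by blast
  qed
  then show ?thesis using f f' by (auto simp: W2inf_def intro!: continuous_intros in_Linf_diff)
qed

lemma norm_Linf_le_norm_W2inf:
  fixes f :: "real ^ 'n \<Rightarrow> real"
  assumes f: "f \<in> W2inf" shows "norm_Linf f \<le> norm_W2inf f"
proof -
  have "0 \<le> (\<Sum>i\<in>(UNIV :: 'n set). norm_Linf (weak_deriv f [i]))"
    "0 \<le> (\<Sum>i\<in>(UNIV :: 'n set). \<Sum>j\<in>(UNIV :: 'n set). norm_Linf (weak_deriv f [i, j]))"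
    using f by (auto intro!: sum_nonneg norm_Linf_nonneg weak_deriv_in_Linf)
  then show ?thesis by (simp add: norm_W2inf_def)
qed

text \<open>
  For a continuous function the set where \<open>|f|\<close> exceeds an essential bound is open and null, hence empty.
\<close>

lemma abs_le_norm_Linf:
  fixes f :: "real ^ 'n \<Rightarrow> real"
  assumes c: "continuous_on UNIV f" and f: "in_Linf f"
  shows "\<bar>f x\<bar> \<le> norm_Linf f"
  unfolding norm_Linf_def
proof (rule cInf_greatest)
  obtain c where "AE x in lebesgue. \<bar>f x\<bar> \<le> c" using f by (auto simp: in_Linf_def)
  then have "AE x in lebesgue. \<bar>f x\<bar> \<le> max c 0" by eventually_elim auto
  then show "{c. 0 \<le> c \<and> (AE x in lebesgue. \<bar>f x\<bar> \<le> c)} \<noteq> {}" by (auto intro!: exI[of _ "max c 0"])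
  fix d assume "d \<in> {c. 0 \<le> c \<and> (AE x in lebesgue. \<bar>f x\<bar> \<le> c)}"
  then have "AE x in lebesgue. \<bar>f x\<bar> \<le> d" by simp
  then have "{x. d < \<bar>f x\<bar>} \<in> null_sets lebesgue"
    by (simp add: completion.AE_iff_null_sets not_le)
  then have "negligible {x. d < \<bar>f x\<bar>}" by (simp add: negligible_iff_null_sets)
  moreover have "open {x. d < \<bar>f x\<bar>}"
    by (intro open_Collect_less continuous_intros c)
  ultimately have "{x. d < \<bar>f x\<bar>} = {}" using open_not_negligible by blast
  then show "\<bar>f x\<bar> \<le> d" by (simp add: Collect_empty_eq not_less)
qed

lemma abs_le_norm_W2inf:
  "f \<in> W2inf \<Longrightarrow> \<bar>f x\<bar> \<le> norm_W2inf f"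
  using abs_le_norm_Linf[of f x] norm_Linf_le_norm_W2inf[of f] by (auto simp: W2inf_def)

text \<open>
  Point evaluation is continuous for the \<open>W\<^sup>2\<^sup>,\<^sup>\<infinity>\<close> norm, so the values at \<open>x\<close> are almost everywhere limits of
  measurable simple functions and are dominated by the norm.
\<close>

lemma bochner_integrable_W2inf_pointwise:
  fixes f :: "real \<Rightarrow> real ^ 'n \<Rightarrow> real"
  assumes f: "bochner_integrable_W2inf f"
  shows "set_integrable lebesgue {0..1} (\<lambda>t. f t x)"
proof -
  have fW: "\<And>t. t \<in> {0..1} \<Longrightarrow> f t \<in> W2inf" and nI: "integrable (lebesgue_on {0..1}) (\<lambda>t. norm_W2inf (f t))"
    using f by (auto simp: bochner_integrable_W2inf_def)
  obtain s :: "nat \<Rightarrow> real \<Rightarrow> real ^ 'n \<Rightarrow> real" where s: "\<And>k. finite (s k ` {0..1})" "\<And>k. s k ` {0..1} \<subseteq> W2inf"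
      "\<And>k w. {t\<in>{0..1}. s k t = w} \<in> sets lebesgue"
    and lim: "AE t in lebesgue_on {0..1}. (\<lambda>k. norm_W2inf (\<lambda>x. s k t x - f t x)) \<longlonglongrightarrow> 0"
    using f unfolding bochner_integrable_W2inf_def by blast
  have "AE t in lebesgue. t \<in> {0..1} \<longrightarrow> (\<lambda>k. norm_W2inf (\<lambda>x. s k t x - f t x)) \<longlonglongrightarrow> 0"
    using lim by (subst (asm) AE_restrict_space_iff) auto
  then obtain N where N: "N \<in> null_sets lebesgue"
    and limN: "\<And>t. t \<in> {0..1} \<Longrightarrow> t \<notin> N \<Longrightarrow> (\<lambda>k. norm_W2inf (\<lambda>x. s k t x - f t x)) \<longlonglongrightarrow> 0"
    unfolding completion.AE_iff_null_sets by auto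
  have sk: "(\<lambda>t. indicator {0..1} t * s k t x) \<in> borel_measurable lebesgue" for k
  proof -
    have "indicator {0..1} t * s k t x = (\<Sum>w\<in>s k ` {0..1}. w x * indicator {t\<in>{0..1}. s k t = w} t)" for t
    proof (cases "t \<in> {0..1}")
      case True
      have "(\<Sum>w\<in>s k ` {0..1}. w x * indicator {t\<in>{0..1}. s k t = w} t) = (\<Sum>w\<in>s k ` {0..1}. if w = s k t then w x else 0)"
        using True by (intro sum.cong) (auto simp: indicator_def)
      then show ?thesis using True s(1) by (simp add: sum.delta)
    qed (auto simp: indicator_def)
    moreover have "(\<lambda>t. \<Sum>w\<in>s k ` {0..1}. w x * indicat_real {t\<in>{0..1}. s k t = w} t) \<in> borel_measurable lebesgue"
      using s(3) by (intro borel_measurable_sum borel_measurable_times borel_measurable_const borel_measurable_indicator)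
    ultimately show ?thesis by simp
  qed
  have "(\<lambda>t. indicator (-N) t * (indicator {0..1} t * f t x)) \<in> borel_measurable lebesgue"
  proof (rule borel_measurable_LIMSEQ_real)
    have "- N \<in> sets lebesgue" using N by (metis Compl_in_sets_lebesgue null_setsD2)
    then have "indicat_real (-N) \<in> borel_measurable lebesgue" by (rule borel_measurable_indicator)
    then show "(\<lambda>t. indicator (-N) t * (indicator {0..1} t * s k t x)) \<in> borel_measurable lebesgue" for k
      using sk by (rule borel_measurable_times)
    fix t :: real
    show "(\<lambda>k. indicator (-N) t * (indicator {0..1} t * s k t x)) \<longlonglongrightarrow> indicator (-N) t * (indicator {0..1} t * f t x)"
    proof (cases "t \<in> {0..1} \<and> t \<notin> N")
      case True
      have "(\<lambda>k. s k t x - f t x) \<longlonglongrightarrow> 0"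
      proof (rule Lim_null_comparison[OF always_eventually limN])
        show "\<forall>k. norm (s k t x - f t x) \<le> norm_W2inf (\<lambda>x. s k t x - f t x)"
        proof
          fix k
          have "s k t \<in> W2inf" using s(2)[of k] True by auto
          from abs_le_norm_W2inf[OF W2inf_diff[OF this fW], of t x]
          show "norm (s k t x - f t x) \<le> norm_W2inf (\<lambda>x. s k t x - f t x)" using True by simp
        qed
      qed (use True in auto)
      then have "(\<lambda>k. s k t x) \<longlonglongrightarrow> f t x" by (simp add: LIM_zero_iff)
      then show ?thesis by (intro tendsto_intros)
    qed (auto simp: indicator_def)
  qed
  then have m: "(\<lambda>t. indicator {0..1} t * f t x) \<in> borel_measurable lebesgue"
  proof (rule borel_measurable_AE)
    show "AE t in lebesgue. indicator (-N) t * (indicator {0..1} t * f t x) = indicator {0..1} t * f t x"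
      using AE_not_in[OF N] by eventually_elim (auto simp: indicator_def)
  qed
  have n: "integrable lebesgue (\<lambda>t. indicator {0..1} t *\<^sub>R norm_W2inf (f t))"
    using nI by (subst (asm) integrable_restrict_space) (auto simp: set_integrable_def)
  show ?thesis unfolding set_integrable_def
  proof (rule Bochner_Integration.integrable_bound[OF n])
    show "(\<lambda>t. indicator {0..1} t *\<^sub>R f t x) \<in> borel_measurable lebesgue" using m by simp
    show "AE t in lebesgue. norm (indicator {0..1} t *\<^sub>R f t x) \<le> norm (indicator {0..1} t *\<^sub>R norm_W2inf (f t))"
      using abs_le_norm_W2inf[OF fW, of _ x] by (intro AE_I2) (fastforce simp: indicator_def intro: order_trans[OF _ abs_ge_self])
  qed
qed

lemma W11_W2inf_pointwise:
  fixes g :: "real \<Rightarrow> real ^ 'n \<Rightarrow> real"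
  assumes "g \<in> W11_W2inf"
  obtains g' where "\<And>x. set_integrable lebesgue {0..1} (\<lambda>s. g' s x)"
    "\<And>t x. t \<in> {0..1} \<Longrightarrow> g t x = g 0 x + (LINT s:{0..t}|lebesgue. g' s x)"
  using assms bochner_integrable_W2inf_pointwise unfolding W11_W2inf_def by blast

section \<open>Absolute continuity, chaining and Helly selection\<close>

text \<open>
  Chaining over a fine subdivision: the bounds \<open>\<eta> (\<rho>(t) - \<rho>(s))\<close> telescope. This replaces differentiation
  almost everywhere when \<open>G\<close> is only known to be controlled by a function \<open>\<rho>\<close>.
\<close>

lemma constant_if_locally_small_increments:
  fixes G \<rho> :: "real \<Rightarrow> real"
  assumes ab: "a \<le> b"
    and small: "\<And>\<eta>. 0 < \<eta> \<Longrightarrow> \<exists>\<delta>>0. \<forall>s t. a \<le> s \<and> s \<le> t \<and> t \<le> b \<and> t - s < \<delta> \<longrightarrow> \<bar>G t - G s\<bar> \<le> \<eta> * (\<rho> t - \<rho> s)"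
  shows "G b = G a"
proof -
  have bound: "\<bar>G b - G a\<bar> \<le> \<eta> * (\<rho> b - \<rho> a)" if \<eta>: "0 < \<eta>" for \<eta>
  proof -
    obtain \<delta> where \<delta>: "\<delta> > 0" and sm: "\<And>s t. a \<le> s \<Longrightarrow> s \<le> t \<Longrightarrow> t \<le> b \<Longrightarrow> t - s < \<delta> \<Longrightarrow> \<bar>G t - G s\<bar> \<le> \<eta> * (\<rho> t - \<rho> s)"
      using small[OF \<eta>] by blast
    obtain N :: nat where N: "(b - a) / \<delta> < real N" using reals_Archimedean2 by blast
    have N0: "0 < real N" using N ab \<delta> by (smt (verit) divide_nonneg_pos)
    define x where "x i = a + (b - a) * (real i / real N)" for i
    have x0: "x 0 = a" and xN: "x N = b" using N0 by (auto simp: x_def)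
    have "i \<le> N \<Longrightarrow> \<bar>G (x i) - G a\<bar> \<le> \<eta> * (\<rho> (x i) - \<rho> a)" for i
    proof (induction i)
      case 0 then show ?case by (simp add: x0)
    next
      case (Suc i)
      have d: "x (Suc i) - x i = (b - a) / real N"
        using N0 by (simp add: x_def field_simps)
      have "(b - a) / real N < \<delta>" using N N0 \<delta> by (simp add: field_simps)
      moreover have "x i \<le> x (Suc i)" using d ab N0 by (smt (verit) divide_nonneg_pos)
      moreover have "a \<le> x i" using ab N0 by (simp add: x_def)
      moreover have "x (Suc i) \<le> b"
      proof -
        have "real (Suc i) / real N \<le> 1" using Suc.prems N0 by simp
        then have "(b - a) * (real (Suc i) / real N) \<le> (b - a) * 1" using ab by (intro mult_left_mono) auto
        then show ?thesis by (simp add: x_def)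
      qed
      ultimately have "\<bar>G (x (Suc i)) - G (x i)\<bar> \<le> \<eta> * (\<rho> (x (Suc i)) - \<rho> (x i))"
        using d by (intro sm) auto
      then show ?case using Suc by (simp add: right_diff_distrib)
    qed
    from this[of N] show ?thesis by (simp add: xN)
  qed
  show ?thesis
  proof (rule ccontr)
    assume ne: "G b \<noteq> G a"
    define \<eta> where "\<eta> = \<bar>G b - G a\<bar> / (2 * (\<bar>\<rho> b - \<rho> a\<bar> + 1))"
    have p: "0 < 2 * (\<bar>\<rho> b - \<rho> a\<bar> + 1)"
      by (intro mult_pos_pos add_nonneg_pos abs_ge_zero) simp_all
    have \<eta>: "\<eta> > 0" using ne p by (simp add: \<eta>_def)
    have "\<eta> * (\<rho> b - \<rho> a) \<le> \<eta> * (\<bar>\<rho> b - \<rho> a\<bar> + 1)" using \<eta> by (intro mult_left_mono) auto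
    also have "\<dots> = \<bar>G b - G a\<bar> / 2" using p by (simp add: \<eta>_def field_simps)
    finally show False using bound[OF \<eta>] ne by auto
  qed
qed

lemma abs_continuous_on_cong:
  assumes eq: "\<And>t. t \<in> S \<Longrightarrow> f t = f' t" and f': "abs_continuous_on S f'"
  shows "abs_continuous_on S f"
proof -
  have "(\<Sum>(a, b)\<in>P. \<bar>f b - f a\<bar>) = (\<Sum>(a, b)\<in>P. \<bar>f' b - f' a\<bar>)"
    if "\<forall>(a, b)\<in>P. a \<le> b \<and> {a..b} \<subseteq> S" for P
  proof (rule sum.cong[OF refl], clarify)
    fix a b assume "(a, b) \<in> P"
    then have "a \<in> S" "b \<in> S" using that by fastforce+
    then show "\<bar>f b - f a\<bar> = \<bar>f' b - f' a\<bar>" by (simp only: eq)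
  qed
  with f' show ?thesis unfolding abs_continuous_on_def by (simp cong: conj_cong)
qed

text \<open>
  Absolute continuity of the integral: truncate \<open>m\<close> at a level \<open>k\<close> with small remainder in \<open>L\<^sup>1\<close>. Over
  disjoint intervals the remainder contributes at most its full integral, and the bounded part at most
  \<open>k\<close> times the total length.
\<close>

lemma abs_continuous_on_if_dominated:
  fixes E m :: "real \<Rightarrow> real"
  assumes m: "set_integrable lebesgue {0..1} m" and m0: "\<And>s. 0 \<le> m s" and L: "0 \<le> L"
    and dom: "\<And>s t. 0 \<le> s \<Longrightarrow> s \<le> t \<Longrightarrow> t \<le> 1 \<Longrightarrow> \<bar>E t - E s\<bar> \<le> L * (LINT r:{s..t}|lebesgue. m r)"
  shows "abs_continuous_on {0..1} E"
  unfolding abs_continuous_on_def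
proof (intro allI impI)
  fix e :: real assume e: "e > 0"
  let ?m = "\<lambda>x. indicator {0..1} x * m x"
  have mi: "integrable lebesgue ?m" using m by (simp add: set_integrable_def)
  have lim: "(\<lambda>k. LINT x|lebesgue. min (?m x) (real k)) \<longlonglongrightarrow> (LINT x|lebesgue. ?m x)"
  proof (rule integral_dominated_convergence[where w="?m"])
    show "AE x in lebesgue. (\<lambda>k. min (?m x) (real k)) \<longlonglongrightarrow> ?m x"
    proof (rule AE_I2)
      fix x
      obtain k0 :: nat where k0: "?m x < real k0" using reals_Archimedean2 by blast
      have "\<forall>\<^sub>F k in sequentially. min (?m x) (real k) = ?m x"
        using eventually_ge_at_top[of k0] by eventually_elim (use k0 in auto)
      then show "(\<lambda>k. min (?m x) (real k)) \<longlonglongrightarrow> ?m x" by (rule tendsto_eventually)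
    qed
    show "AE x in lebesgue. norm (min (?m x) (real k)) \<le> ?m x" for k
      using m0 by (intro AE_I2) (auto simp: indicator_def min_def)
  qed (use mi in auto)
  define e' where "e' = e / (2 * (L + 1))"
  have e': "e' > 0" using e L by (simp add: e'_def)
  obtain k where k: "\<bar>(LINT x|lebesgue. min (?m x) (real k)) - (LINT x|lebesgue. ?m x)\<bar> < e'"
    using LIMSEQ_D[OF lim e'] by auto
  let ?h = "\<lambda>x. ?m x - min (?m x) (real k)"
  have mini: "integrable lebesgue (\<lambda>x. min (?m x) (real k))"
    using mi m0 by (intro Bochner_Integration.integrable_bound[OF mi]) (auto simp: indicator_def min_def)
  have hi: "integrable lebesgue ?h" using mi mini by auto
  have h: "(LINT x|lebesgue. ?h x) < e'"
    using k mi mini by (subst Bochner_Integration.integral_diff) auto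
  (* the + 1 covers the case of level zero *)
  define d where "d = e' / (real k + 1)"
  show "\<exists>d>0. \<forall>P. finite P \<and> (\<forall>(a, b)\<in>P. a \<le> b \<and> {a..b} \<subseteq> {0..1}) \<and>
     pairwise (\<lambda>p q. {fst p<..<snd p} \<inter> {fst q<..<snd q} = {}) P \<and> (\<Sum>(a, b)\<in>P. b - a) < d
     \<longrightarrow> (\<Sum>(a, b)\<in>P. \<bar>E b - E a\<bar>) < e"
  proof (intro exI[of _ d] conjI allI impI)
    show "d > 0" using e' by (simp add: d_def)
    fix P :: "(real \<times> real) set"
    assume "finite P \<and> (\<forall>(a, b)\<in>P. a \<le> b \<and> {a..b} \<subseteq> {0..1}) \<and>
     pairwise (\<lambda>p q. {fst p<..<snd p} \<inter> {fst q<..<snd q} = {}) P \<and> (\<Sum>(a, b)\<in>P. b - a) < d"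
    then have fin: "finite P" and sub: "\<And>p. p \<in> P \<Longrightarrow> fst p \<le> snd p \<and> 0 \<le> fst p \<and> snd p \<le> 1"
      and pw: "pairwise (\<lambda>p q. {fst p<..<snd p} \<inter> {fst q<..<snd q} = {}) P" and len: "(\<Sum>(a, b)\<in>P. b - a) < d"
      by (auto simp: case_prod_beta)
    let ?I = "\<lambda>p. {fst p<..<snd p} :: real set"
    have bound: "(LINT r:{fst p..snd p}|lebesgue. m r) \<le> (LINT x|lebesgue. indicator (?I p) x * ?h x) + real k * (snd p - fst p)"
      if p: "p \<in> P" for p
    proof -
      have ih: "integrable lebesgue (\<lambda>x. indicator (?I p) x * ?h x)"
        using integrable_mult_indicator[OF _ hi, of "?I p"] by simp
      have ik: "integrable lebesgue (\<lambda>x. indicator (?I p) x * real k)"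
        by (intro integrable_mult_left integrable_real_indicator) (auto simp: emeasure_lborel_Ioo sub[OF p])
      have "(LINT r:{fst p..snd p}|lebesgue. m r) = (LINT x|lebesgue. indicator (?I p) x * ?m x)"
        unfolding set_lebesgue_integral_def
      proof (rule integral_cong_AE)
        have "set_integrable lebesgue {fst p..snd p} m"
          by (rule set_integrable_subset[OF m]) (use sub[OF p] in auto)
        then show "(\<lambda>x. indicator {fst p..snd p} x *\<^sub>R m x) \<in> borel_measurable lebesgue" by (auto simp: set_integrable_def)
        show "(\<lambda>x. indicator (?I p) x * ?m x) \<in> borel_measurable lebesgue"
          using integrable_mult_indicator[OF _ mi, of "?I p"] by auto
        have "{fst p, snd p} \<in> null_sets lebesgue" by (simp add: negligible_iff_null_sets[symmetric])
        from AE_not_in[OF this] show "AE x in lebesgue. indicator {fst p..snd p} x *\<^sub>R m x = indicator (?I p) x * ?m x"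
          by eventually_elim (use sub[OF p] in \<open>auto simp: indicator_def\<close>)
      qed
      also have "\<dots> \<le> (LINT x|lebesgue. indicator (?I p) x * ?h x + indicator (?I p) x * real k)"
        using integrable_mult_indicator[OF _ mi, of "?I p"] ih ik
        by (intro integral_mono) (auto simp: indicator_def)
      also have "\<dots> = (LINT x|lebesgue. indicator (?I p) x * ?h x) + (LINT x|lebesgue. indicator (?I p) x * real k)"
        by (rule Bochner_Integration.integral_add[OF ih ik])
      also have "(LINT x|lebesgue. indicator (?I p) x * real k) = real k * (snd p - fst p)"
        using sub[OF p] by (simp add: mult.commute)
      finally show ?thesis .
    qed
    have disj: "disjoint_family_on ?I P" using pw by (auto simp: disjoint_family_on_def pairwise_def)
    have "(\<Sum>p\<in>P. (LINT x|lebesgue. indicator (?I p) x * ?h x)) = (LINT x|lebesgue. (\<Sum>p\<in>P. indicator (?I p) x * ?h x))"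
      using integrable_mult_indicator[OF _ hi] by (intro Bochner_Integration.integral_sum[symmetric]) simp
    also have "\<dots> \<le> (LINT x|lebesgue. ?h x)"
    proof (rule integral_mono)
      show "integrable lebesgue (\<lambda>x. \<Sum>p\<in>P. indicator (?I p) x * ?h x)"
        using integrable_mult_indicator[OF _ hi] by (intro Bochner_Integration.integrable_sum) simp
      fix x
      have "(\<Sum>p\<in>P. indicator (?I p) x * ?h x) = indicator (\<Union>p\<in>P. ?I p) x * ?h x"
        unfolding indicator_UN_disjoint[OF fin disj] sum_distrib_right ..
      also have "\<dots> \<le> ?h x" by (auto simp: indicator_def)
      finally show "(\<Sum>p\<in>P. indicator (?I p) x * ?h x) \<le> ?h x" .
    qed (use hi in auto)
    finally have "(\<Sum>p\<in>P. (LINT x|lebesgue. indicator (?I p) x * ?h x)) < e'" using h by linarith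
    moreover have "real k * (\<Sum>p\<in>P. snd p - fst p) \<le> e'"
    proof -
      have "0 \<le> (\<Sum>p\<in>P. snd p - fst p)" using sub by (intro sum_nonneg) auto
      then have "real k * (\<Sum>p\<in>P. snd p - fst p) \<le> (real k + 1) * d"
        using len by (intro mult_mono) (auto simp: case_prod_beta)
      then show ?thesis by (simp add: d_def)
    qed
    moreover have "(\<Sum>p\<in>P. (LINT r:{fst p..snd p}|lebesgue. m r)) \<le>
       (\<Sum>p\<in>P. (LINT x|lebesgue. indicator (?I p) x * ?h x)) + real k * (\<Sum>p\<in>P. snd p - fst p)"
      unfolding sum_distrib_left sum.distrib[symmetric] by (intro sum_mono bound)
    ultimately have lt: "(\<Sum>p\<in>P. (LINT r:{fst p..snd p}|lebesgue. m r)) \<le> 2 * e'" by linarith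
    have "(\<Sum>(a, b)\<in>P. \<bar>E b - E a\<bar>) \<le> (\<Sum>p\<in>P. L * (LINT r:{fst p..snd p}|lebesgue. m r))"
      unfolding case_prod_beta by (intro sum_mono dom) (use sub in auto)
    also have "\<dots> = L * (\<Sum>p\<in>P. (LINT r:{fst p..snd p}|lebesgue. m r))" by (simp add: sum_distrib_left)
    also have "\<dots> \<le> L * (2 * e')" using lt L by (intro mult_left_mono)
    also have "\<dots> < (L + 1) * (2 * e')" using e' by (simp add: distrib_right)
    also have "\<dots> = e" unfolding e'_def using L by (simp add: field_simps)
    finally show "(\<Sum>(a, b)\<in>P. \<bar>E b - E a\<bar>) < e" .
  qed
qed

text \<open>
  A monotone predicate is determined, except at one time, by its threshold. Choose a subsequence along
  which the thresholds converge; away from the limit the truth value stabilises, and at the limit a further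
  subsequence makes it constant.
\<close>

lemma monotone_predicates_subsequence:
  fixes \<phi> :: "nat \<Rightarrow> real \<Rightarrow> bool"
  assumes mono: "\<And>m s t. 0 \<le> s \<Longrightarrow> s \<le> t \<Longrightarrow> t \<le> 1 \<Longrightarrow> \<phi> m s \<Longrightarrow> \<phi> m t"
  shows "\<exists>r. strict_mono r \<and> (\<forall>t\<in>{0..1}. \<exists>b. \<forall>\<^sub>F n in sequentially. \<phi> (r n) t = b)"
proof -
  (* the value 2 stands for a predicate that never becomes true *)
  define \<theta> where "\<theta> m = Inf (insert 2 {t\<in>{0..1}. \<phi> m t})" for m
  have bdd: "bdd_below (insert 2 {t\<in>{0..1}. \<phi> m t})" for m by (auto intro!: bdd_belowI[of _ 0])
  have \<theta>b: "\<theta> m \<in> {0..2}" for m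
    unfolding \<theta>_def using bdd[of m] by (auto intro!: cInf_greatest cInf_lower)
  obtain l r where r: "strict_mono r" "(\<theta> \<circ> r) \<longlonglongrightarrow> l"
    using compact_Icc[of 0 "2::real"] \<theta>b unfolding compact_def by (metis (no_types, lifting))
  have conv: "\<exists>b. \<forall>\<^sub>F n in sequentially. \<phi> (r n) t = b" if t: "t \<in> {0..1}" "t \<noteq> l" for t
  proof (cases "t < l")
    case True
    have "\<forall>\<^sub>F n in sequentially. \<phi> (r n) t = False"
      using order_tendstoD(1)[OF r(2) True]
    proof eventually_elim
      case (elim n)
      have "\<theta> (r n) \<le> t" if "\<phi> (r n) t"
        unfolding \<theta>_def using bdd t that by (intro cInf_lower) auto
      then show ?case using elim by auto
    qed
    then show ?thesis by blast
  next
    case False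
    then have "l < t" using t by simp
    have "\<forall>\<^sub>F n in sequentially. \<phi> (r n) t = True"
      using order_tendstoD(2)[OF r(2) \<open>l < t\<close>]
    proof eventually_elim
      case (elim n)
      then have "Inf (insert 2 {t\<in>{0..1}. \<phi> (r n) t}) < t" by (simp add: \<theta>_def)
      then obtain s where "s \<in> insert 2 {t\<in>{0..1}. \<phi> (r n) t}" "s < t"
        using cInf_lessD[of "insert 2 {t\<in>{0..1}. \<phi> (r n) t}" t] by blast
      then show ?case using t mono[of s t "r n"] by auto
    qed
    then show ?thesis by blast
  qed
  have "\<exists>b. infinite {n. \<phi> (r n) l = b}"
  proof (rule ccontr)
    assume "\<not> ?thesis"
    then have "finite ({n. \<phi> (r n) l = True} \<union> {n. \<phi> (r n) l = False})" by blast
    moreover have "{n. \<phi> (r n) l = True} \<union> {n. \<phi> (r n) l = False} = UNIV" by auto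
    ultimately show False by (metis infinite_UNIV_nat)
  qed
  then obtain b where b: "infinite {n. \<phi> (r n) l = b}" by blast
  obtain q :: "nat \<Rightarrow> nat" where q: "strict_mono q" "\<And>n. q n \<in> {n. \<phi> (r n) l = b}"
    using infinite_enumerate[OF b] by blast
  show ?thesis
  proof (intro exI[of _ "r \<circ> q"] conjI ballI)
    show "strict_mono (r \<circ> q)" using r(1) q(1) by (rule strict_mono_o)
    fix t :: real assume t: "t \<in> {0..1}"
    show "\<exists>b. \<forall>\<^sub>F n in sequentially. \<phi> ((r \<circ> q) n) t = b"
    proof (cases "t = l")
      case True
      then show ?thesis using q(2) by (auto intro!: exI[of _ b])
    next
      case False
      then obtain b' where "\<forall>\<^sub>F n in sequentially. \<phi> (r n) t = b'" using conv t by blast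
      then have "\<forall>\<^sub>F n in sequentially. \<phi> (r (q n)) t = b'"
        using filterlim_subseq[OF q(1)] by (rule eventually_compose_filterlim)
      then show ?thesis by auto
    qed
  qed
qed

text \<open>
  Applied to one element of \<open>X\<close> after the other. As the target is discrete, convergence means being
  eventually equal.
\<close>

theorem helly_selection_finite_sets:
  fixes P :: "nat \<Rightarrow> real \<Rightarrow> 'a set"
  assumes X: "finite X" and sub: "\<And>m t. t \<in> {0..1} \<Longrightarrow> P m t \<subseteq> X"
    and mono: "\<And>m s t. 0 \<le> s \<Longrightarrow> s \<le> t \<Longrightarrow> t \<le> 1 \<Longrightarrow> P m s \<subseteq> P m t"
  shows "\<exists>r P'. strict_mono r \<and> (\<forall>t\<in>{0..1}. \<forall>\<^sub>F n in sequentially. P (r n) t = P' t)"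
proof -
  have "\<exists>r. strict_mono r \<and> (\<forall>x\<in>Y. \<forall>t\<in>{0..1}. \<exists>b. \<forall>\<^sub>F n in sequentially. (x \<in> P (r n) t) = b)"
    if "finite Y" for Y
    using that
  proof (induction Y rule: finite_induct)
    case empty then show ?case by (auto intro!: exI[of _ id] strict_mono_id)
  next
    case (insert x Y)
    then obtain r where r: "strict_mono r" "\<And>x t. x \<in> Y \<Longrightarrow> t \<in> {0..1} \<Longrightarrow> \<exists>b. \<forall>\<^sub>F n in sequentially. (x \<in> P (r n) t) = b"
      by blast
    obtain q where q: "strict_mono q" "\<And>t. t \<in> {0..1} \<Longrightarrow> \<exists>b. \<forall>\<^sub>F n in sequentially. (x \<in> P (r (q n)) t) = b"
      using monotone_predicates_subsequence[of "\<lambda>m t. x \<in> P (r m) t"] mono by blast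
    show ?case
    proof (intro exI[of _ "r \<circ> q"] conjI ballI)
      show "strict_mono (r \<circ> q)" using r(1) q(1) by (rule strict_mono_o)
      fix y t assume y: "y \<in> insert x Y" and t: "t \<in> {0..1::real}"
      show "\<exists>b. \<forall>\<^sub>F n in sequentially. (y \<in> P ((r \<circ> q) n) t) = b"
      proof (cases "y = x")
        case True then show ?thesis using q(2)[OF t] by simp
      next
        case False
        then obtain b' where "\<forall>\<^sub>F n in sequentially. (y \<in> P (r n) t) = b'" using r(2)[of y t] y t by blast
        then have "\<forall>\<^sub>F n in sequentially. (y \<in> P (r (q n)) t) = b'"
          using filterlim_subseq[OF q(1)] by (rule eventually_compose_filterlim)
        then show ?thesis by auto
      qed
    qed
  qed
  from this[OF X] obtain r where r: "strict_mono r"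
    "\<And>x t. x \<in> X \<Longrightarrow> t \<in> {0..1} \<Longrightarrow> \<exists>b. \<forall>\<^sub>F n in sequentially. (x \<in> P (r n) t) = b" by blast
  define P' where "P' t = {x\<in>X. \<forall>\<^sub>F n in sequentially. x \<in> P (r n) t}" for t
  have "\<forall>\<^sub>F n in sequentially. P (r n) t = P' t" if t: "t \<in> {0..1}" for t
  proof -
    have "\<forall>\<^sub>F n in sequentially. x \<in> P (r n) t \<longleftrightarrow> x \<in> P' t" if x: "x \<in> X" for x
    proof -
      obtain b where b: "\<forall>\<^sub>F n in sequentially. (x \<in> P (r n) t) = b" using r(2)[OF x t] by blast
      show ?thesis
      proof (cases b)
        case True
        then have "\<forall>\<^sub>F n in sequentially. x \<in> P (r n) t" using b by simp
        then show ?thesis using x by (auto simp: P'_def)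
      next
        case False
        then have ev: "\<forall>\<^sub>F n in sequentially. x \<notin> P (r n) t" using b by simp
        have "x \<notin> P' t"
        proof
          assume "x \<in> P' t"
          then have "\<forall>\<^sub>F n in sequentially. x \<in> P (r n) t" by (simp add: P'_def)
          with ev have "\<forall>\<^sub>F n in sequentially. False" by eventually_elim blast
          then show False by simp
        qed
        then show ?thesis using ev by simp
      qed
    qed
    then have "\<forall>\<^sub>F n in sequentially. \<forall>x\<in>X. x \<in> P (r n) t \<longleftrightarrow> x \<in> P' t"
      using X by (simp add: eventually_ball_finite)
    then show ?thesis
    proof eventually_elim
      case (elim n)
      have "P' t \<subseteq> X" by (auto simp: P'_def)
      then show ?case using elim sub[OF t, of "r n"] by blast
    qed
  qed
  then show ?thesis using r(1) by blast
qed

section \<open>Simplices, triangulations and interpolation\<close>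

definition affine_fun_on :: "(real ^ 'n) set \<Rightarrow> (real ^ 'n \<Rightarrow> real) \<Rightarrow> bool" where
  "affine_fun_on T u \<longleftrightarrow> (\<exists>a b. \<forall>x\<in>T. u x = a \<bullet> x + b)"

text \<open>
  On a set with interior points this is the gradient of an affine function.
\<close>

definition slope :: "(real ^ 'n \<Rightarrow> real) \<Rightarrow> (real ^ 'n) set \<Rightarrow> real ^ 'n" where
  "slope u T = (SOME a. \<exists>b. \<forall>x\<in>T. u x = a \<bullet> x + b)"

lemma full_simplex_facts:
  fixes T :: "(real ^ 'n) set"
  assumes T: "int CARD('n) simplex T"
  shows "compact T" "convex T" "interior T \<noteq> {}" "closure (interior T) = T"
    "T = convex hull {v. v extreme_point_of T}" "finite {v. v extreme_point_of T}"
proof -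
  show c: "compact T" using T compact_simplex by blast
  show v: "convex T" using T convex_simplex by blast
  have "aff_dim T = int DIM(real ^ 'n)" using aff_dim_simplex[OF T] by simp
  moreover from this have "T \<noteq> {}" by auto
  ultimately show i: "interior T \<noteq> {}" 
    using interior_rel_interior_gen[of T] rel_interior_eq_empty[OF v] by simp
  show "closure (interior T) = T" 
    using convex_closure_interior[OF v i] c compact_imp_closed closure_closed by metis
  show "T = convex hull {v. v extreme_point_of T}" by (rule Krein_Milman_Minkowski[OF c v])
  show "finite {v. v extreme_point_of T}"
    using finite_polyhedron_extreme_points simplex_imp_polyhedron[OF T] by blast
qed

lemma affine_eq_on_interior:
  fixes a a' :: "real ^ 'n"
  assumes "\<And>x. x \<in> S \<Longrightarrow> a \<bullet> x + b = a' \<bullet> x + b'" "interior S \<noteq> {}"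
  shows "a = a'" "b = b'"
proof -
  obtain x e where x: "e > 0" "cball x e \<subseteq> S"
    using assms(2) mem_interior_cball by blast
  have xS: "x \<in> S" using x by (meson centre_in_cball less_imp_le subsetD)
  show "a = a'"
  proof (rule ccontr)
    assume ne: "a \<noteq> a'"
    define y where "y = x + (e / norm (a - a')) *\<^sub>R (a - a')"
    have "y \<in> cball x e" using x ne by (simp add: y_def dist_norm)
    then have "(a - a') \<bullet> y + (b - b') = 0" "(a - a') \<bullet> x + (b - b') = 0"
      using assms(1)[of y] assms(1)[of x] x xS by (auto simp: inner_diff_left)
    then have "(a - a') \<bullet> (y - x) = 0" by (simp add: inner_diff_right)
    then show False using ne x by (simp add: y_def)
  qed
  then show "b = b'" using assms(1)[OF xS] by simp
qed

lemma slope_eqI: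
  assumes "interior T \<noteq> {}" "\<And>x. x \<in> T \<Longrightarrow> u x = a \<bullet> x + b"
  shows "slope u T = a"
  unfolding slope_def
proof (rule some_equality)
  show "\<exists>b. \<forall>x\<in>T. u x = a \<bullet> x + b" using assms by blast
  fix a' assume "\<exists>b. \<forall>x\<in>T. u x = a' \<bullet> x + b"
  then obtain b' where "\<forall>x\<in>T. u x = a' \<bullet> x + b'" by blast
  then show "a' = a" using assms by (intro affine_eq_on_interior(1)[of T a' b' a b]) auto
qed

lemma affine_fun_on_slope:
  assumes "affine_fun_on T u" "y \<in> T" "x \<in> T"
  shows "u x = u y + slope u T \<bullet> (x - y)"
proof -
  have "\<exists>b. \<forall>x\<in>T. u x = slope u T \<bullet> x + b"
    using assms(1) unfolding slope_def affine_fun_on_def by (rule someI_ex)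
  then show ?thesis using assms by (auto simp: inner_diff_right)
qed

lemma slope_cong: "(\<And>x. x \<in> T \<Longrightarrow> u x = v x) \<Longrightarrow> slope u T = slope v T"
  unfolding slope_def by (intro arg_cong[of _ _ Eps]) auto

lemma affine_fun_on_add: "affine_fun_on T u \<Longrightarrow> affine_fun_on T v \<Longrightarrow> affine_fun_on T (\<lambda>x. u x + v x)"
  unfolding affine_fun_on_def
  by (auto, rule_tac x="a + aa" in exI, rule_tac x="b + ba" in exI) (auto simp: inner_add_left)

lemma affine_fun_on_cmult: "affine_fun_on T u \<Longrightarrow> affine_fun_on T (\<lambda>x. c * u x)"
  unfolding affine_fun_on_def
  by (auto, rule_tac x="c *\<^sub>R a" in exI, rule_tac x="c * b" in exI) (auto simp: algebra_simps)

lemma slope_add: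
  assumes "interior T \<noteq> {}" "affine_fun_on T u" "affine_fun_on T v"
  shows "slope (\<lambda>x. u x + v x) T = slope u T + slope v T"
proof -
  obtain y where y: "y \<in> T" using assms(1) interior_subset by blast
  show ?thesis
  proof (rule slope_eqI[OF assms(1)])
    fix x assume x: "x \<in> T"
    show "u x + v x = (slope u T + slope v T) \<bullet> x + (u y + v y - (slope u T + slope v T) \<bullet> y)"
      using affine_fun_on_slope[OF assms(2) y x] affine_fun_on_slope[OF assms(3) y x]
      by (simp add: inner_add_left inner_diff_right)
  qed
qed

lemma slope_cmult:
  assumes "interior T \<noteq> {}" "affine_fun_on T u"
  shows "slope (\<lambda>x. c * u x) T = c *\<^sub>R slope u T"
proof -
  obtain y where y: "y \<in> T" using assms(1) interior_subset by blast
  show ?thesis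
  proof (rule slope_eqI[OF assms(1)])
    fix x assume x: "x \<in> T"
    show "c * u x = (c *\<^sub>R slope u T) \<bullet> x + (c * u y - (c *\<^sub>R slope u T) \<bullet> y)"
      by (subst affine_fun_on_slope[OF assms(2) y x]) (simp add: inner_diff_right algebra_simps)
  qed
qed

lemma grad_affine_on_interior:
  assumes u: "affine_fun_on T u" and x: "x \<in> interior T"
  shows "grad u x = slope u T"
proof -
  have "((\<lambda>y. u x + slope u T \<bullet> (y - x)) has_derivative (\<lambda>h. slope u T \<bullet> h)) (at x)"
    by (auto intro!: derivative_eq_intros)
  then have "(u has_derivative (\<lambda>h. slope u T \<bullet> h)) (at x)"
  proof (rule has_derivative_transform_within_open[OF _ open_interior x])
    fix y assume "y \<in> interior T"
    then show "u x + slope u T \<bullet> (y - x) = u y"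
      using affine_fun_on_slope[OF u, of x y] x interior_subset by (metis subsetD)
  qed
  then show ?thesis
    by (simp add: grad_def vec_eq_iff frechet_derivative_at[symmetric] inner_axis)
qed

text \<open>
  The edges from one vertex are linearly independent, so a linear functional takes prescribed values on
  them; it is an inner product with the vector \<open>adjoint l 1\<close>.
\<close>

lemma simplex_affine_interpolation:
  fixes T :: "(real ^ 'n) set"
  assumes T: "n simplex T"
  shows "\<exists>a b. \<forall>v. v extreme_point_of T \<longrightarrow> a \<bullet> v + b = f v"
proof -
  obtain K where K: "\<not> affine_dependent K" "T = convex hull K"
    using T by (auto simp: simplex_def)
  show ?thesis
  proof (cases "K = {}")
    case True
    then show ?thesis using K by (auto simp: extreme_point_of_def)
  next
    case False
    then obtain v0 where v0: "v0 \<in> K" by blast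
    have "independent ((\<lambda>x. - v0 + x) ` (K - {v0}))"
      using K(1) affine_dependent_iff_dependent2[OF v0] by blast
    then obtain l where l: "linear l" "\<And>x. x \<in> (\<lambda>x. - v0 + x) ` (K - {v0}) \<Longrightarrow> l x = f (x + v0) - f v0"
      using linear_independent_extend[of _ "\<lambda>x. f (x + v0) - f v0"] by blast
    define a where "a = adjoint l 1"
    have la: "l x = a \<bullet> x" for x
      using adjoint_works[OF l(1), of x 1] by (simp add: a_def inner_commute)
    have "a \<bullet> v + (f v0 - a \<bullet> v0) = f v" if "v extreme_point_of T" for v
    proof (cases "v = v0")
      case False
      have "v \<in> K" using that K extreme_point_of_convex_hull_affine_independent by blast
      then have "l (- v0 + v) = f v - f v0" using l(2)[of "- v0 + v"] False by auto
      then show ?thesis by (simp add: la inner_diff_right)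
    qed simp
    then show ?thesis by blast
  qed
qed

text \<open>
  By Krein--Milman: the points where two affine functions agree form a hyperplane (or everything, or
  nothing), in particular a convex set.
\<close>

lemma affine_eq_on_hull_extreme_points:
  fixes S :: "(real ^ 'n) set"
  assumes S: "compact S" "convex S"
    and eq: "\<And>v. v extreme_point_of S \<Longrightarrow> a \<bullet> v + b = a' \<bullet> v + b'" and x: "x \<in> S"
  shows "a \<bullet> x + b = a' \<bullet> x + b'"
proof -
  let ?H = "{x. (a - a') \<bullet> x = b' - b}"
  have "{v. v extreme_point_of S} \<subseteq> ?H" using eq by (auto simp: inner_diff_left algebra_simps)
  then have "convex hull {v. v extreme_point_of S} \<subseteq> ?H" by (rule hull_minimal) (rule convex_hyperplane)
  then have "x \<in> ?H" using Krein_Milman_Minkowski[OF S] x by blast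
  then show ?thesis by (simp add: inner_diff_left)
qed

locale triangulated =
  fixes Th :: "(real ^ 'n) set set"
  assumes tri: "space_triangulation Th"
begin

lemma simplexD: "T \<in> Th \<Longrightarrow> int CARD('n) simplex T"
  using tri by (auto simp: space_triangulation_def)

lemmas simplex_facts = full_simplex_facts[OF simplexD]

lemma cover: "\<exists>T\<in>Th. x \<in> T"
  using tri by (auto simp: space_triangulation_def)

lemma finite_meeting: "bounded K \<Longrightarrow> finite {T\<in>Th. T \<inter> K \<noteq> {}}"
  using tri by (auto simp: space_triangulation_def)

lemma inter_face: "T \<in> Th \<Longrightarrow> T' \<in> Th \<Longrightarrow> (T \<inter> T') face_of T"
  using tri by (auto simp: space_triangulation_def)

lemma interior_disjoint:
  assumes "T \<in> Th" "T' \<in> Th" "x \<in> interior T" "x \<in> interior T'"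
  shows "T = T'"
proof -
  have *: "T \<subseteq> T'" if "T \<in> Th" "T' \<in> Th" "x \<in> interior T" "x \<in> T'" for T T'
  proof -
    have "rel_interior T = interior T" using simplex_facts(3)[OF that(1)] by (rule rel_interior_nonempty_interior)
    then have "T \<subseteq> T \<inter> T'"
      using that interior_subset by (intro subset_of_face_of[OF inter_face[OF that(1,2)]]) auto
    then show ?thesis by blast
  qed
  show ?thesis using *[OF assms(1,2)] *[OF assms(2,1)] assms interior_subset by blast
qed

text \<open>
  Conformity of the mesh enters here: \<open>T \<inter> T'\<close> is a face of both simplices, so its extreme points are
  vertices of both, and the two affine pieces agree on all of \<open>T \<inter> T'\<close>.
\<close>

lemma interpolant_exists:
  "\<exists>!w. \<forall>T\<in>Th. (\<exists>a b. \<forall>x\<in>T. w x = a \<bullet> x + b) \<and> (\<forall>v. v extreme_point_of T \<longrightarrow> w v = f v)"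
proof -
  have "\<forall>T\<in>Th. \<exists>ab. \<forall>v. v extreme_point_of T \<longrightarrow> fst ab \<bullet> v + snd ab = f v"
    using simplex_affine_interpolation[OF simplexD, of _ f] by simp
  then obtain ab where ab: "\<And>T v. T \<in> Th \<Longrightarrow> v extreme_point_of T \<Longrightarrow> fst (ab T) \<bullet> v + snd (ab T) = f v"
    by metis
  have cons: "fst (ab T) \<bullet> x + snd (ab T) = fst (ab T') \<bullet> x + snd (ab T')"
    if "T \<in> Th" "T' \<in> Th" "x \<in> T" "x \<in> T'" for T T' x
  proof (rule affine_eq_on_hull_extreme_points)
    show "compact (T \<inter> T')" "convex (T \<inter> T')"
      using simplex_facts[OF that(1)] simplex_facts[OF that(2)] by (auto intro: compact_Int convex_Int)
    show "x \<in> T \<inter> T'" using that by simp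
    fix v assume v: "v extreme_point_of (T \<inter> T')"
    have "v extreme_point_of T" using v extreme_point_of_face[OF inter_face[OF that(1,2)]] by blast
    moreover have "v extreme_point_of T'" 
      using v extreme_point_of_face[OF inter_face[OF that(2,1)]] by (simp add: Int_commute)
    ultimately show "fst (ab T) \<bullet> v + snd (ab T) = fst (ab T') \<bullet> v + snd (ab T')"
      using ab that by simp
  qed
  define w where "w x = (let T = (SOME T. T \<in> Th \<and> x \<in> T) in fst (ab T) \<bullet> x + snd (ab T))" for x
  have w: "w x = fst (ab T) \<bullet> x + snd (ab T)" if "T \<in> Th" "x \<in> T" for T x
  proof -
    have "\<exists>T. T \<in> Th \<and> x \<in> T" using that by blast
    from someI_ex[OF this] show ?thesis unfolding w_def Let_def using cons that by blast
  qed
  show ?thesis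
  proof (rule ex1I[of _ w])
    show "\<forall>T\<in>Th. (\<exists>a b. \<forall>x\<in>T. w x = a \<bullet> x + b) \<and> (\<forall>v. v extreme_point_of T \<longrightarrow> w v = f v)"
      using w ab by (auto simp: extreme_point_of_def) 
    fix w' assume w': "\<forall>T\<in>Th. (\<exists>a b. \<forall>x\<in>T. w' x = a \<bullet> x + b) \<and> (\<forall>v. v extreme_point_of T \<longrightarrow> w' v = f v)"
    show "w' = w"
    proof
      fix x
      obtain T where T: "T \<in> Th" "x \<in> T" using cover by blast
      then obtain a b where *: "\<forall>x\<in>T. w' x = a \<bullet> x + b" using w' by blast
      have "a \<bullet> x + b = fst (ab T) \<bullet> x + snd (ab T)"
      proof (rule affine_eq_on_hull_extreme_points[OF simplex_facts(1,2)[OF T(1)] _ T(2)])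
        fix v assume v: "v extreme_point_of T"
        then have "v \<in> T" by (simp add: extreme_point_of_def)
        then show "a \<bullet> v + b = fst (ab T) \<bullet> v + snd (ab T)"
          using ab[OF T(1) v] w' T v * by metis
      qed
      then show "w' x = w x" using w[OF T] * T by simp
    qed
  qed
qed

lemma interpolant_affine: "T \<in> Th \<Longrightarrow> affine_fun_on T (interpolant Th f)"
  using theI'[OF interpolant_exists[of f]] unfolding interpolant_def affine_fun_on_def by blast

lemma interpolant_vertex: "T \<in> Th \<Longrightarrow> v extreme_point_of T \<Longrightarrow> interpolant Th f v = f v"
  using theI'[OF interpolant_exists[of f]] unfolding interpolant_def by blast

lemma affine_eq_if_vertices:
  assumes T: "T \<in> Th" and u: "affine_fun_on T u" "affine_fun_on T w"
    and eq: "\<And>v. v extreme_point_of T \<Longrightarrow> u v = w v" and x: "x \<in> T"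
  shows "u x = w x"
proof -
  obtain a b a' b' where ab: "\<forall>x\<in>T. u x = a \<bullet> x + b" "\<forall>x\<in>T. w x = a' \<bullet> x + b'"
    using u by (auto simp: affine_fun_on_def)
  have "a \<bullet> x + b = a' \<bullet> x + b'"
  proof (rule affine_eq_on_hull_extreme_points[OF simplex_facts(1,2)[OF T] _ x])
    fix v assume v: "v extreme_point_of T"
    then have "v \<in> T" by (simp add: extreme_point_of_def)
    then show "a \<bullet> v + b = a' \<bullet> v + b'" using eq[OF v] ab by simp
  qed
  then show ?thesis using ab x by simp
qed

lemma interpolant_eqI:
  assumes "T \<in> Th" "affine_fun_on T u" "\<And>v. v extreme_point_of T \<Longrightarrow> u v = f v" "x \<in> T"
  shows "interpolant Th f x = u x"
  by (rule affine_eq_if_vertices[OF assms(1) interpolant_affine[OF assms(1)] assms(2) _ assms(4)])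
     (simp add: interpolant_vertex[OF assms(1)] assms)

lemma interpolant_add: "interpolant Th (\<lambda>x. f x + f' x) = (\<lambda>x. interpolant Th f x + interpolant Th f' x)"
proof
  fix x obtain T where T: "T \<in> Th" "x \<in> T" using cover by blast
  show "interpolant Th (\<lambda>x. f x + f' x) x = interpolant Th f x + interpolant Th f' x"
    by (rule interpolant_eqI[OF T(1) _ _ T(2)])
      (auto intro: affine_fun_on_add interpolant_affine T simp: interpolant_vertex[OF T(1)])
qed

lemma interpolant_cmult: "interpolant Th (\<lambda>x. c * f x) = (\<lambda>x. c * interpolant Th f x)"
proof
  fix x obtain T where T: "T \<in> Th" "x \<in> T" using cover by blast
  show "interpolant Th (\<lambda>x. c * f x) x = c * interpolant Th f x"
    by (rule interpolant_eqI[OF T(1) _ _ T(2)])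
      (auto intro: affine_fun_on_cmult interpolant_affine T simp: interpolant_vertex[OF T(1)])
qed

lemma interpolant_cong_vertices:
  assumes "T \<in> Th" "\<And>v. v extreme_point_of T \<Longrightarrow> f v = f' v" "x \<in> T"
  shows "interpolant Th f x = interpolant Th f' x"
  by (rule interpolant_eqI[OF assms(1) interpolant_affine[OF assms(1)] _ assms(3)])
     (simp add: interpolant_vertex[OF assms(1)] assms)

lemma continuous_on_affine_fun: "affine_fun_on T u \<Longrightarrow> continuous_on T u"
proof -
  assume "affine_fun_on T u"
  then obtain a b where "\<forall>x\<in>T. u x = a \<bullet> x + b" by (auto simp: affine_fun_on_def)
  moreover have "continuous_on T (\<lambda>x. a \<bullet> x + b)" by (intro continuous_intros)
  ultimately show ?thesis by (simp cong: continuous_on_cong)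
qed

end

section \<open>Lipschitz boundaries are null sets\<close>

lemma frontier_subset_graph:
  fixes S :: "(real ^ 'n) set"
  assumes S: "open S" and L: "L-lipschitz_on {z. \<nu> \<bullet> z = 0} \<psi>" and \<nu>: "norm \<nu> = 1"
    and loc: "\<forall>y\<in>ball x r. y \<in> S \<longleftrightarrow> \<nu> \<bullet> y < \<psi> (y - (\<nu> \<bullet> y) *\<^sub>R \<nu>)"
    and y: "y \<in> frontier S" "y \<in> ball x r"
  shows "\<nu> \<bullet> y = \<psi> (y - (\<nu> \<bullet> y) *\<^sub>R \<nu>)"
proof (rule antisym)
  let ?p = "\<lambda>y. y - (\<nu> \<bullet> y) *\<^sub>R \<nu>"
  have nS: "y \<notin> S" using y(1) S by (simp add: frontier_def interior_open)
  then show "\<psi> (?p y) \<le> \<nu> \<bullet> y" using loc y(2) by force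
  show "\<nu> \<bullet> y \<le> \<psi> (?p y)"
  proof (rule ccontr)
    assume "\<not> ?thesis"
    then have gt: "\<psi> (?p y) < \<nu> \<bullet> y" by simp
    have p: "\<nu> \<bullet> ?p z = 0" for z
      using \<nu> by (simp add: inner_diff_right dot_square_norm)
    have "continuous_on UNIV (\<lambda>z. \<psi> (?p z))"
      by (rule continuous_on_compose2[OF lipschitz_on_continuous_on[OF L]]) (auto intro!: continuous_intros simp: p)
    then have "open {z. \<psi> (?p z) < \<nu> \<bullet> z}" by (intro open_Collect_less continuous_intros)
    then have "open ({z. \<psi> (?p z) < \<nu> \<bullet> z} \<inter> ball x r)" by auto
    moreover have "{z. \<psi> (?p z) < \<nu> \<bullet> z} \<inter> ball x r \<inter> S = {}" using loc by force
    ultimately have "{z. \<psi> (?p z) < \<nu> \<bullet> z} \<inter> ball x r \<inter> closure S = {}"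
      by (simp add: open_Int_closure_eq_empty)
    then show False using gt y by (auto simp: frontier_def)
  qed
qed

text \<open>
  The graph meets each of its translates in direction \<open>\<nu>\<close> nowhere. Infinitely many translates of equal
  measure fit into a bounded set, so this measure is zero.
\<close>

lemma negligible_compact_graph:
  fixes F :: "(real ^ 'n) set"
  assumes F: "compact F" and \<nu>: "norm \<nu> = 1"
    and graph: "\<And>y. y \<in> F \<Longrightarrow> \<nu> \<bullet> y = \<psi> (y - (\<nu> \<bullet> y) *\<^sub>R \<nu>)"
  shows "negligible F"
proof -
  define G where "G j = (+) (inverse (real (Suc j)) *\<^sub>R \<nu>) ` F" for j
  obtain B where B: "\<And>y. y \<in> F \<Longrightarrow> norm y \<le> B"
    using compact_imp_bounded[OF F] by (auto simp: bounded_iff)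
  have meas: "G j \<in> lmeasurable" for j
    unfolding G_def using F by (intro lmeasurable_compact compact_translation)
  have sub: "G j \<subseteq> cball 0 (B + 1)" for j
  proof
    fix z assume "z \<in> G j"
    then obtain y where y: "y \<in> F" "z = inverse (real (Suc j)) *\<^sub>R \<nu> + y" by (auto simp: G_def)
    have "norm z \<le> norm (inverse (real (Suc j)) *\<^sub>R \<nu>) + norm y" unfolding y by (rule norm_triangle_ineq)
    also have "\<dots> \<le> 1 + B" using B[OF y(1)] \<nu> by (intro add_mono) (auto simp: field_simps)
    finally show "z \<in> cball 0 (B + 1)" by simp
  qed
  have disj: "G i \<inter> G j = {}" if "i \<noteq> j" for i j
  proof (rule ccontr)
    assume "G i \<inter> G j \<noteq> {}"
    then obtain y y' where y: "y \<in> F" "y' \<in> F"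
      and eq: "inverse (real (Suc i)) *\<^sub>R \<nu> + y = inverse (real (Suc j)) *\<^sub>R \<nu> + y'"
      by (auto simp: G_def)
    define s where "s = inverse (real (Suc j)) - inverse (real (Suc i))"
    have ys: "y = y' + s *\<^sub>R \<nu>" using eq by (simp add: s_def algebra_simps)
    have vs: "\<nu> \<bullet> y = \<nu> \<bullet> y' + s" using \<nu> by (simp add: ys inner_add_right dot_square_norm)
    have "y - (\<nu> \<bullet> y) *\<^sub>R \<nu> = y' - (\<nu> \<bullet> y') *\<^sub>R \<nu>" unfolding vs by (simp add: ys algebra_simps)
    then have "\<nu> \<bullet> y = \<nu> \<bullet> y'" using graph y by metis
    then have "s = 0" using vs by simp
    then show False using that by (simp add: s_def)
  qed
  have "measure lebesgue F = 0"
  proof (rule ccontr)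
    assume "measure lebesgue F \<noteq> 0"
    then have pos: "measure lebesgue F > 0" by (simp add: zero_less_measure_iff)
    obtain N :: nat where N: "measure lebesgue (cball 0 (B + 1) :: (real ^ 'n) set) < N * measure lebesgue F"
      using reals_Archimedean3[OF pos] by blast
    have "real N * measure lebesgue F = (\<Sum>j<N. measure lebesgue (G j))"
      by (simp add: G_def measure_translation)
    also have "\<dots> = measure lebesgue (\<Union>j<N. G j)"
    proof (rule measure_finite_Union[symmetric])
      show "G ` {..<N} \<subseteq> sets lebesgue" using meas by (auto simp: fmeasurableD)
      show "disjoint_family_on G {..<N}" using disj by (auto simp: disjoint_family_on_def)
      show "emeasure lebesgue (G j) \<noteq> \<infinity>" for j using fmeasurableD2[OF meas[of j]] by simp
    qed simp
    also have "\<dots> \<le> measure lebesgue (cball 0 (B + 1) :: (real ^ 'n) set)"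
      using sub meas by (intro measure_mono_fmeasurable) (auto simp: fmeasurableD)
    finally show False using N by simp
  qed
  then show ?thesis using F lmeasurable_compact negligible_iff_measure by blast
qed

lemma lipschitz_set_null_frontier:
  fixes S :: "(real ^ 'n) set"
  assumes S: "lipschitz_set S"
  shows "negligible (frontier S)"
proof (rule locally_negligible_alt[THEN iffD2], rule ballI)
  fix x assume x: "x \<in> frontier S"
  have o: "open S" using S by (simp add: lipschitz_set_def)
  obtain \<nu> r L \<psi> where *: "norm \<nu> = 1" "0 < r" "L-lipschitz_on {z. \<nu> \<bullet> z = 0} \<psi>"
      "\<forall>y\<in>ball x r. y \<in> S \<longleftrightarrow> \<nu> \<bullet> y < \<psi> (y - (\<nu> \<bullet> y) *\<^sub>R \<nu>)"
    using S[unfolded lipschitz_set_def lipschitz_boundary_def] x by blast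
  have "negligible (frontier S \<inter> cball x (r / 2))"
  proof (rule negligible_compact_graph[OF _ *(1)])
    show "compact (frontier S \<inter> cball x (r / 2))" by (intro closed_Int_compact) auto
    fix y assume y: "y \<in> frontier S \<inter> cball x (r / 2)"
    then have "y \<in> ball x r" using *(2) by auto
    then show "\<nu> \<bullet> y = \<psi> (y - (\<nu> \<bullet> y) *\<^sub>R \<nu>)"
      using frontier_subset_graph[OF o *(3,1,4)] y by blast
  qed
  then have "negligible (frontier S \<inter> ball x (r / 2))"
    by (rule negligible_subset) auto
  moreover have "openin (top_of_set (frontier S)) (frontier S \<inter> ball x (r / 2))"
    by (rule openin_open_Int) simp
  ultimately show "\<exists>U. openin (top_of_set (frontier S)) U \<and> x \<in> U \<and> negligible U"
    using x *(2) by (intro exI[of _ "frontier S \<inter> ball x (r / 2)"]) auto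
qed

section \<open>Slopes, eigenstrains and the energy on a mesh\<close>

text \<open>
  Passing to closures makes the crack energy insensitive to the values of the precise representative of \<open>\<gamma>\<close>
  at boundary points of cells, which mix the values on several cells.
\<close>

lemma closed_nbhd_closure_cong:
  assumes "closure A = closure B"
  shows "closed_nbhd \<epsilon> A = closed_nbhd \<epsilon> B"
proof -
  have "infdist x A = infdist x B" for x
  proof (cases "A = {}")
    case True
    then have "B = {}" using assms by (metis closure_eq_empty)
    then show ?thesis using True by simp
  next
    case False
    then have "B \<noteq> {}" using assms by (metis closure_eq_empty)
    then show ?thesis using False assms by (metis infdist_eq_setdist setdist_closure_2)
  qed
  moreover have "A = {} \<longleftrightarrow> B = {}" using assms by (metis closure_eq_empty)
  ultimately show ?thesis by (simp add: closed_nbhd_def)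
qed

lemma mesh_nbhd_closure_cong:
  assumes "closure A = closure B"
  shows "mesh_nbhd Th \<epsilon> A = mesh_nbhd Th \<epsilon> B"
  unfolding mesh_nbhd_def closed_nbhd_closure_cong[OF assms] ..

lemma bounded_closed_nbhd:
  assumes "bounded A" shows "bounded (closed_nbhd \<epsilon> A)"
proof (cases "A = {}")
  case False
  obtain B where B: "\<And>x. x \<in> A \<Longrightarrow> norm x \<le> B" using assms by (auto simp: bounded_iff)
  have "norm x \<le> B + (\<epsilon> + 1)" if x: "x \<in> closed_nbhd \<epsilon> A" for x
  proof -
    have "infdist x A < \<epsilon> + 1" using x by (simp add: closed_nbhd_def)
    moreover have "\<epsilon> + 1 \<le> infdist x A" if "\<And>a. a \<in> A \<Longrightarrow> \<epsilon> + 1 \<le> dist x a"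
      unfolding infdist_notempty[OF False] using False that by (rule cINF_greatest)
    ultimately obtain a where a: "a \<in> A" "dist x a < \<epsilon> + 1"
      by (meson not_le)
    have "norm x \<le> norm a + dist x a" by (metis dist_norm norm_triangle_sub add.commute)
    then show ?thesis using B[OF a(1)] a(2) by simp
  qed
  then show ?thesis by (auto simp: bounded_iff)
qed (simp add: closed_nbhd_def)

text \<open>
  The averages over small balls are eventually equal to \<open>c\<close>.
\<close>

lemma precise_rep_locally_constant:
  fixes f :: "real ^ 'n \<Rightarrow> real ^ 'n"
  assumes A: "open A" "x \<in> A" and AE: "AE y in lebesgue. y \<in> A \<longrightarrow> f y = c"
  shows "precise_rep f x = c"
proof -
  obtain e where e: "e > 0" "ball x e \<subseteq> A" using A open_contains_ball by blast
  let ?avg = "\<lambda>r. (LINT y:ball x r|lebesgue. f y) /\<^sub>R measure lebesgue (ball x r)"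
  have avg: "?avg r = c" if r: "0 < r" "r < e" for r
  proof -
    have "(LINT y:ball x r|lebesgue. f y) = (LINT y:ball x r|lebesgue. c)"
    proof -
      have m: "(\<lambda>y. indicat_real (ball x r) y *\<^sub>R c) \<in> borel_measurable lebesgue"
        by (intro borel_measurable_scaleR borel_measurable_indicator) auto
      have "AE y in lebesgue. indicat_real (ball x r) y *\<^sub>R c = indicator (ball x r) y *\<^sub>R f y"
        using AE
      proof eventually_elim
        case (elim y)
        have "ball x r \<subseteq> A" using e r subset_ball[of r e x] by simp
        then show ?case using elim by (cases "y \<in> ball x r") auto
      qed
      from integral_cong_AE[OF m borel_measurable_AE[OF m this] this] show ?thesis
        unfolding set_lebesgue_integral_def by (rule sym)
    qed
    also have "\<dots> = (LINT y|lebesgue. indicat_real (ball x r) y) *\<^sub>R c"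
      unfolding set_lebesgue_integral_def
      by (rule integral_scaleR_left, rule integrable_real_indicator) (use lmeasurable_ball[of x r] in \<open>auto simp: fmeasurable_def\<close>)
    also have "(LINT y|lebesgue. indicat_real (ball x r) y) = measure lebesgue (ball x r)"
      by (simp only: Bochner_Integration.integral_indicator space_completion space_lborel) simp
    finally show ?thesis using content_ball_pos[OF r(1), of x] by simp
  qed
  have ev: "\<forall>\<^sub>F r in at_right 0. ?avg r = c"
    unfolding eventually_at_right_field using e(1) avg by blast
  have lim: "(?avg \<longlongrightarrow> c) (at_right 0)"
    by (rule tendsto_eventually[OF ev])
  have "Lim (at_right 0) ?avg = c"
    by (rule tendsto_Lim[OF _ lim]) simp
  then show ?thesis using lim unfolding precise_rep_def Let_def by auto
qed

text \<open>
  The null boundary is what the Lipschitz condition on \<open>\<Omega>\<close> provides.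
\<close>

locale fe_mesh = triangulated Th for Th :: "(real ^ 'n) set set" +
  fixes \<Omega> \<Omega>' :: "(real ^ 'n) set"
  assumes open_domain: "open \<Omega>" and bounded_outer: "bounded \<Omega>'" and domain_subset: "\<Omega> \<subseteq> \<Omega>'"
    and open_collar: "open (\<Omega>' - closure \<Omega>)" and null_boundary: "negligible (frontier \<Omega>)"
begin

definition cells where "cells = {T\<in>Th. T \<inter> \<Omega>' \<noteq> {}}"

text \<open>
  Cells meeting the collar \<open>\<Omega>' - closure \<Omega>\<close>: since they meet it in a set with interior points, the
  boundary conditions determine \<open>u\<close> and \<open>\<gamma>\<close> on the whole cell.
\<close>

definition clamped where "clamped T \<longleftrightarrow> T \<inter> (\<Omega>' - closure \<Omega>) \<noteq> {}"

definition vol where "vol T = measure lebesgue (T \<inter> \<Omega>)"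

lemma cellsD: "T \<in> cells \<Longrightarrow> T \<in> Th" by (simp add: cells_def)

lemma finite_cells: "finite cells"
  unfolding cells_def by (rule finite_meeting[OF bounded_outer])

lemma mesh_dom_eq: "mesh_dom Th \<Omega>' = \<Union>cells"
  by (simp add: mesh_dom_def cells_def)

lemma compact_Union_cells: "P \<subseteq> cells \<Longrightarrow> compact (\<Union>P)"
  using finite_cells simplex_facts(1)[OF cellsD] by (intro compact_Union) (auto intro: finite_subset)

lemma lmeasurable_cell: "T \<in> cells \<Longrightarrow> T \<in> lmeasurable"
  using simplex_facts(1)[OF cellsD] lmeasurable_compact by blast

lemma AE_interior_cells: "AE x in lebesgue. \<forall>T\<in>cells. x \<in> T \<longrightarrow> x \<in> interior T"
proof -
  have "AE x in lebesgue. x \<in> T \<longrightarrow> x \<in> interior T" if "T \<in> cells" for T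
  proof -
    have "negligible (frontier T)"
      using simplex_facts(2)[OF cellsD[OF that]] by (rule negligible_convex_frontier)
    then have "AE x in lebesgue. x \<notin> frontier T" by (simp add: negligible_iff_null_sets AE_not_in)
    then show ?thesis
      by eventually_elim (use simplex_facts(1)[OF cellsD[OF that]] in \<open>auto simp: frontier_def compact_imp_closed\<close>)
  qed
  then show ?thesis using finite_cells by (simp add: AE_finite_all)
qed

text \<open>
  A simplex is the closure of its interior, so an open set cannot touch it only along its boundary.
\<close>

lemma meets_interior:
  assumes "T \<in> Th" "open A" "T \<inter> A \<noteq> {}"
  shows "interior T \<inter> A \<noteq> {}"
  using simplex_facts(4)[OF assms(1)] open_Int_closure_eq_empty[OF assms(2), of "interior T"] assms(3)
  by (metis inf_commute)

lemma not_null_open_part: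
  assumes "T \<in> Th" "open A" "T \<inter> A \<noteq> {}" "AE x in lebesgue. x \<in> T \<inter> A \<longrightarrow> P x"
  shows "\<exists>x\<in>interior T \<inter> A. P x"
proof (rule ccontr)
  assume "\<not> ?thesis"
  then have "AE x in lebesgue. x \<notin> interior T \<inter> A"
    using assms(4) interior_subset[of T] by (auto elim!: eventually_mono)
  then have "interior T \<inter> A \<in> null_sets lebesgue"
    by (simp add: completion.AE_iff_null_sets Int_def)
  then have "negligible (interior T \<inter> A)" by (simp add: negligible_iff_null_sets)
  then show False using meets_interior[OF assms(1-3)] open_not_negligible assms(2)
    by (meson open_Int open_interior)
qed

lemma vol_pos: "T \<in> cells \<Longrightarrow> T \<inter> \<Omega> \<noteq> {} \<Longrightarrow> 0 < vol T"
proof -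
  assume T: "T \<in> cells" "T \<inter> \<Omega> \<noteq> {}"
  have m: "T \<inter> \<Omega> \<in> lmeasurable"
    using lmeasurable_cell[OF T(1)] open_domain by (intro fmeasurable_Int_fmeasurable) auto
  have "\<not> negligible (T \<inter> \<Omega>)"
  proof
    assume "negligible (T \<inter> \<Omega>)"
    then have "T \<inter> \<Omega> \<in> null_sets lebesgue" by (simp only: negligible_iff_null_sets)
    from AE_not_in[OF this] have "AE x in lebesgue. x \<in> T \<inter> \<Omega> \<longrightarrow> False" by eventually_elim auto
    then show False using not_null_open_part[OF cellsD[OF T(1)] open_domain T(2), of "\<lambda>_. False"] by simp
  qed
  then show ?thesis using m unfolding vol_def
    by (simp add: zero_less_measure_iff negligible_iff_measure)
qed

lemma vol_nonneg: "0 \<le> vol T" by (simp add: vol_def)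

lemma vol_zero: "T \<inter> \<Omega> = {} \<Longrightarrow> vol T = 0" by (simp add: vol_def)

lemma domain_cover: "x \<in> \<Omega>' \<Longrightarrow> \<exists>T\<in>cells. x \<in> T"
  using cover[of x] by (auto simp: cells_def)

text \<open>
  Besides the cells that meet \<open>\<Omega>\<close> and the clamped ones there may be cells that meet \<open>\<Omega>'\<close> only in boundary
  points of \<open>\<Omega>\<close>. The energy puts no control on \<open>u\<close> there, but they meet \<open>\<Omega>'\<close> in a null set only.
\<close>

lemma dangling_part: "\<not> clamped T \<Longrightarrow> T \<inter> \<Omega> = {} \<Longrightarrow> T \<inter> \<Omega>' \<subseteq> frontier \<Omega>"
  using open_domain by (auto simp: clamped_def frontier_def interior_open)

text \<open>
  Almost every point of \<open>\<Omega>\<close> lies in the interior of exactly one cell.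
\<close>

lemma piecewise_constant_integral:
  fixes F :: "real ^ 'n \<Rightarrow> real"
  assumes "AE x in lebesgue. \<forall>T\<in>cells. x \<in> T \<longrightarrow> F x = c T"
  shows "(LINT x:\<Omega>|lebesgue. F x) = (\<Sum>T\<in>cells. vol T * c T)" "set_integrable lebesgue \<Omega> F"
proof -
  let ?G = "\<lambda>x. \<Sum>T\<in>cells. indicator (T \<inter> \<Omega>) x * c T"
  have m: "T \<inter> \<Omega> \<in> lmeasurable" if "T \<in> cells" for T
    using lmeasurable_cell[OF that] open_domain by (intro fmeasurable_Int_fmeasurable) auto
  have AE: "AE x in lebesgue. ?G x = indicator \<Omega> x *\<^sub>R F x"
    using assms AE_interior_cells
  proof eventually_elim
    case (elim x)
    show ?case
    proof (cases "x \<in> \<Omega>")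
      case True
      then have "x \<in> \<Omega>'" using domain_subset by blast
      from domain_cover[OF this] obtain T where T: "T \<in> cells" "x \<in> T" by blast
      have "indicator (T' \<inter> \<Omega>) x * c T' = (if T' = T then F x else 0)" if "T' \<in> cells" for T'
      proof (cases "T' = T")
        case False
        have "x \<notin> T'"
        proof
          assume "x \<in> T'"
          then have "x \<in> interior T'" "x \<in> interior T" using elim(2) T that by auto
          then show False using interior_disjoint[OF cellsD[OF that] cellsD[OF T(1)]] False by blast
        qed
        then show ?thesis using False by simp
      qed (use True T elim(1) in simp)
      then have "?G x = (\<Sum>T'\<in>cells. if T' = T then F x else 0)" by (intro sum.cong) auto
      then show ?thesis using T finite_cells True by simp
    qed auto
  qed
  have iT: "integrable lebesgue (indicat_real (T \<inter> \<Omega>))" if "T \<in> cells" for T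
    using m[OF that] by (intro integrable_real_indicator) (auto simp: fmeasurable_def)
  have iG: "integrable lebesgue ?G"
    by (intro Bochner_Integration.integrable_sum integrable_mult_left iT)
  have meas: "(\<lambda>x. indicator \<Omega> x *\<^sub>R F x) \<in> borel_measurable lebesgue"
    by (rule borel_measurable_AE[OF borel_measurable_integrable[OF iG] AE])
  show "set_integrable lebesgue \<Omega> F"
    unfolding set_integrable_def using iG integrable_cong_AE[OF borel_measurable_integrable[OF iG] meas AE] by simp
  have "(LINT x:\<Omega>|lebesgue. F x) = (LINT x|lebesgue. ?G x)"
    unfolding set_lebesgue_integral_def
    using integral_cong_AE[OF borel_measurable_integrable[OF iG] meas AE] by simp
  also have "\<dots> = (\<Sum>T\<in>cells. (LINT x|lebesgue. indicator (T \<inter> \<Omega>) x * c T))"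
    by (intro Bochner_Integration.integral_sum integrable_mult_left iT)
  also have "\<dots> = (\<Sum>T\<in>cells. vol T * c T)"
    by (simp add: vol_def)
  finally show "(LINT x:\<Omega>|lebesgue. F x) = (\<Sum>T\<in>cells. vol T * c T)" .
qed

lemma V_space_affine: "u \<in> V_space Th \<Omega>' \<Longrightarrow> T \<in> cells \<Longrightarrow> affine_fun_on T u"
  by (auto simp: V_space_def cells_def affine_fun_on_def)

lemma V_spaceI:
  assumes "\<And>T. T \<in> cells \<Longrightarrow> affine_fun_on T u"
  shows "u \<in> V_space Th \<Omega>'"
proof -
  have "continuous_on (\<Union>cells) u"
    using finite_cells assms simplex_facts(1)[OF cellsD]
    by (intro continuous_on_closed_Union[of cells id, simplified] continuous_on_affine_fun) (auto intro: compact_imp_closed)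
  then show ?thesis using assms by (auto simp: V_space_def mesh_dom_eq cells_def affine_fun_on_def)
qed

lemma AE_grad:
  assumes "u \<in> V_space Th \<Omega>'"
  shows "AE x in lebesgue. \<forall>T\<in>cells. x \<in> T \<longrightarrow> grad u x = slope u T"
  using AE_interior_cells by eventually_elim (auto intro: grad_affine_on_interior V_space_affine[OF assms])

lemma slope_add_cell:
  "T \<in> cells \<Longrightarrow> affine_fun_on T u \<Longrightarrow> affine_fun_on T v \<Longrightarrow> slope (\<lambda>x. u x + v x) T = slope u T + slope v T"
  by (intro slope_add simplex_facts(3) cellsD)

lemma slope_cmult_cell:
  "T \<in> cells \<Longrightarrow> affine_fun_on T u \<Longrightarrow> slope (\<lambda>x. c * u x) T = c *\<^sub>R slope u T"
  by (intro slope_cmult simplex_facts(3) cellsD)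

lemma affine_eq_if_eq_on_collar:
  assumes T: "T \<in> cells" "clamped T" and u: "affine_fun_on T u" "affine_fun_on T w"
    and eq: "\<forall>x\<in>\<Omega>' - closure \<Omega>. u x = w x" and x: "x \<in> T"
  shows "u x = w x"
proof -
  obtain a b a' b' where ab: "\<forall>x\<in>T. u x = a \<bullet> x + b" "\<forall>x\<in>T. w x = a' \<bullet> x + b'"
    using u by (auto simp: affine_fun_on_def)
  let ?S = "interior T \<inter> (\<Omega>' - closure \<Omega>)"
  have S: "interior ?S \<noteq> {}"
    using meets_interior[OF cellsD[OF T(1)] open_collar] T(2) open_collar
    by (simp add: interior_open clamped_def open_Int)
  have "a \<bullet> y + b = a' \<bullet> y + b'" if "y \<in> ?S" for y
  proof -
    have "y \<in> T" using that interior_subset by blast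
    then show ?thesis using ab eq that by force
  qed
  then have "a = a'" "b = b'" using S affine_eq_on_interior[of ?S a b a' b'] by blast+
  then show ?thesis using ab x by simp
qed

definition cell_value where "cell_value \<gamma> T = (SOME c. AE x in lebesgue. x \<in> T \<longrightarrow> \<gamma> x = c)"
  for \<gamma> :: "real ^ 'n \<Rightarrow> real ^ 'n"

definition support where "support \<gamma> = {T\<in>cells. cell_value \<gamma> T \<noteq> 0}"

lemma cell_value_AE:
  assumes "\<gamma> \<in> W_space Th \<Omega>'" "T \<in> cells"
  shows "AE x in lebesgue. x \<in> T \<longrightarrow> \<gamma> x = cell_value \<gamma> T"
proof -
  have "\<exists>c. AE x in lebesgue. x \<in> T \<longrightarrow> \<gamma> x = c" using assms by (auto simp: W_space_def cells_def)
  then show ?thesis unfolding cell_value_def by (rule someI_ex)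
qed

lemma AE_cell_value:
  assumes "\<gamma> \<in> W_space Th \<Omega>'"
  shows "AE x in lebesgue. \<forall>T\<in>cells. x \<in> T \<longrightarrow> \<gamma> x = cell_value \<gamma> T"
  using cell_value_AE[OF assms] finite_cells by (simp add: AE_finite_all)

lemma cell_value_eqI:
  assumes T: "T \<in> cells" and A: "open A" "T \<inter> A \<noteq> {}"
    and \<gamma>: "\<gamma> \<in> W_space Th \<Omega>'" and c: "AE x in lebesgue. x \<in> T \<inter> A \<longrightarrow> \<gamma> x = c"
  shows "cell_value \<gamma> T = c"
proof -
  have "AE x in lebesgue. x \<in> T \<inter> A \<longrightarrow> cell_value \<gamma> T = c"
    using cell_value_AE[OF \<gamma> T] c by eventually_elim auto
  then show ?thesis using not_null_open_part[OF cellsD[OF T] A, of "\<lambda>_. cell_value \<gamma> T = c"] by simp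
qed

abbreviation \<A> where "\<A> \<equiv> admissible_pairs Th \<Omega> \<Omega>'"

lemma support_not_clamped:
  assumes "(u, \<gamma>) \<in> \<A> w" "T \<in> support \<gamma>"
  shows "\<not> clamped T"
proof
  assume T: "clamped T"
  have "AE x in lebesgue. x \<in> T \<inter> (\<Omega>' - closure \<Omega>) \<longrightarrow> \<gamma> x = 0"
    using assms(1) by (auto simp: admissible_pairs_def elim!: eventually_mono)
  then have "cell_value \<gamma> T = 0"
    using T assms by (intro cell_value_eqI[OF _ open_collar]) (auto simp: admissible_pairs_def clamped_def support_def)
  then show False using assms(2) by (simp add: support_def)
qed

lemma support_subset: "support \<gamma> \<subseteq> cells" by (auto simp: support_def)

lemma nonzero_set_subset:
  assumes \<gamma>: "\<gamma> \<in> W_space Th \<Omega>'"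
  shows "nonzero_set Th \<Omega>' \<gamma> \<subseteq> \<Union>(support \<gamma>)"
proof -
  let ?f = "\<lambda>y. indicat_real (mesh_dom Th \<Omega>') y *\<^sub>R \<gamma> y"
  have "precise_rep ?f x = 0" if x: "x \<notin> \<Union>(support \<gamma>)" for x
  proof (rule precise_rep_locally_constant)
    show "open (- \<Union>(support \<gamma>))"
      using compact_Union_cells[OF support_subset] compact_imp_closed by blast
    show "x \<in> - \<Union>(support \<gamma>)" using x by simp
    show "AE y in lebesgue. y \<in> - \<Union>(support \<gamma>) \<longrightarrow> ?f y = 0"
      using AE_cell_value[OF \<gamma>]
      by eventually_elim (auto simp: mesh_dom_eq support_def indicator_def)
  qed
  then show ?thesis unfolding nonzero_set_def by blast
qed

lemma interior_subset_nonzero_set: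
  assumes \<gamma>: "\<gamma> \<in> W_space Th \<Omega>'" and T: "T \<in> support \<gamma>"
  shows "interior T \<subseteq> nonzero_set Th \<Omega>' \<gamma>"
proof
  let ?f = "\<lambda>y. indicat_real (mesh_dom Th \<Omega>') y *\<^sub>R \<gamma> y"
  fix x assume x: "x \<in> interior T"
  have Tc: "T \<in> cells" using T by (simp add: support_def)
  have "precise_rep ?f x = cell_value \<gamma> T"
  proof (rule precise_rep_locally_constant[OF open_interior x])
    show "AE y in lebesgue. y \<in> interior T \<longrightarrow> ?f y = cell_value \<gamma> T"
      using AE_cell_value[OF \<gamma>]
    proof eventually_elim
      case (elim y)
      have "y \<in> interior T \<Longrightarrow> y \<in> T" using interior_subset by blast
      then show ?case using elim Tc by (auto simp: mesh_dom_eq indicator_def)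
    qed
  qed
  then show "x \<in> nonzero_set Th \<Omega>' \<gamma>" using T by (simp add: nonzero_set_def support_def)
qed

text \<open>
  The nonzero set contains the interiors of the cells in the support and is contained in their union.
\<close>

lemma closure_nonzero_set:
  assumes \<gamma>: "\<gamma> \<in> W_space Th \<Omega>'"
  shows "closure (nonzero_set Th \<Omega>' \<gamma>) = \<Union>(support \<gamma>)"
proof
  have "closed (\<Union>(support \<gamma>))" using compact_Union_cells[OF support_subset] compact_imp_closed by blast
  then show "closure (nonzero_set Th \<Omega>' \<gamma>) \<subseteq> \<Union>(support \<gamma>)"
    using nonzero_set_subset[OF \<gamma>] closure_minimal by blast
  show "\<Union>(support \<gamma>) \<subseteq> closure (nonzero_set Th \<Omega>' \<gamma>)"
  proof
    fix x assume "x \<in> \<Union>(support \<gamma>)"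
    then obtain T where T: "T \<in> support \<gamma>" "x \<in> T" by blast
    have "T = closure (interior T)" using T(1) simplex_facts(4) by (simp add: support_def cells_def)
    then show "x \<in> closure (nonzero_set Th \<Omega>' \<gamma>)"
      using T closure_mono[OF interior_subset_nonzero_set[OF \<gamma> T(1)]] by blast
  qed
qed

text \<open>
  Cracks are represented by sets \<open>P\<close> of cells; the corresponding subset of space is \<open>\<Union>P\<close>.
\<close>

definition crack_area where "crack_area \<epsilon> P = measure lebesgue (mesh_nbhd Th \<epsilon> (\<Union>P))"

lemma bounded_Union_cells: "P \<subseteq> cells \<Longrightarrow> bounded (\<Union>P)"
  using compact_Union_cells compact_imp_bounded by blast

lemma crack_area_mono:
  assumes "P \<subseteq> P'" "P' \<subseteq> cells"
  shows "crack_area \<epsilon> P \<le> crack_area \<epsilon> P'"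
proof -
  have fin: "mesh_nbhd Th \<epsilon> (\<Union>Q) \<in> lmeasurable" if "Q \<subseteq> cells" for Q
  proof -
    have "finite {T\<in>Th. T \<inter> closed_nbhd \<epsilon> (\<Union>Q) \<noteq> {}}"
      using finite_meeting bounded_closed_nbhd bounded_Union_cells that by blast
    then have "compact (mesh_nbhd Th \<epsilon> (\<Union>Q))"
      unfolding mesh_nbhd_def mesh_dom_def by (intro compact_Union) (auto intro: simplex_facts(1))
    then show ?thesis by (rule lmeasurable_compact)
  qed
  have "closed_nbhd \<epsilon> (\<Union>P) \<subseteq> closed_nbhd \<epsilon> (\<Union>P')"
  proof
    fix x assume "x \<in> closed_nbhd \<epsilon> (\<Union>P)"
    then have x: "\<Union>P \<noteq> {}" "infdist x (\<Union>P) \<le> \<epsilon>" by (auto simp: closed_nbhd_def)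
    have sub: "\<Union>P \<subseteq> \<Union>P'" using assms(1) by blast
    have "infdist x (\<Union>P') \<le> infdist x (\<Union>P)" using sub x(1) by (rule infdist_mono)
    then show "x \<in> closed_nbhd \<epsilon> (\<Union>P')" using x sub by (auto simp: closed_nbhd_def)
  qed
  then have "mesh_nbhd Th \<epsilon> (\<Union>P) \<subseteq> mesh_nbhd Th \<epsilon> (\<Union>P')"
    unfolding mesh_nbhd_def mesh_dom_def by blast
  then show ?thesis unfolding crack_area_def
    using fin assms by (intro measure_mono_fmeasurable) (auto simp: fmeasurableD)
qed

lemma energy_formula:
  assumes u: "u \<in> V_space Th \<Omega>'" and \<gamma>: "\<gamma> \<in> W_space Th \<Omega>'" and \<Psi>: "closure \<Psi> = \<Union>P"
  shows "energy C \<kappa> \<epsilon> Th \<Omega> \<Omega>' u \<gamma> \<Psi> =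
    (\<Sum>T\<in>cells. vol T * quad C (slope u T - cell_value \<gamma> T)) + \<kappa> / (2 * \<epsilon>) * crack_area \<epsilon> (P \<union> support \<gamma>)"
proof -
  have "AE x in lebesgue. \<forall>T\<in>cells. x \<in> T \<longrightarrow> quad C (grad u x - \<gamma> x) = quad C (slope u T - cell_value \<gamma> T)"
    using AE_grad[OF u] AE_cell_value[OF \<gamma>] by eventually_elim auto
  note * = piecewise_constant_integral(1)[OF this]
  have "mesh_nbhd Th \<epsilon> (\<Psi> \<union> nonzero_set Th \<Omega>' \<gamma>) = mesh_nbhd Th \<epsilon> (\<Union>(P \<union> support \<gamma>))"
  proof (rule mesh_nbhd_closure_cong)
    have "closure (\<Union>(P \<union> support \<gamma>)) = closure (closure \<Psi> \<union> closure (nonzero_set Th \<Omega>' \<gamma>))"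
      by (simp add: \<Psi> closure_nonzero_set[OF \<gamma>])
    also have "\<dots> = closure (\<Psi> \<union> nonzero_set Th \<Omega>' \<gamma>)" by (simp add: closure_Un)
    finally show "closure (\<Psi> \<union> nonzero_set Th \<Omega>' \<gamma>) = closure (\<Union>(P \<union> support \<gamma>))" ..
  qed
  then show ?thesis unfolding energy_def * crack_area_def by simp
qed

end

section \<open>Optimal pairs for a given crack\<close>

text \<open>
  The minimisation takes place in a finite-dimensional space of nodal values. Orthogonal projection with
  respect to a semidefinite form is pure algebra there, and pointwise operations on functions take the
  place of a vector space structure.
\<close>

locale semidefinite_form =
  fixes B :: "('v \<Rightarrow> real) \<Rightarrow> ('v \<Rightarrow> real) \<Rightarrow> real"
  assumes add_left: "B (\<lambda>x. f x + g x) h = B f h + B g h"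
    and cmult_left: "B (\<lambda>x. c * f x) h = c * B f h"
    and sym: "B f g = B g f"
    and nonneg: "0 \<le> B f f"
begin

lemma add_right: "B h (\<lambda>x. f x + g x) = B h f + B h g"
  using add_left[of f g h] by (simp add: sym)

lemma cmult_right: "B h (\<lambda>x. c * f x) = c * B h f"
  using cmult_left[of c f h] by (simp add: sym)

lemma null_orthogonal:
  assumes "B g g = 0"
  shows "B f g = 0"
proof (rule ccontr)
  assume n: "B f g \<noteq> 0"
  (* the choice that makes the form take the value - 1 at f + t g *)
  define t where "t = - (B f f + 1) / (2 * B f g)"
  have "0 \<le> B (\<lambda>x. f x + t * g x) (\<lambda>x. f x + t * g x)" by (rule nonneg)
  also have "\<dots> = B f f + 2 * t * B f g"
    using assms by (simp add: add_left add_right cmult_left cmult_right sym[of g f])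
  also have "\<dots> = - 1" using n by (simp add: t_def field_simps)
  finally show False by simp
qed

text \<open>
  Gram--Schmidt, one coordinate at a time. If the new direction, made orthogonal to the old ones, is a null
  vector of the form, nothing has to be corrected by the Cauchy--Schwarz inequality
  (\<open>null_orthogonal\<close>).
\<close>

lemma projection_exists:
  assumes "finite N"
  shows "\<exists>f'. (\<forall>x. x \<notin> N \<longrightarrow> f' x = f x) \<and> (\<forall>\<phi>. (\<forall>x. x \<notin> N \<longrightarrow> \<phi> x = 0) \<longrightarrow> B f' \<phi> = 0)"
  using assms
proof (induction N arbitrary: f rule: finite_induct)
  case empty
  have "B f \<phi> = 0" if "\<forall>x. \<phi> x = 0" for \<phi>
  proof -
    have "\<phi> = (\<lambda>x. 0 * \<phi> x)" using that by auto
    then have "B f \<phi> = B f (\<lambda>x. 0 * \<phi> x)" by (rule arg_cong)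
    then show ?thesis unfolding cmult_right by simp
  qed
  then show ?case by auto
next
  case (insert v N)
  obtain d where d: "\<And>x. x \<notin> N \<Longrightarrow> d x = (if x = v then 1 else 0)"
    "\<And>\<phi>. (\<forall>x. x \<notin> N \<longrightarrow> \<phi> x = 0) \<Longrightarrow> B d \<phi> = 0"
    using insert.IH[of "\<lambda>x. if x = v then 1 else 0"] by auto
  obtain f1 where f1: "\<And>x. x \<notin> N \<Longrightarrow> f1 x = f x"
    "\<And>\<phi>. (\<forall>x. x \<notin> N \<longrightarrow> \<phi> x = 0) \<Longrightarrow> B f1 \<phi> = 0"
    using insert.IH[of f] by auto
  define c where "c = (if B d d = 0 then 0 else - B f1 d / B d d)"
  define f' where "f' = (\<lambda>x. f1 x + c * d x)"
  have fd: "B f' d = 0"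
    using null_orthogonal[of d f1] by (auto simp: f'_def add_left cmult_left c_def)
  have "B f' \<phi> = 0" if \<phi>: "\<forall>x. x \<notin> insert v N \<longrightarrow> \<phi> x = 0" for \<phi>
  proof -
    (* d equals 1 at v, so this removes the component of the test function at v *)
    define \<psi> where "\<psi> = (\<lambda>x. \<phi> x + (- \<phi> v) * d x)"
    have \<psi>: "\<forall>x. x \<notin> N \<longrightarrow> \<psi> x = 0" using \<phi> insert.hyps d(1) by (auto simp: \<psi>_def)
    have "B f' \<psi> = 0"
      using f1(2)[OF \<psi>] d(2)[OF \<psi>] by (simp add: f'_def add_left cmult_left)
    moreover have "B f' \<psi> = B f' \<phi> + (- \<phi> v) * B f' d"
      unfolding \<psi>_def by (simp only: add_right cmult_right)
    ultimately show ?thesis using fd by simp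
  qed
  moreover have "f' x = f x" if "x \<notin> insert v N" for x
    using that d(1)[of x] f1(1)[of x] by (auto simp: f'_def)
  ultimately show ?case by blast
qed

end

locale fe_energy = fe_mesh Th \<Omega> \<Omega>' for Th :: "(real ^ 'n) set set" and \<Omega> \<Omega>' +
  fixes C :: "real ^ 'n ^ 'n" and \<kappa> \<epsilon> :: real
  assumes C_sym: "transpose C = C" and C_pos: "\<And>F. F \<noteq> 0 \<Longrightarrow> 0 < quad C F"
    and \<kappa>_pos: "0 < \<kappa>" and \<epsilon>_pos: "0 < \<epsilon>"
begin

abbreviation \<E> where "\<E> \<equiv> energy C \<kappa> \<epsilon> Th \<Omega> \<Omega>'"

abbreviation minimises where "minimises \<equiv> minimizer C \<kappa> \<epsilon> Th \<Omega> \<Omega>'"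

lemma quad_nonneg: "0 \<le> quad C F"
  using C_pos[of F] by (cases "F = 0") (auto simp: quad_def)

lemma quad_zero_iff: "quad C F = 0 \<longleftrightarrow> F = 0"
  by (cases "F = 0") (use C_pos[of F] in \<open>auto simp: quad_def\<close>)

lemma C_inner_sym: "F \<bullet> (C *v G) = G \<bullet> (C *v F)"
  by (metis C_sym dot_lmul_matrix inner_commute vector_transpose_matrix)

definition nodes where "nodes = {v. \<exists>T\<in>cells. v extreme_point_of T}"

text \<open>
  The nodes at which the displacement may be chosen; at the other nodes it is prescribed, as they are
  vertices of clamped cells.
\<close>

definition free_nodes where "free_nodes = nodes - {v. \<exists>T\<in>cells. clamped T \<and> v extreme_point_of T}"

lemma finite_nodes: "finite nodes"
proof -
  have "nodes = (\<Union>T\<in>cells. {v. v extreme_point_of T})" by (auto simp: nodes_def)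
  then show ?thesis using finite_cells simplex_facts(6)[OF cellsD] by auto
qed

lemma finite_free_nodes: "finite free_nodes"
  using finite_nodes by (auto simp: free_nodes_def)

definition nodal_slope where "nodal_slope f T = slope (interpolant Th f) T"

lemma nodal_slope_add: "T \<in> cells \<Longrightarrow> nodal_slope (\<lambda>x. f x + g x) T = nodal_slope f T + nodal_slope g T"
  unfolding nodal_slope_def interpolant_add
  by (intro slope_add_cell interpolant_affine cellsD)

lemma nodal_slope_cmult: "T \<in> cells \<Longrightarrow> nodal_slope (\<lambda>x. c * f x) T = c *\<^sub>R nodal_slope f T"
  unfolding nodal_slope_def interpolant_cmult
  by (intro slope_cmult_cell interpolant_affine cellsD)

lemma nodal_slope_cong:
  "T \<in> cells \<Longrightarrow> (\<And>v. v \<in> nodes \<Longrightarrow> f v = g v) \<Longrightarrow> nodal_slope f T = nodal_slope g T"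
  unfolding nodal_slope_def
  by (intro slope_cong interpolant_cong_vertices) (auto simp: cellsD nodes_def)

text \<open>
  The polarised elastic energy of the cells outside the crack; cells in \<open>P\<close> drop out because there the
  eigenstrain cancels the slope.
\<close>

definition form where
  "form P f g = (\<Sum>T\<in>cells - P. vol T * (nodal_slope f T \<bullet> (C *v nodal_slope g T)))"

lemma form_semidefinite: "semidefinite_form (form P)"
proof
  show "form P (\<lambda>x. f x + g x) h = form P f h + form P g h" for f g h
    by (simp add: form_def nodal_slope_add inner_add_left distrib_left sum.distrib)
  show "form P (\<lambda>x. c * f x) h = c * form P f h" for c f h
    by (simp add: form_def nodal_slope_cmult sum_distrib_left mult.left_commute)
  show "form P f g = form P g f" for f g
    unfolding form_def by (subst C_inner_sym) (rule refl)
  show "0 \<le> form P f f" for f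
    unfolding form_def by (intro sum_nonneg mult_nonneg_nonneg vol_nonneg) (use quad_nonneg in \<open>simp add: quad_def\<close>)
qed

lemmas form_rules = semidefinite_form.add_left[OF form_semidefinite] semidefinite_form.add_right[OF form_semidefinite]
  semidefinite_form.cmult_left[OF form_semidefinite] semidefinite_form.cmult_right[OF form_semidefinite]

lemmas form_sym = semidefinite_form.sym[OF form_semidefinite]
lemmas form_nonneg = semidefinite_form.nonneg[OF form_semidefinite]

lemma form_cong:
  assumes "\<And>v. v \<in> nodes \<Longrightarrow> f v = f' v" "\<And>v. v \<in> nodes \<Longrightarrow> g v = g' v"
  shows "form P f g = form P f' g'"
  unfolding form_def using nodal_slope_cong[OF _ assms(1)] nodal_slope_cong[OF _ assms(2)] by simp

lemma form_zero_imp: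
  assumes "form P f f = 0" "T \<in> cells - P" "T \<inter> \<Omega> \<noteq> {}"
  shows "nodal_slope f T = 0"
proof -
  have "\<forall>T\<in>cells - P. vol T * (nodal_slope f T \<bullet> (C *v nodal_slope f T)) = 0"
    using assms(1) finite_cells unfolding form_def
    by (subst (asm) sum_nonneg_eq_0_iff)
       (auto intro!: mult_nonneg_nonneg vol_nonneg quad_nonneg[unfolded quad_def])
  then have "vol T * quad C (nodal_slope f T) = 0" using assms(2) by (simp add: quad_def)
  moreover have "vol T > 0" using vol_pos[of T] assms(2,3) by blast
  ultimately have "quad C (nodal_slope f T) = 0" by simp
  then show ?thesis by (simp add: quad_zero_iff)
qed

text \<open>
  Discrete harmonic extension of the boundary values of \<open>f\<close> in the domain cracked along \<open>P\<close>: the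
  Euler--Lagrange equation of the elastic energy.
\<close>

definition harmonic where
  "harmonic P f h \<longleftrightarrow> (\<forall>v\<in>nodes - free_nodes. h v = f v) \<and>
     (\<forall>\<phi>. (\<forall>v. v \<notin> free_nodes \<longrightarrow> \<phi> v = 0) \<longrightarrow> form P h \<phi> = 0)"

lemma harmonic_orthogonal:
  assumes "harmonic P f h" "\<And>v. v \<in> nodes - free_nodes \<Longrightarrow> \<phi> v = 0"
  shows "form P h \<phi> = 0"
proof -
  have "form P h \<phi> = form P h (\<lambda>v. if v \<in> free_nodes then \<phi> v else 0)"
    using assms(2) by (intro form_cong) auto
  also have "\<dots> = 0" using assms(1) by (auto simp: harmonic_def)
  finally show ?thesis .
qed

lemma harmonic_exists: "\<exists>h. harmonic P f h"
  using semidefinite_form.projection_exists[OF form_semidefinite finite_free_nodes, of f P]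
  unfolding harmonic_def by blast

lemma harmonic_add: "harmonic P f h \<Longrightarrow> harmonic P g k \<Longrightarrow> harmonic P (\<lambda>x. f x + g x) (\<lambda>x. h x + k x)"
  by (auto simp: harmonic_def form_rules)

lemma harmonic_cmult: "harmonic P f h \<Longrightarrow> harmonic P (\<lambda>x. c * f x) (\<lambda>x. c * h x)"
  by (auto simp: harmonic_def form_rules)

lemma pythagoras:
  assumes h: "harmonic P f h" and g: "\<And>v. v \<in> nodes - free_nodes \<Longrightarrow> g v = f v"
  shows "form P g g = form P h h + form P (\<lambda>x. g x + (-1) * h x) (\<lambda>x. g x + (-1) * h x)"
proof -
  have "form P h (\<lambda>x. g x + (-1) * h x) = 0"
    using h g by (intro harmonic_orthogonal[OF h]) (auto simp: harmonic_def)
  then have "form P h g + (-1) * form P h h = 0" by (simp only: form_rules)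
  then show ?thesis unfolding form_rules using form_sym[of P g h] by (simp add: algebra_simps)
qed

text \<open>
  By the Pythagorean identity a competitor with minimal energy differs from the harmonic extension by a
  null vector of the form, and null vectors have slope zero on every uncracked cell of positive volume.
\<close>

lemma minimal_imp_same_slope:
  assumes h: "harmonic P f h" and g: "\<And>v. v \<in> nodes - free_nodes \<Longrightarrow> g v = f v"
    and le: "form P g g \<le> form P h h" and T: "T \<in> cells - P" "T \<inter> \<Omega> \<noteq> {}"
  shows "nodal_slope g T = nodal_slope h T"
proof -
  have "form P (\<lambda>x. g x + (-1) * h x) (\<lambda>x. g x + (-1) * h x) = 0"
    using pythagoras[OF h g] le form_nonneg[of P "\<lambda>x. g x + (-1) * h x"] by linarith
  from form_zero_imp[OF this T] show ?thesis
    using T nodal_slope_add[of T g "\<lambda>x. (-1) * h x"] nodal_slope_cmult[of T "-1" h] by simp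
qed

lemma harmonic_unique:
  assumes h: "harmonic P f h" and k: "harmonic P f k" and T: "T \<in> cells - P" "T \<inter> \<Omega> \<noteq> {}"
  shows "nodal_slope h T = nodal_slope k T"
proof (rule minimal_imp_same_slope[OF k _ _ T])
  show "\<And>v. v \<in> nodes - free_nodes \<Longrightarrow> h v = f v" using h by (simp add: harmonic_def)
  have kf: "\<And>v. v \<in> nodes - free_nodes \<Longrightarrow> k v = f v" using k by (simp add: harmonic_def)
  show "form P h h \<le> form P k k"
    using pythagoras[OF h kf] form_nonneg[of P "\<lambda>x. k x + (-1) * h x"] by linarith
qed

definition extension where "extension P f = (SOME h. harmonic P f h)"

lemma harmonic_extension: "harmonic P f (extension P f)"
  unfolding extension_def by (rule someI_ex[OF harmonic_exists])

text \<open>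
  The elastic strain \<open>\<nabla>u - \<gamma>\<close> of an optimal pair with crack \<open>P\<close>.
\<close>

definition strain where "strain P f T = (if T \<in> P then 0 else nodal_slope (extension P f) T)"

definition elastic where "elastic P f = (\<Sum>T\<in>cells. vol T * quad C (strain P f T))"

lemma elastic_eq_form: "elastic P f = form P (extension P f) (extension P f)"
proof -
  have "elastic P f = (\<Sum>T\<in>cells - P. vol T * quad C (strain P f T))"
    unfolding elastic_def using finite_cells
    by (intro sum.mono_neutral_right) (auto simp: strain_def quad_def)
  also have "\<dots> = form P (extension P f) (extension P f)"
    unfolding form_def by (intro sum.cong) (auto simp: strain_def quad_def)
  finally show ?thesis .
qed

lemma elastic_le:
  assumes "\<And>v. v \<in> nodes - free_nodes \<Longrightarrow> g v = f v"
  shows "elastic P f \<le> form P g g"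
proof -
  have "form P g g = elastic P f + form P (\<lambda>x. g x + (-1) * extension P f x) (\<lambda>x. g x + (-1) * extension P f x)"
    unfolding elastic_eq_form by (rule pythagoras[OF harmonic_extension assms])
  then show ?thesis using form_nonneg[of P "\<lambda>x. g x + (-1) * extension P f x"] by linarith
qed

text \<open>
  Harmonic extensions of the nodal basis combine to a harmonic extension of \<open>f\<close>, and the slope of such an
  extension is unique. All continuity in time comes from this formula.
\<close>

lemma strain_linear:
  assumes T: "T \<in> cells" "T \<inter> \<Omega> \<noteq> {}"
  shows "strain P f T = (\<Sum>v\<in>nodes. f v *\<^sub>R strain P (\<lambda>x. if x = v then 1 else 0) T)"
proof (cases "T \<in> P")
  case True
  then show ?thesis by (simp add: strain_def)
next
  case False
  let ?d = "\<lambda>v x. if x = v then (1::real) else 0"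
  have zero: "nodal_slope (\<lambda>x. 0) T = 0" using nodal_slope_cmult[OF T(1), of 0 "\<lambda>x. 0"] by simp
  have z: "harmonic P (\<lambda>x. 0) (\<lambda>x. 0)"
    using harmonic_cmult[OF harmonic_extension[of P "\<lambda>x. 0"], of 0] by simp
  have *: "harmonic P (\<lambda>x. \<Sum>v\<in>J. f v * ?d v x) (\<lambda>x. \<Sum>v\<in>J. f v * extension P (?d v) x) \<and>
      nodal_slope (\<lambda>x. \<Sum>v\<in>J. f v * extension P (?d v) x) T = (\<Sum>v\<in>J. f v *\<^sub>R nodal_slope (extension P (?d v)) T)"
    if "finite J" for J
    using that
  proof (induction J rule: finite_induct)
    case empty then show ?case using z zero by simp
  next
    case (insert v J)
    have "harmonic P (\<lambda>x. f v * ?d v x + (\<Sum>v\<in>J. f v * ?d v x)) (\<lambda>x. f v * extension P (?d v) x + (\<Sum>v\<in>J. f v * extension P (?d v) x))"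
      using insert.IH by (intro harmonic_add harmonic_cmult harmonic_extension) simp
    moreover have "nodal_slope (\<lambda>x. f v * extension P (?d v) x + (\<Sum>v\<in>J. f v * extension P (?d v) x)) T
       = f v *\<^sub>R nodal_slope (extension P (?d v)) T + (\<Sum>v\<in>J. f v *\<^sub>R nodal_slope (extension P (?d v)) T)"
      using insert.IH by (simp add: nodal_slope_add[OF T(1)] nodal_slope_cmult[OF T(1)])
    ultimately show ?case using insert.hyps by simp
  qed
  have "harmonic P f (\<lambda>x. \<Sum>v\<in>nodes. f v * extension P (?d v) x)"
  proof -
    have "(\<Sum>v\<in>nodes. f v * ?d v w) = f w" if "w \<in> nodes" for w
    proof -
      have "(\<Sum>v\<in>nodes. f v * ?d v w) = (\<Sum>v\<in>nodes. if v = w then f v else 0)" by (intro sum.cong) auto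
      then show ?thesis using that finite_nodes by simp
    qed
    then show ?thesis using *[OF finite_nodes] by (simp add: harmonic_def)
  qed
  then have "nodal_slope (extension P f) T = nodal_slope (\<lambda>x. \<Sum>v\<in>nodes. f v * extension P (?d v) x) T"
    using False T by (intro harmonic_unique[OF harmonic_extension]) auto
  then show ?thesis using *[OF finite_nodes] False by (simp add: strain_def)
qed

definition cracks where "cracks = {P. P \<subseteq> cells \<and> (\<forall>T\<in>P. \<not> clamped T)}"

lemma finite_cracks: "finite cracks"
  unfolding cracks_def using finite_cells by (auto intro: finite_subset[of _ "Pow cells"])

lemma cracks_Un: "P \<in> cracks \<Longrightarrow> Q \<in> cracks \<Longrightarrow> P \<union> Q \<in> cracks"
  by (auto simp: cracks_def)

text \<open>
  Least energy for the datum \<open>f\<close> among all pairs whose crack, old and new, is \<open>P\<close>.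
\<close>

definition total where "total P f = elastic P f + \<kappa> / (2 * \<epsilon>) * crack_area \<epsilon> P"

lemma clamped_nodes:
  "T \<in> cells \<Longrightarrow> clamped T \<Longrightarrow> v extreme_point_of T \<Longrightarrow> v \<in> nodes - free_nodes"
  by (auto simp: nodes_def free_nodes_def)

lemma not_free_node: "v \<in> nodes - free_nodes \<Longrightarrow> \<exists>T\<in>cells. clamped T \<and> v extreme_point_of T"
  by (auto simp: nodes_def free_nodes_def)

lemma admissible_boundary_nodes:
  assumes "(u, \<gamma>) \<in> \<A> (interpolant Th f)" "v \<in> nodes - free_nodes"
  shows "u v = f v"
proof -
  obtain T where T: "T \<in> cells" "clamped T" "v extreme_point_of T" using not_free_node[OF assms(2)] by blast
  have "u v = interpolant Th f v"
  proof (rule affine_eq_if_eq_on_collar[OF T(1,2)])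
    show "affine_fun_on T u" using assms(1) T by (auto simp: admissible_pairs_def intro: V_space_affine)
    show "affine_fun_on T (interpolant Th f)" using T by (intro interpolant_affine cellsD)
    show "\<forall>x\<in>\<Omega>' - closure \<Omega>. u x = interpolant Th f x" using assms(1) by (auto simp: admissible_pairs_def)
    show "v \<in> T" using T(3) by (simp add: extreme_point_of_def)
  qed
  then show ?thesis using interpolant_vertex[OF cellsD[OF T(1)] T(3)] by simp
qed

lemma V_space_nodal_slope:
  assumes "u \<in> V_space Th \<Omega>'" "T \<in> cells"
  shows "nodal_slope u T = slope u T"
  unfolding nodal_slope_def
proof (rule slope_cong)
  fix x assume "x \<in> T"
  then show "interpolant Th u x = u x"
    by (intro interpolant_eqI[OF cellsD[OF assms(2)] V_space_affine[OF assms]]) auto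
qed

lemma support_cracks:
  "(u, \<gamma>) \<in> \<A> w \<Longrightarrow> support \<gamma> \<in> cracks"
  using support_not_clamped support_subset by (auto simp: cracks_def)

lemma energy_split:
  assumes u: "u \<in> V_space Th \<Omega>'" and \<gamma>: "\<gamma> \<in> W_space Th \<Omega>'" and \<Psi>: "closure \<Psi> = \<Union>P0"
    and P: "P = P0 \<union> support \<gamma>" and P0: "P0 \<subseteq> cells"
  shows "\<E> u \<gamma> \<Psi> = form P u u
      + (\<Sum>T\<in>P. vol T * quad C (slope u T - cell_value \<gamma> T)) + \<kappa> / (2 * \<epsilon>) * crack_area \<epsilon> P"
proof -
  have Pc: "P \<subseteq> cells" using P P0 support_subset by auto
  have "(\<Sum>T\<in>cells. vol T * quad C (slope u T - cell_value \<gamma> T)) =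
    (\<Sum>T\<in>cells - P. vol T * quad C (slope u T - cell_value \<gamma> T)) + (\<Sum>T\<in>P. vol T * quad C (slope u T - cell_value \<gamma> T))"
    by (rule sum.subset_diff[OF Pc finite_cells])
  also have "(\<Sum>T\<in>cells - P. vol T * quad C (slope u T - cell_value \<gamma> T)) = form P u u"
    unfolding form_def
    by (intro sum.cong) (auto simp: P support_def quad_def V_space_nodal_slope[OF u])
  finally show ?thesis using energy_formula[OF u \<gamma> \<Psi>] P by simp
qed

lemma energy_ge_total:
  assumes adm: "(u, \<gamma>) \<in> \<A> (interpolant Th f)"
    and \<Psi>: "closure \<Psi> = \<Union>P0" and P0: "P0 \<subseteq> cells"
  shows "total (P0 \<union> support \<gamma>) f \<le> \<E> u \<gamma> \<Psi>"
proof -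
  have u: "u \<in> V_space Th \<Omega>'" "\<gamma> \<in> W_space Th \<Omega>'" using adm by (auto simp: admissible_pairs_def)
  have "0 \<le> (\<Sum>T\<in>P0 \<union> support \<gamma>. vol T * quad C (slope u T - cell_value \<gamma> T))"
    by (intro sum_nonneg mult_nonneg_nonneg vol_nonneg quad_nonneg)
  moreover have "elastic (P0 \<union> support \<gamma>) f \<le> form (P0 \<union> support \<gamma>) u u"
    by (rule elastic_le) (rule admissible_boundary_nodes[OF adm])
  ultimately show ?thesis using energy_split[OF u \<Psi> refl P0] by (simp add: total_def)
qed

text \<open>
  The optimal \<open>\<gamma>\<close> for a crack \<open>P\<close>. On the null set of cell boundaries it is zero by convention.
\<close>

definition eigenstrain where
  "eigenstrain P u x = (if \<exists>T\<in>P. x \<in> interior T then grad u x else 0)"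

lemma eigenstrain_AE:
  assumes u: "u \<in> V_space Th \<Omega>'" and P: "P \<subseteq> cells"
  shows "AE x in lebesgue. \<forall>T\<in>cells. x \<in> T \<longrightarrow> eigenstrain P u x = (if T \<in> P then slope u T else 0)"
  using AE_interior_cells AE_grad[OF u]
proof eventually_elim
  case (elim x)
  show ?case
  proof (intro ballI impI)
    fix T assume T: "T \<in> cells" "x \<in> T"
    then have xi: "x \<in> interior T" using elim by blast
    show "eigenstrain P u x = (if T \<in> P then slope u T else 0)"
    proof (cases "T \<in> P")
      case True
      then show ?thesis using xi elim T by (auto simp: eigenstrain_def)
    next
      case False
      have "\<not> (\<exists>T'\<in>P. x \<in> interior T')"
      proof
        assume "\<exists>T'\<in>P. x \<in> interior T'"
        then obtain T' where "T' \<in> P" "x \<in> interior T'" by blast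
        then show False using interior_disjoint[of T' T x] xi P T False by (auto simp: cellsD)
      qed
      then show ?thesis using False by (simp add: eigenstrain_def)
    qed
  qed
qed

lemma eigenstrain_W:
  assumes u: "u \<in> V_space Th \<Omega>'" and P: "P \<subseteq> cells"
  shows "eigenstrain P u \<in> W_space Th \<Omega>'"
  unfolding W_space_def
proof (clarify)
  fix T assume "T \<in> Th" "T \<inter> \<Omega>' \<noteq> {}"
  then have "T \<in> cells" by (simp add: cells_def)
  then have "AE x in lebesgue. x \<in> T \<longrightarrow> eigenstrain P u x = (if T \<in> P then slope u T else 0)"
    using eigenstrain_AE[OF assms] by (auto elim!: eventually_mono)
  then show "\<exists>c. AE x in lebesgue. x \<in> T \<longrightarrow> eigenstrain P u x = c" by blast
qed

lemma cell_value_eigenstrain: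
  assumes u: "u \<in> V_space Th \<Omega>'" and P: "P \<subseteq> cells" and T: "T \<in> cells"
  shows "cell_value (eigenstrain P u) T = (if T \<in> P then slope u T else 0)"
proof (rule cell_value_eqI[OF T open_UNIV _ eigenstrain_W[OF u P]])
  show "T \<inter> UNIV \<noteq> {}" using T by (auto simp: cells_def)
  show "AE x in lebesgue. x \<in> T \<inter> UNIV \<longrightarrow> eigenstrain P u x = (if T \<in> P then slope u T else 0)"
    using eigenstrain_AE[OF u P] by eventually_elim (use T in auto)
qed

definition displacement where "displacement P f = interpolant Th (extension P f)"

lemma displacement_V: "displacement P f \<in> V_space Th \<Omega>'"
  unfolding displacement_def by (intro V_spaceI interpolant_affine cellsD)

lemma optimal_pair_admissible:
  assumes P: "P \<in> cracks"
  shows "(displacement P f, eigenstrain P (displacement P f)) \<in> \<A> (interpolant Th f)"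
proof -
  have Pc: "P \<subseteq> cells" using P by (simp add: cracks_def)
  have "displacement P f x = interpolant Th f x" if x: "x \<in> \<Omega>' - closure \<Omega>" for x
  proof -
    obtain T where T: "T \<in> cells" "x \<in> T" using domain_cover[of x] x by blast
    then have cl: "clamped T" using x by (auto simp: clamped_def)
    show ?thesis unfolding displacement_def
    proof (rule interpolant_cong_vertices[OF cellsD[OF T(1)] _ T(2)])
      fix v assume "v extreme_point_of T"
      then show "extension P f v = f v"
        using clamped_nodes[OF T(1) cl] harmonic_extension[of P f] by (auto simp: harmonic_def)
    qed
  qed
  moreover have "AE x in lebesgue. x \<in> \<Omega>' - closure \<Omega> \<longrightarrow> eigenstrain P (displacement P f) x = 0"
    using eigenstrain_AE[OF displacement_V Pc, of P f]
  proof eventually_elim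
    case (elim x)
    show ?case
    proof
      assume x: "x \<in> \<Omega>' - closure \<Omega>"
      then obtain T where T: "T \<in> cells" "x \<in> T" using domain_cover[of x] by blast
      then have "T \<notin> P" using x P by (auto simp: clamped_def cracks_def)
      then show "eigenstrain P (displacement P f) x = 0" using elim T by simp
    qed
  qed
  ultimately show ?thesis
    using displacement_V eigenstrain_W[OF displacement_V Pc] by (simp add: admissible_pairs_def)
qed

lemma optimal_pair_support:
  assumes P: "P \<in> cracks"
  shows "support (eigenstrain P (displacement P f)) \<subseteq> P"
  using cell_value_eigenstrain[OF displacement_V, of P _ P f] P by (auto simp: support_def cracks_def split: if_splits)

lemma optimal_pair_energy:
  assumes P: "P \<in> cracks" and P0: "P0 \<subseteq> P" and \<Psi>: "closure \<Psi> = \<Union>P0"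
  shows "\<E> (displacement P f) (eigenstrain P (displacement P f)) \<Psi> \<le> total P f"
    and "P0 = P \<Longrightarrow> \<E> (displacement P f) (eigenstrain P (displacement P f)) \<Psi> = total P f"
proof -
  let ?u = "displacement P f" and ?\<gamma> = "eigenstrain P (displacement P f)"
  have Pc: "P \<subseteq> cells" using P by (simp add: cracks_def)
  have supp: "P0 \<union> support ?\<gamma> \<subseteq> P" using optimal_pair_support[OF P] P0 by blast
  have *: "vol T * quad C (slope ?u T - cell_value ?\<gamma> T) = vol T * quad C (strain P f T)" if "T \<in> cells" for T
    using cell_value_eigenstrain[OF displacement_V Pc that, of P f]
    by (simp add: strain_def nodal_slope_def displacement_def)
  have eq: "\<E> ?u ?\<gamma> \<Psi> = elastic P f + \<kappa> / (2 * \<epsilon>) * crack_area \<epsilon> (P0 \<union> support ?\<gamma>)"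
    unfolding energy_formula[OF displacement_V eigenstrain_W[OF displacement_V Pc] \<Psi>] elastic_def
    by (simp only: sum.cong[OF refl *])
  have "crack_area \<epsilon> (P0 \<union> support ?\<gamma>) \<le> crack_area \<epsilon> P" by (rule crack_area_mono[OF supp Pc])
  then show "\<E> ?u ?\<gamma> \<Psi> \<le> total P f"
    unfolding eq total_def using \<kappa>_pos \<epsilon>_pos by (intro add_left_mono mult_left_mono) auto
  assume "P0 = P"
  then have "P0 \<union> support ?\<gamma> = P" using supp by blast
  then show "\<E> ?u ?\<gamma> \<Psi> = total P f" unfolding eq total_def by simp
qed

text \<open>
  The infimum over pairs reduces to a minimum of \<open>total\<close> over the finitely many cracks containing the
  given one: \<open>energy_ge_total\<close> is the lower bound, \<open>optimal_pair_energy\<close> the construction.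
\<close>

lemma minimizer_exists:
  assumes P0: "P0 \<in> cracks" and \<Psi>: "closure \<Psi> = \<Union>P0"
  shows "\<exists>u \<gamma>. minimises (interpolant Th f) \<Psi> u \<gamma>"
proof -
  let ?S = "{P\<in>cracks. P0 \<subseteq> P}"
  have S: "finite ?S" "?S \<noteq> {}" using finite_cracks P0 by auto
  define P where "P = arg_min_on (\<lambda>P. total P f) ?S"
  have P: "P \<in> ?S" "\<And>P'. P' \<in> ?S \<Longrightarrow> total P f \<le> total P' f"
    unfolding P_def by (rule arg_min_if_finite(1)[OF S], rule arg_min_least[OF S])
  have "minimises (interpolant Th f) \<Psi> (displacement P f) (eigenstrain P (displacement P f))"
    unfolding minimizer_def
  proof (intro conjI ballI, goal_cases)
    case 1 show ?case using P by (intro optimal_pair_admissible) simp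
  next
    case (2 p)
    obtain v \<eta> where p: "p = (v, \<eta>)" by (cases p)
    have adm: "(v, \<eta>) \<in> \<A> (interpolant Th f)" using 2 p by simp
    have "\<E> (displacement P f) (eigenstrain P (displacement P f)) \<Psi> \<le> total P f"
      using P \<Psi> by (intro optimal_pair_energy(1)[where ?P0.0=P0]) auto
    also have "\<dots> \<le> total (P0 \<union> support \<eta>) f"
      using P0 support_cracks[OF adm] by (intro P(2)) (auto intro: cracks_Un)
    also have "\<dots> \<le> \<E> v \<eta> \<Psi>"
      using P0 by (intro energy_ge_total[OF adm \<Psi>]) (simp add: cracks_def)
    finally show ?case using p by simp
  qed
  then show ?thesis by blast
qed

text \<open>
  A minimiser attains the lower bound \<open>total P f\<close>, so equality holds in both estimates behind that bound:
  the eigenstrain cancels the slope on the crack, and \<open>u\<close> has minimal elastic energy off the crack. In this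
  way a minimiser, though not unique, has an energy and a strain that depend on \<open>P\<close> and \<open>f\<close> alone.
\<close>

lemma minimizer_properties:
  assumes min: "minimises (interpolant Th f) \<Psi> u \<gamma>"
    and P0: "P0 \<in> cracks" and \<Psi>: "closure \<Psi> = \<Union>P0" and P: "P = P0 \<union> support \<gamma>"
  shows "P \<in> cracks"
    and "\<E> u \<gamma> \<Psi> = total P f"
    and "\<And>\<Psi>'. closure \<Psi>' = \<Union>P \<Longrightarrow> \<E> u \<gamma> \<Psi>' = total P f"
    and "\<And>P'. P' \<in> cracks \<Longrightarrow> P0 \<subseteq> P' \<Longrightarrow> total P f \<le> total P' f"
    and "\<And>T. T \<in> cells \<Longrightarrow> T \<inter> \<Omega> \<noteq> {} \<Longrightarrow> slope u T - cell_value \<gamma> T = strain P f T"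
proof -
  have adm: "(u, \<gamma>) \<in> \<A> (interpolant Th f)"
    and le: "\<And>v \<eta>. (v, \<eta>) \<in> \<A> (interpolant Th f) \<Longrightarrow>
       \<E> u \<gamma> \<Psi> \<le> \<E> v \<eta> \<Psi>"
    using min by (auto simp: minimizer_def)
  have u: "u \<in> V_space Th \<Omega>'" "\<gamma> \<in> W_space Th \<Omega>'" using adm by (auto simp: admissible_pairs_def)
  show Pc: "P \<in> cracks" unfolding P by (intro cracks_Un P0 support_cracks[OF adm])
  have P0c: "P0 \<subseteq> cells" using P0 by (simp add: cracks_def)
  have ge: "total P f \<le> \<E> u \<gamma> \<Psi>" unfolding P by (rule energy_ge_total[OF adm \<Psi> P0c])
  show comp: "total P f \<le> total P' f" if P': "P' \<in> cracks" "P0 \<subseteq> P'" for P'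
    using ge le[OF optimal_pair_admissible[OF P'(1)]] optimal_pair_energy(1)[OF P' \<Psi>, of f] by (meson order_trans)
  show en: "\<E> u \<gamma> \<Psi> = total P f"
  proof (rule antisym[OF _ ge])
    have "P0 \<subseteq> P" using P by simp
    then show "\<E> u \<gamma> \<Psi> \<le> total P f"
      using le[OF optimal_pair_admissible[OF Pc]] optimal_pair_energy(1)[OF Pc _ \<Psi>, of f] by (meson order_trans)
  qed
  show "\<E> u \<gamma> \<Psi>' = total P f" if "closure \<Psi>' = \<Union>P" for \<Psi>'
    using energy_formula[OF u that] energy_formula[OF u \<Psi>] en P by (simp add: Un_assoc)
  let ?S = "\<Sum>T\<in>P. vol T * quad C (slope u T - cell_value \<gamma> T)"
  have S0: "0 \<le> ?S" by (intro sum_nonneg mult_nonneg_nonneg vol_nonneg quad_nonneg)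
  have el: "elastic P f \<le> form P u u"
    by (rule elastic_le) (rule admissible_boundary_nodes[OF adm])
  have "form P u u + ?S = elastic P f"
    using energy_split[OF u \<Psi> P P0c] en by (simp add: total_def)
  then have S: "?S = 0" and F: "form P u u \<le> form P (extension P f) (extension P f)"
    using S0 el by (auto simp: elastic_eq_form)
  fix T assume T: "T \<in> cells" "T \<inter> \<Omega> \<noteq> {}"
  show "slope u T - cell_value \<gamma> T = strain P f T"
  proof (cases "T \<in> P")
    case True
    have "finite P" using Pc finite_cells by (auto simp: cracks_def intro: finite_subset)
    then have "vol T * quad C (slope u T - cell_value \<gamma> T) = 0"
      using S True by (subst (asm) sum_nonneg_eq_0_iff)
        (auto intro!: mult_nonneg_nonneg vol_nonneg quad_nonneg)
    then have "quad C (slope u T - cell_value \<gamma> T) = 0" using vol_pos[OF T] by simp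
    then show ?thesis using True by (simp add: quad_zero_iff strain_def)
  next
    case False
    have "nodal_slope u T = nodal_slope (extension P f) T"
      using False T by (intro minimal_imp_same_slope[OF harmonic_extension _ F] admissible_boundary_nodes[OF adm]) auto
    moreover have "cell_value \<gamma> T = 0" using False T by (simp add: P support_def)
    ultimately show ?thesis using False by (simp add: strain_def V_space_nodal_slope[OF u(1) T(1)])
  qed
qed

end

section \<open>Dependence of the elastic energy on the load\<close>

lemma uniform_finite_bound:
  fixes F :: "'a \<Rightarrow> 'b \<Rightarrow> real"
  assumes "finite S" "\<And>x. x \<in> S \<Longrightarrow> \<exists>M. \<forall>t\<in>A. \<bar>F x t\<bar> \<le> M"
  shows "\<exists>M\<ge>0. \<forall>x\<in>S. \<forall>t\<in>A. \<bar>F x t\<bar> \<le> M"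
proof -
  obtain M where M: "\<And>x t. x \<in> S \<Longrightarrow> t \<in> A \<Longrightarrow> \<bar>F x t\<bar> \<le> M x" using assms(2) by metis
  have "\<bar>F x t\<bar> \<le> (\<Sum>x\<in>S. \<bar>M x\<bar>)" if "x \<in> S" "t \<in> A" for x t
  proof -
    have "\<bar>M x\<bar> \<le> (\<Sum>x\<in>S. \<bar>M x\<bar>)" using that assms(1) by (intro member_le_sum) auto
    then show ?thesis using M[OF that] by linarith
  qed
  then show ?thesis by (intro exI[of _ "\<Sum>x\<in>S. \<bar>M x\<bar>"]) (auto intro: sum_nonneg)
qed

context fe_energy
begin

definition hat where "hat v = (\<lambda>x. if x = v then 1 else 0 :: real)" for v :: "real ^ 'n"

lemma sum_hat: "w \<in> nodes \<Longrightarrow> (\<Sum>v\<in>nodes. f v * hat v w) = f w"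
proof -
  assume w: "w \<in> nodes"
  have "(\<Sum>v\<in>nodes. f v * hat v w) = (\<Sum>v\<in>nodes. if v = w then f v else 0)"
    by (intro sum.cong) (auto simp: hat_def)
  then show ?thesis using w finite_nodes by simp
qed

lemma nodal_slope_expand:
  assumes T: "T \<in> cells"
  shows "nodal_slope f T = (\<Sum>v\<in>nodes. f v *\<^sub>R nodal_slope (hat v) T)"
proof -
  have zero: "nodal_slope (\<lambda>x. 0) T = 0" using nodal_slope_cmult[OF T, of 0 "\<lambda>x. 0"] by simp
  have *: "nodal_slope (\<lambda>x. \<Sum>v\<in>J. f v * hat v x) T = (\<Sum>v\<in>J. f v *\<^sub>R nodal_slope (hat v) T)" if "finite J" for J
    using that
    by (induction J rule: finite_induct) (auto simp: zero nodal_slope_add[OF T] nodal_slope_cmult[OF T])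
  have "nodal_slope f T = nodal_slope (\<lambda>x. \<Sum>v\<in>nodes. f v * hat v x) T"
    by (rule nodal_slope_cong[OF T]) (simp add: sum_hat)
  then show ?thesis using *[OF finite_nodes] by simp
qed

lemma interpolant_expand:
  assumes T: "T \<in> cells" "x \<in> T"
  shows "interpolant Th f x = (\<Sum>v\<in>nodes. f v * interpolant Th (hat v) x)"
proof -
  have zero: "interpolant Th (\<lambda>x. 0) = (\<lambda>x. 0)" using interpolant_cmult[of 0 "\<lambda>x. 0"] by simp
  have *: "interpolant Th (\<lambda>x. \<Sum>v\<in>J. f v * hat v x) x = (\<Sum>v\<in>J. f v * interpolant Th (hat v) x)" if "finite J" for J
    using that
    by (induction J rule: finite_induct) (auto simp: zero interpolant_add interpolant_cmult)
  have "interpolant Th f x = interpolant Th (\<lambda>x. \<Sum>v\<in>nodes. f v * hat v x) x"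
  proof (rule interpolant_cong_vertices[OF cellsD[OF T(1)] _ T(2)])
    fix v assume "v extreme_point_of T"
    then have "v \<in> nodes" using T by (auto simp: nodes_def)
    then show "f v = (\<Sum>w\<in>nodes. f w * hat w v)" by (simp add: sum_hat)
  qed
  then show ?thesis using *[OF finite_nodes] by simp
qed

text \<open>
  The derivative of half the elastic energy with respect to the nodal value at \<open>v\<close> of the datum.
\<close>

definition stress where
  "stress P f v = (\<Sum>T\<in>cells. vol T * (strain P f T \<bullet> (C *v nodal_slope (hat v) T)))"

lemma matrix_vector_sum: "C *v (\<Sum>v\<in>A. f v) = (\<Sum>v\<in>A. C *v f v)"
  by (rule linear_sum[OF matrix_vector_mul_linear, unfolded o_def])

lemma sum_stress:
  "(\<Sum>T\<in>cells. vol T * (strain P f T \<bullet> (C *v nodal_slope \<phi> T))) = (\<Sum>v\<in>nodes. \<phi> v * stress P f v)"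
proof -
  have "(\<Sum>T\<in>cells. vol T * (strain P f T \<bullet> (C *v nodal_slope \<phi> T)))
      = (\<Sum>T\<in>cells. \<Sum>v\<in>nodes. \<phi> v * (vol T * (strain P f T \<bullet> (C *v nodal_slope (hat v) T))))"
    by (intro sum.cong refl)
      (simp add: nodal_slope_expand[of _ \<phi>] matrix_vector_sum inner_sum_right sum_distrib_left matrix_vector_mult_scaleR mult.left_commute)
  also have "\<dots> = (\<Sum>v\<in>nodes. \<phi> v * stress P f v)"
    unfolding stress_def sum_distrib_left by (rule sum.swap)
  finally show ?thesis .
qed

lemma form_extension: "form P (extension P f) \<phi> = (\<Sum>v\<in>nodes. \<phi> v * stress P f v)"
proof -
  have "form P (extension P f) \<phi> = (\<Sum>T\<in>cells. vol T * (strain P f T \<bullet> (C *v nodal_slope \<phi> T)))"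
    unfolding form_def using finite_cells
    by (intro sum.mono_neutral_cong_left) (auto simp: strain_def)
  then show ?thesis by (simp add: sum_stress)
qed

text \<open>
  Difference of two squares. The difference of the two extensions may be replaced by that of the data, as
  both have the same boundary values and harmonic extensions are orthogonal to variations that vanish at
  the prescribed nodes.
\<close>

lemma elastic_difference:
  "elastic P f - elastic P f' = (\<Sum>v\<in>nodes. (stress P f v + stress P f' v) * (f v - f' v))"
proof -
  let ?h = "extension P f" and ?h' = "extension P f'"
  let ?d = "\<lambda>x. f x + (-1) * f' x" and ?e = "\<lambda>x. ?h x + (-1) * ?h' x"
  let ?\<phi> = "\<lambda>x. ?e x + (-1) * ?d x"
  have z: "?\<phi> v = 0" if "v \<in> nodes - free_nodes" for v
    using harmonic_extension[of P f] harmonic_extension[of P f'] that by (simp add: harmonic_def)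
  have "form P ?h ?\<phi> = 0" by (rule harmonic_orthogonal[OF harmonic_extension]) (rule z)
  moreover have "form P ?h' ?\<phi> = 0" by (rule harmonic_orthogonal[OF harmonic_extension]) (rule z)
  ultimately have "form P ?h ?e = form P ?h ?d" "form P ?h' ?e = form P ?h' ?d"
    by (simp_all only: form_rules(2)[of P _ ?e] form_rules(4)[of P _ "-1" ?d])
  moreover have "form P ?h ?h - form P ?h' ?h' = form P ?h ?e + form P ?h' ?e"
    unfolding form_rules using form_sym[of P ?h ?h'] by simp
  ultimately have "elastic P f - elastic P f' = form P ?h ?d + form P ?h' ?d"
    by (simp add: elastic_eq_form)
  also have "\<dots> = (\<Sum>v\<in>nodes. (stress P f v + stress P f' v) * (f v - f' v))"
    by (simp add: form_extension sum.distrib[symmetric] algebra_simps)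
  finally show ?thesis .
qed

lemma stress_body:
  "stress P f v = (\<Sum>T | T \<in> cells \<and> T \<inter> \<Omega> \<noteq> {}. vol T * (strain P f T \<bullet> (C *v nodal_slope (hat v) T)))"
  unfolding stress_def using finite_cells
  by (intro sum.mono_neutral_right) (auto simp: vol_zero)

end

text \<open>
  The datum enters only through its point values, which are indefinite integrals in time.
\<close>

locale fe_loading = fe_energy Th \<Omega> \<Omega>' C \<kappa> \<epsilon>
  for Th :: "(real ^ 'n) set set" and \<Omega> \<Omega>' C \<kappa> \<epsilon> +
  fixes g g' :: "real \<Rightarrow> real ^ 'n \<Rightarrow> real"
  assumes rate_integrable: "\<And>x. (\<lambda>s. g' s x) absolutely_integrable_on {0..1}"
    and load_eq: "\<And>t x. t \<in> {0..1} \<Longrightarrow> g t x = g 0 x + (LINT s:{0..t}|lebesgue. g' s x)"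
begin

lemma sub_integrable:
  fixes f :: "real \<Rightarrow> real"
  assumes "f absolutely_integrable_on {0..1}" "0 \<le> s" "t \<le> 1"
  shows "f absolutely_integrable_on {s..t}" "f integrable_on {s..t}"
proof -
  show "f absolutely_integrable_on {s..t}"
    by (rule set_integrable_subset[OF assms(1)]) (use assms in auto)
  then show "f integrable_on {s..t}" by (rule set_lebesgue_integral_eq_integral(1))
qed

lemma indefinite_integral_continuous:
  fixes f :: "real \<Rightarrow> real"
  assumes "f absolutely_integrable_on {0..1}"
  shows "continuous_on {0..1} (\<lambda>t. integral {0..t} f)"
  by (rule indefinite_integral_continuous_1[OF set_lebesgue_integral_eq_integral(1)[OF assms]])

lemma load_difference:
  assumes "0 \<le> s" "s \<le> t" "t \<le> 1"
  shows "g t x - g s x = integral {s..t} (\<lambda>r. g' r x)"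
proof -
  have "integral {0..s} (\<lambda>r. g' r x) + integral {s..t} (\<lambda>r. g' r x) = integral {0..t} (\<lambda>r. g' r x)"
    by (rule Henstock_Kurzweil_Integration.integral_combine)
       (use assms sub_integrable[OF rate_integrable] in auto)
  moreover have "(LINT r:{0..t}|lebesgue. g' r x) = integral {0..t} (\<lambda>r. g' r x)"
     "(LINT r:{0..s}|lebesgue. g' r x) = integral {0..s} (\<lambda>r. g' r x)"
    using assms by (auto intro!: set_lebesgue_integral_eq_integral(2) sub_integrable rate_integrable)
  ultimately show ?thesis using load_eq[of t x] load_eq[of s x] assms by simp
qed

lemma load_continuous: "continuous_on {0..1} (\<lambda>t. g t x)"
proof -
  have "continuous_on {0..1} (\<lambda>t. g 0 x + integral {0..t} (\<lambda>r. g' r x))"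
    by (rule continuous_on_add[OF continuous_on_const indefinite_integral_continuous[OF rate_integrable]])
  moreover have "g 0 x + integral {0..t} (\<lambda>r. g' r x) = g t x" if "t \<in> {0..1}" for t
    using load_difference[of 0 t x] that by simp
  ultimately show ?thesis by (rule continuous_on_eq)
qed

definition rate where "rate r = (\<Sum>v\<in>nodes. \<bar>g' r v\<bar>)"

lemma rate_nonneg: "0 \<le> rate r" by (simp add: rate_def sum_nonneg)

lemma abs_rate_integrable: "(\<lambda>r. \<bar>g' r x\<bar>) absolutely_integrable_on {0..1}"
  using set_integrable_abs[OF rate_integrable] .

lemma total_rate_integrable: "rate absolutely_integrable_on {0..1}"
  unfolding rate_def[abs_def] using finite_nodes abs_rate_integrable
  by (intro absolutely_integrable_sum)

text \<open>
  A bound for the variation of all nodal values of the datum up to time \<open>t\<close>.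
\<close>

definition arc where "arc t = integral {0..t} rate"

lemma arc_difference:
  assumes "0 \<le> s" "s \<le> t" "t \<le> 1"
  shows "arc t - arc s = integral {s..t} rate"
proof -
  have "integral {0..s} rate + integral {s..t} rate = integral {0..t} rate"
    by (rule Henstock_Kurzweil_Integration.integral_combine)
       (use assms sub_integrable[OF total_rate_integrable] in auto)
  then show ?thesis by (simp add: arc_def)
qed

lemma arc_continuous: "continuous_on {0..1} arc"
  unfolding arc_def
  by (rule indefinite_integral_continuous[OF total_rate_integrable])

lemma integral_combination_bound:
  assumes st: "0 \<le> s" "s \<le> t" "t \<le> 1"
    and c: "\<And>r v. v \<in> nodes \<Longrightarrow> s \<le> r \<Longrightarrow> r \<le> t \<Longrightarrow> \<bar>c r v\<bar> \<le> M"
    and int: "(\<lambda>r. \<Sum>v\<in>nodes. c r v * g' r v) integrable_on {s..t}"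
  shows "\<bar>integral {s..t} (\<lambda>r. \<Sum>v\<in>nodes. c r v * g' r v)\<bar> \<le> M * (arc t - arc s)"
proof -
  have "norm (integral {s..t} (\<lambda>r. \<Sum>v\<in>nodes. c r v * g' r v)) \<le> integral {s..t} (\<lambda>r. M * rate r)"
  proof (rule integral_norm_bound_integral[OF int])
    show "(\<lambda>r. M * rate r) integrable_on {s..t}"
      using sub_integrable(2)[OF total_rate_integrable st(1,3)] by (rule integrable_on_mult_right)
    fix r assume r: "r \<in> {s..t}"
    have "norm (\<Sum>v\<in>nodes. c r v * g' r v) \<le> (\<Sum>v\<in>nodes. \<bar>c r v * g' r v\<bar>)" by (simp add: sum_abs)
    also have "\<dots> \<le> (\<Sum>v\<in>nodes. M * \<bar>g' r v\<bar>)"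
      using c r by (intro sum_mono) (auto simp: abs_mult intro!: mult_right_mono)
    finally show "norm (\<Sum>v\<in>nodes. c r v * g' r v) \<le> M * rate r"
      by (simp add: rate_def sum_distrib_left)
  qed
  also have "\<dots> = M * (arc t - arc s)" using arc_difference[OF st] by simp
  finally show ?thesis by simp
qed

lemma strain_continuous:
  "T \<in> cells \<Longrightarrow> T \<inter> \<Omega> \<noteq> {} \<Longrightarrow> continuous_on {0..1} (\<lambda>t. strain P (g t) T)"
  by (subst strain_linear) (auto intro!: continuous_intros load_continuous)

lemma stress_continuous: "continuous_on {0..1} (\<lambda>t. stress P (g t) v)"
  unfolding stress_body by (intro continuous_intros strain_continuous) auto

lemma stress_bounded: "\<exists>M\<ge>0. \<forall>P\<in>cracks. \<forall>v\<in>nodes. \<forall>t\<in>{0..1}. \<bar>stress P (g t) v\<bar> \<le> M"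
proof -
  have "\<exists>M\<ge>0. \<forall>p\<in>cracks \<times> nodes. \<forall>t\<in>{0..1}. \<bar>stress (fst p) (g t) (snd p)\<bar> \<le> M"
  proof (rule uniform_finite_bound)
    show "finite (cracks \<times> nodes)" using finite_cracks finite_nodes by simp
    fix p :: "(real ^ 'n) set set \<times> (real ^ 'n)"
    have "compact ((\<lambda>t. stress (fst p) (g t) (snd p)) ` {0..1})"
      by (intro compact_continuous_image stress_continuous compact_Icc)
    then show "\<exists>M. \<forall>t\<in>{0..1}. \<bar>stress (fst p) (g t) (snd p)\<bar> \<le> M"
      using compact_imp_bounded by (fastforce simp: bounded_iff)
  qed
  then show ?thesis by force
qed

definition power where "power P r = (\<Sum>v\<in>nodes. stress P (g r) v * g' r v)"

lemma stress_rate_integrable: "(\<lambda>r. stress P (g r) v * g' r x) absolutely_integrable_on {0..1}"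
proof (rule absolutely_integrable_bounded_measurable_product_real[OF _ _ _ rate_integrable])
  show "(\<lambda>r. stress P (g r) v) \<in> borel_measurable (lebesgue_on {0..1})"
    by (intro continuous_imp_measurable_on_sets_lebesgue stress_continuous) auto
  show "bounded ((\<lambda>r. stress P (g r) v) ` {0..1})"
    by (intro compact_imp_bounded compact_continuous_image stress_continuous) auto
qed auto

lemma power_integrable: "power P absolutely_integrable_on {0..1}"
  unfolding power_def[abs_def] by (intro absolutely_integrable_sum finite_nodes stress_rate_integrable)

lemma elastic_lipschitz:
  "\<exists>L\<ge>0. \<forall>P\<in>cracks. \<forall>s t. 0 \<le> s \<longrightarrow> s \<le> t \<longrightarrow> t \<le> 1 \<longrightarrow>
     \<bar>elastic P (g t) - elastic P (g s)\<bar> \<le> L * (arc t - arc s)"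
proof -
  obtain M where M: "M \<ge> 0" "\<And>P v t. P \<in> cracks \<Longrightarrow> v \<in> nodes \<Longrightarrow> t \<in> {0..1} \<Longrightarrow> \<bar>stress P (g t) v\<bar> \<le> M"
    using stress_bounded by blast
  have "\<bar>elastic P (g t) - elastic P (g s)\<bar> \<le> (2 * M) * (arc t - arc s)"
    if P: "P \<in> cracks" and st: "0 \<le> s" "s \<le> t" "t \<le> 1" for P s t
  proof -
    let ?c = "\<lambda>v. stress P (g t) v + stress P (g s) v"
    have i: "(\<lambda>r. ?c v * g' r v) integrable_on {s..t}" for v
      using sub_integrable(2)[OF rate_integrable st(1,3)] by (rule integrable_on_mult_right)
    have "elastic P (g t) - elastic P (g s) = integral {s..t} (\<lambda>r. \<Sum>v\<in>nodes. ?c v * g' r v)"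
      unfolding elastic_difference load_difference[OF st]
      using i finite_nodes by (subst integral_sum) auto
    also have "\<bar>\<dots>\<bar> \<le> (2 * M) * (arc t - arc s)"
    proof (rule integral_combination_bound[OF st])
      show "\<bar>?c v\<bar> \<le> 2 * M" if "v \<in> nodes" for v
        using M(2)[OF P that, of t] M(2)[OF P that, of s] st by auto
      show "(\<lambda>r. \<Sum>v\<in>nodes. ?c v * g' r v) integrable_on {s..t}"
        using i finite_nodes by (intro integrable_sum)
    qed
    finally show ?thesis .
  qed
  then show ?thesis using M(1) by (intro exI[of _ "2 * M"]) auto
qed

text \<open>
  For a fixed crack the increment of the elastic energy over \<open>[s,t]\<close> equals twice the work, up to the
  oscillation of the stress on \<open>[s,t]\<close>. The stress is uniformly continuous, so chaining removes the error.
\<close>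

lemma elastic_balance:
  assumes ab: "0 \<le> a" "a \<le> b" "b \<le> 1"
  shows "elastic P (g b) - elastic P (g a) = 2 * integral {a..b} (power P)"
proof -
  have pint: "power P integrable_on {s..t}" if "0 \<le> s" "t \<le> 1" for s t
    using sub_integrable(2)[OF power_integrable that] .
  define G where "G t = elastic P (g t) - 2 * integral {0..t} (power P)" for t
  have "G b = G a"
  proof (rule constant_if_locally_small_increments[OF ab(2), where \<rho>=arc])
    fix \<eta> :: real assume \<eta>: "0 < \<eta>"
    have "\<forall>v\<in>nodes. \<exists>\<delta>>0. \<forall>s\<in>{0..1}. \<forall>t\<in>{0..1}. \<bar>t - s\<bar> < \<delta> \<longrightarrow> \<bar>stress P (g t) v - stress P (g s) v\<bar> < \<eta> / 2"
    proof
      fix v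
      have "uniformly_continuous_on {0..1} (\<lambda>t. stress P (g t) v)"
        by (rule compact_uniformly_continuous[OF stress_continuous compact_Icc])
      then show "\<exists>\<delta>>0. \<forall>s\<in>{0..1}. \<forall>t\<in>{0..1}. \<bar>t - s\<bar> < \<delta> \<longrightarrow> \<bar>stress P (g t) v - stress P (g s) v\<bar> < \<eta> / 2"
        unfolding uniformly_continuous_on_def dist_real_def using \<eta> by (metis half_gt_zero)
    qed
    then obtain d where d: "\<And>v. v \<in> nodes \<Longrightarrow> d v > 0"
      "\<And>v s t. v \<in> nodes \<Longrightarrow> s \<in> {0..1} \<Longrightarrow> t \<in> {0..1} \<Longrightarrow> \<bar>t - s\<bar> < d v \<Longrightarrow> \<bar>stress P (g t) v - stress P (g s) v\<bar> < \<eta> / 2"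
      by metis
    define \<delta> where "\<delta> = Min (insert 1 (d ` nodes))"
    have \<delta>0: "\<delta> > 0" unfolding \<delta>_def using d(1) finite_nodes by (subst Min_gr_iff) auto
    have \<delta>d: "\<delta> \<le> d v" if "v \<in> nodes" for v unfolding \<delta>_def using that finite_nodes by (intro Min_le) auto
    have "\<bar>G t - G s\<bar> \<le> \<eta> * (arc t - arc s)" if st: "a \<le> s" "s \<le> t" "t \<le> b" "t - s < \<delta>" for s t
    proof -
      have st': "0 \<le> s" "s \<le> t" "t \<le> 1" using st ab by auto
      let ?c = "\<lambda>r v. stress P (g t) v + stress P (g s) v - 2 * stress P (g r) v"
      have i1: "(\<lambda>r. (stress P (g t) v + stress P (g s) v) * g' r v) integrable_on {s..t}" for v
        using sub_integrable(2)[OF rate_integrable st'(1,3)] by (rule integrable_on_mult_right)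
      have i2: "(\<lambda>r. stress P (g r) v * g' r v) integrable_on {s..t}" for v
        using sub_integrable(2)[OF stress_rate_integrable st'(1,3)] .
      have i2': "(\<lambda>r. 2 * (stress P (g r) v * g' r v)) integrable_on {s..t}" for v
        using i2 by (rule integrable_on_mult_right)
      have "integral {0..s} (power P) + integral {s..t} (power P) = integral {0..t} (power P)"
        by (rule Henstock_Kurzweil_Integration.integral_combine) (use st' pint in auto)
      then have "G t - G s = (elastic P (g t) - elastic P (g s)) - 2 * integral {s..t} (power P)"
        by (simp add: G_def)
      also have "elastic P (g t) - elastic P (g s) = integral {s..t} (\<lambda>r. \<Sum>v\<in>nodes. (stress P (g t) v + stress P (g s) v) * g' r v)"
        unfolding elastic_difference load_difference[OF st']
        using i1 finite_nodes by (subst integral_sum) auto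
      also have "2 * integral {s..t} (power P) = integral {s..t} (\<lambda>r. \<Sum>v\<in>nodes. 2 * (stress P (g r) v * g' r v))"
        by (simp add: power_def[abs_def] sum_distrib_left[symmetric])
      also have "integral {s..t} (\<lambda>r. \<Sum>v\<in>nodes. (stress P (g t) v + stress P (g s) v) * g' r v) -
           integral {s..t} (\<lambda>r. \<Sum>v\<in>nodes. 2 * (stress P (g r) v * g' r v)) = integral {s..t} (\<lambda>r. \<Sum>v\<in>nodes. ?c r v * g' r v)"
        using i1 i2' finite_nodes
        by (subst Henstock_Kurzweil_Integration.integral_diff[symmetric])
          (auto intro!: integrable_sum integral_cong simp: sum_subtractf[symmetric] algebra_simps)
      finally have eq: "G t - G s = integral {s..t} (\<lambda>r. \<Sum>v\<in>nodes. ?c r v * g' r v)" .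
      show ?thesis unfolding eq
      proof (rule integral_combination_bound[OF st'])
        fix r v assume v: "v \<in> nodes" and r: "s \<le> r" "r \<le> t"
        have "\<bar>stress P (g t) v - stress P (g r) v\<bar> < \<eta> / 2" "\<bar>stress P (g s) v - stress P (g r) v\<bar> < \<eta> / 2"
          using \<delta>d[OF v] st st' r by (intro d(2)[OF v]; simp)+
        then show "\<bar>?c r v\<bar> \<le> \<eta>" by linarith
      next
        have "(\<lambda>r. (stress P (g t) v + stress P (g s) v) * g' r v - 2 * (stress P (g r) v * g' r v)) integrable_on {s..t}" for v
          by (rule integrable_diff[OF i1 i2'])
        then have "(\<lambda>r. ?c r v * g' r v) integrable_on {s..t}" for v by (simp add: algebra_simps)
        then show "(\<lambda>r. \<Sum>v\<in>nodes. ?c r v * g' r v) integrable_on {s..t}"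
          using finite_nodes by (intro integrable_sum)
      qed
    qed
    then show "\<exists>\<delta>>0. \<forall>s t. a \<le> s \<and> s \<le> t \<and> t \<le> b \<and> t - s < \<delta> \<longrightarrow> \<bar>G t - G s\<bar> \<le> \<eta> * (arc t - arc s)"
      using \<delta>0 by blast
  qed
  moreover have "integral {0..a} (power P) + integral {a..b} (power P) = integral {0..b} (power P)"
    by (rule Henstock_Kurzweil_Integration.integral_combine) (use ab pint in auto)
  ultimately show ?thesis by (simp add: G_def)
qed

lemma elastic_continuous: "P \<in> cracks \<Longrightarrow> continuous_on {0..1} (\<lambda>t. elastic P (g t))"
proof -
  have "continuous_on {0..1} (\<lambda>t. elastic P (g 0) + 2 * integral {0..t} (power P))"
    by (intro continuous_on_add continuous_on_mult continuous_on_const indefinite_integral_continuous[OF power_integrable])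
  moreover have "elastic P (g 0) + 2 * integral {0..t} (power P) = elastic P (g t)" if "t \<in> {0..1}" for t
    using elastic_balance[of 0 t P] that by simp
  ultimately show ?thesis by (rule continuous_on_eq)
qed

lemma AE_load_derivative:
  "AE s in lebesgue. s \<in> {0..1} \<longrightarrow> (\<forall>v\<in>nodes. ((\<lambda>t. g t v) has_vector_derivative g' s v) (at s within {0..1}))"
proof -
  have "AE s in lebesgue. s \<in> {0..1} \<longrightarrow> ((\<lambda>t. g t v) has_vector_derivative g' s v) (at s within {0..1})" for v
  proof -
    have "AE s in lebesgue. s \<in> {0..1} \<longrightarrow> ((\<lambda>t. integral {0..t} (\<lambda>r. g' r v)) has_vector_derivative g' s v) (at s within {0..1})"
      by (rule lebesgue_differentiation_integral[OF sub_integrable(2)[OF rate_integrable]]) auto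
    then show ?thesis
    proof eventually_elim
      case (elim s)
      show ?case
      proof
        assume s: "s \<in> {0..1}"
        have "((\<lambda>t. g 0 v + integral {0..t} (\<lambda>r. g' r v)) has_vector_derivative 0 + g' s v) (at s within {0..1})"
          using elim s by (intro has_vector_derivative_add has_vector_derivative_const) auto
        then have "((\<lambda>t. g 0 v + integral {0..t} (\<lambda>r. g' r v)) has_vector_derivative g' s v) (at s within {0..1})" by simp
        moreover have "g t v = g 0 v + integral {0..t} (\<lambda>r. g' r v)" if "t \<in> {0..1}" for t
          using load_difference[of 0 t v] that by simp
        ultimately show "((\<lambda>t. g t v) has_vector_derivative g' s v) (at s within {0..1})"
          by (rule has_vector_derivative_transform[OF s, rotated])
      qed
    qed
  qed
  then have "AE s in lebesgue. \<forall>v\<in>nodes. s \<in> {0..1} \<longrightarrow> ((\<lambda>t. g t v) has_vector_derivative g' s v) (at s within {0..1})"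
    by (subst AE_finite_all[OF finite_nodes]) (rule ballI)
  then show ?thesis by eventually_elim blast
qed

end

section \<open>Time-discrete solutions\<close>

definition step_of :: "(nat \<Rightarrow> nat \<Rightarrow> real) \<Rightarrow> nat \<Rightarrow> real \<Rightarrow> nat" where
  "step_of \<tau> m t = Max {k. k \<le> m \<and> \<tau> m k \<le> t}"

lemma step_of_props:
  assumes "\<tau> m 0 \<le> t"
  shows "step_of \<tau> m t \<le> m" "\<tau> m (step_of \<tau> m t) \<le> t"
    "\<And>k. k \<le> m \<Longrightarrow> \<tau> m k \<le> t \<Longrightarrow> k \<le> step_of \<tau> m t"
proof -
  have fin: "finite {k. k \<le> m \<and> \<tau> m k \<le> t}" by (rule finite_subset[of _ "{..m}"]) auto
  have "{k. k \<le> m \<and> \<tau> m k \<le> t} \<noteq> {}" using assms by auto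
  from Max_in[OF fin this] show "step_of \<tau> m t \<le> m" "\<tau> m (step_of \<tau> m t) \<le> t"
    by (auto simp: step_of_def)
  show "\<And>k. k \<le> m \<Longrightarrow> \<tau> m k \<le> t \<Longrightarrow> k \<le> step_of \<tau> m t"
    unfolding step_of_def using fin by (intro Max_ge) auto
qed

locale partitions =
  fixes I :: "real set" and \<tau> :: "nat \<Rightarrow> nat \<Rightarrow> real"
  assumes tp: "time_partitions I \<tau>"
begin

lemma tau_0: "\<tau> m 0 = 0" using tp by (simp add: time_partitions_def)

lemma tau_less: "i < j \<Longrightarrow> j \<le> m \<Longrightarrow> \<tau> m i < \<tau> m j"
proof (induction j)
  case (Suc j)
  have "\<tau> m j < \<tau> m (Suc j)" using tp Suc.prems by (simp add: time_partitions_def)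
  then show ?case using Suc by (cases "i = j") auto
qed simp

lemma tau_le: "i \<le> j \<Longrightarrow> j \<le> m \<Longrightarrow> \<tau> m i \<le> \<tau> m j"
  using tau_less[of i j m] by (cases "i = j") auto

lemma tau_range: "i \<le> m \<Longrightarrow> \<tau> m i \<in> {0..1}"
proof -
  assume "i \<le> m"
  then have "\<tau> m i \<in> I" using tp by (auto simp: time_partitions_def)
  moreover have "I \<subseteq> {0..1}" using tp by (simp add: time_partitions_def)
  ultimately show ?thesis by blast
qed

lemma tau_nested: "m \<le> m' \<Longrightarrow> \<tau> m ` {..m} \<subseteq> \<tau> m' ` {..m'}"
proof (induction m' rule: dec_induct)
  case (step m')
  then show ?case using tp by (force simp: time_partitions_def)
qed simp

lemma step_of: 
  assumes "0 \<le> t"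
  shows "step_of \<tau> m t \<le> m" "\<tau> m (step_of \<tau> m t) \<le> t"
    "\<And>k. k \<le> m \<Longrightarrow> \<tau> m k \<le> t \<Longrightarrow> k \<le> step_of \<tau> m t"
  using step_of_props[of \<tau> m t] assms by (auto simp: tau_0)

lemma step_of_next: "0 \<le> t \<Longrightarrow> step_of \<tau> m t < m \<Longrightarrow> t < \<tau> m (Suc (step_of \<tau> m t))"
  using step_of(3)[of t "Suc (step_of \<tau> m t)" m] by force

lemma step_of_mono: "0 \<le> s \<Longrightarrow> s \<le> t \<Longrightarrow> step_of \<tau> m s \<le> step_of \<tau> m t"
  using step_of(1,2)[of s m] by (intro step_of(3)) auto

lemma step_of_0: "step_of \<tau> m 0 = 0"
proof (rule ccontr)
  assume "step_of \<tau> m 0 \<noteq> 0"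
  then have "\<tau> m 0 < \<tau> m (step_of \<tau> m 0)" using step_of(1)[of 0 m] by (intro tau_less) auto
  then show False using step_of(2)[of 0 m] by (simp add: tau_0)
qed

lemma step_index_unique:
  assumes k: "step_index \<tau> t k" and t: "0 \<le> t"
  shows "k m = step_of \<tau> m t"
proof (rule antisym)
  have km: "k m \<le> m" "\<tau> m (k m) \<le> t" "k m < m \<longrightarrow> t < \<tau> m (Suc (k m))"
    using k by (auto simp: step_index_def)
  show "k m \<le> step_of \<tau> m t" using km t by (intro step_of(3)) auto
  show "step_of \<tau> m t \<le> k m"
  proof (rule ccontr)
    assume "\<not> ?thesis"
    then have less: "k m < step_of \<tau> m t" by simp
    then have "\<tau> m (Suc (k m)) \<le> \<tau> m (step_of \<tau> m t)" using step_of(1)[OF t, of m] by (intro tau_le) auto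
    then show False using km(3) less step_of(1,2)[OF t, of m] by auto
  qed
qed

text \<open>
  The mesh size of the partition controls all steps but the last one; that the last partition point tends
  to 1 follows from density and nestedness.
\<close>

lemma last_time_tendsto:
  assumes t: "t \<in> {0..1}"
  shows "(\<lambda>m. \<tau> m (step_of \<tau> m t)) \<longlonglongrightarrow> t"
proof (rule LIMSEQ_I)
  fix e :: real assume e: "0 < e"
  have "(\<lambda>m. MAX i\<in>{1..m}. \<tau> m i - \<tau> m (i - 1)) \<longlonglongrightarrow> 0" using tp by (simp add: time_partitions_def)
  then have "\<forall>\<^sub>F m in sequentially. (MAX i\<in>{1..m}. \<tau> m i - \<tau> m (i - 1)) < e"
    using e by (rule order_tendstoD(2))
  then obtain m1 where m1: "\<And>m. m \<ge> m1 \<Longrightarrow> (MAX i\<in>{1..m}. \<tau> m i - \<tau> m (i - 1)) < e"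
    by (auto simp: eventually_sequentially)
  have "(1::real) \<in> closure I" using tp by (auto simp: time_partitions_def)
  then obtain y where y: "y \<in> I" "dist y 1 < e" using e by (meson closure_approachable)
  then obtain m2 where m2: "y \<in> \<tau> m2 ` {..m2}" using tp by (auto simp: time_partitions_def)
  have "norm (\<tau> m (step_of \<tau> m t) - t) < e" if m: "m \<ge> max m1 m2" for m
  proof -
    let ?k = "step_of \<tau> m t"
    have t0: "0 \<le> t" using t by simp
    have "t - \<tau> m ?k < e"
    proof (cases "?k < m")
      case True
      have "\<tau> m (Suc ?k) - \<tau> m (Suc ?k - 1) \<in> (\<lambda>i. \<tau> m i - \<tau> m (i - 1)) ` {1..m}"
        using True by (intro imageI) auto
      then have "\<tau> m (Suc ?k) - \<tau> m (Suc ?k - 1) \<le> (MAX i\<in>{1..m}. \<tau> m i - \<tau> m (i - 1))"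
        by (rule Max_ge[rotated]) simp
      then have "\<tau> m (Suc ?k) - \<tau> m ?k < e" using m1[of m] m by simp
      then show ?thesis using step_of_next[OF t0 True] by simp
    next
      case False
      then have k: "?k = m" using step_of(1)[OF t0, of m] by simp
      obtain j where "j \<le> m" "y = \<tau> m j" using m2 tau_nested[of m2 m] m by auto
      then have "y \<le> \<tau> m m" using tau_le[of j m m] by simp
      moreover have "1 - e < y" using y(2) by (simp add: dist_real_def abs_less_iff)
      moreover have "t \<le> 1" using t by simp
      ultimately show ?thesis unfolding k by linarith
    qed
    then show ?thesis using step_of(2)[OF t0, of m] by simp
  qed
  then show "\<exists>no. \<forall>n\<ge>no. norm (\<tau> n (step_of \<tau> n t) - t) < e" by blast
qed

end

context fe_loading
begin

lemma minimizer_at: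
  assumes "closure \<Psi> = \<Union>P" "P \<in> cracks"
  shows "\<exists>u \<gamma>. minimises (interpolant Th (g t)) \<Psi> u \<gamma>"
  using minimizer_exists[OF assms(2,1)] .

lemma minimizer_crack:
  assumes "minimises w \<Psi> u \<gamma>" "closure \<Psi> = \<Union>P" "P \<in> cracks"
  shows "closure (\<Psi> \<union> nonzero_set Th \<Omega>' \<gamma>) = \<Union>(P \<union> support \<gamma>)" "P \<union> support \<gamma> \<in> cracks"
proof -
  have adm: "(u, \<gamma>) \<in> \<A> w" using assms(1) by (simp add: minimizer_def)
  then have "\<gamma> \<in> W_space Th \<Omega>'" by (simp add: admissible_pairs_def)
  from closure_nonzero_set[OF this] show "closure (\<Psi> \<union> nonzero_set Th \<Omega>' \<gamma>) = \<Union>(P \<union> support \<gamma>)"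
    by (simp add: closure_Un assms(2))
  show "P \<union> support \<gamma> \<in> cracks" by (intro cracks_Un assms(3) support_cracks[OF adm])
qed

lemma empty_crack: "{} \<in> cracks" "closure {} = \<Union>{}" by (auto simp: cracks_def)

text \<open>
  The last component accumulates the crack, which makes the recursion depend on the previous state only.
\<close>

fun discrete_step where
  "discrete_step \<tau> (0::nat) = (let p = (SOME p. minimises (interpolant Th (g 0)) {} (fst p) (snd p))
     in (p, nonzero_set Th \<Omega>' (snd p)))"
| "discrete_step \<tau> (Suc i) = (let p = (SOME p. minimises (interpolant Th (g (\<tau> (Suc i)))) (snd (discrete_step \<tau> i)) (fst p) (snd p))
     in (p, snd (discrete_step \<tau> i) \<union> nonzero_set Th \<Omega>' (snd p)))"

lemma discrete_step_minimizer:
  "minimises (interpolant Th (g (case i of 0 \<Rightarrow> 0 | Suc j \<Rightarrow> \<tau> (Suc j))))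
     (case i of 0 \<Rightarrow> {} | Suc j \<Rightarrow> snd (discrete_step \<tau> j)) (fst (fst (discrete_step \<tau> i))) (snd (fst (discrete_step \<tau> i)))
   \<and> (\<exists>P\<in>cracks. closure (snd (discrete_step \<tau> i)) = \<Union>P)"
proof (induction i)
  case 0
  have "\<exists>p. minimises (interpolant Th (g 0)) {} (fst p) (snd p)"
    using minimizer_at[OF empty_crack(2,1)] by simp
  from someI_ex[OF this] have m: "minimises (interpolant Th (g 0)) {} (fst (fst (discrete_step \<tau> 0))) (snd (fst (discrete_step \<tau> 0)))"
    by (simp add: Let_def)
  have "snd (discrete_step \<tau> 0) = {} \<union> nonzero_set Th \<Omega>' (snd (fst (discrete_step \<tau> 0)))" by (simp add: Let_def)
  then have "\<exists>P\<in>cracks. closure (snd (discrete_step \<tau> 0)) = \<Union>P"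
    using minimizer_crack[OF m empty_crack(2,1)] by metis
  then show ?case using m by (simp del: discrete_step.simps)
next
  case (Suc i)
  then obtain P where P: "P \<in> cracks" "closure (snd (discrete_step \<tau> i)) = \<Union>P" by blast
  have "\<exists>p. minimises (interpolant Th (g (\<tau> (Suc i)))) (snd (discrete_step \<tau> i)) (fst p) (snd p)"
    using minimizer_at[OF P(2,1)] by simp
  from someI_ex[OF this] have m: "minimises (interpolant Th (g (\<tau> (Suc i)))) (snd (discrete_step \<tau> i)) (fst (fst (discrete_step \<tau> (Suc i)))) (snd (fst (discrete_step \<tau> (Suc i))))"
    by (simp add: Let_def)
  have "snd (discrete_step \<tau> (Suc i)) = snd (discrete_step \<tau> i) \<union> nonzero_set Th \<Omega>' (snd (fst (discrete_step \<tau> (Suc i))))" by (simp add: Let_def)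
  then have "\<exists>P\<in>cracks. closure (snd (discrete_step \<tau> (Suc i))) = \<Union>P"
    using minimizer_crack[OF m P(2,1)] by metis
  then show ?case using m by (simp del: discrete_step.simps)
qed

lemma discrete_step_crack_set:
  "snd (discrete_step \<tau> i) = crack_set Th \<Omega>' (\<lambda>i. snd (fst (discrete_step \<tau> i))) i"
proof (induction i)
  case 0
  then show ?case by (simp add: crack_set_def Let_def)
next
  case (Suc i)
  have "snd (discrete_step \<tau> (Suc i)) = snd (discrete_step \<tau> i) \<union> nonzero_set Th \<Omega>' (snd (fst (discrete_step \<tau> (Suc i))))" by (simp add: Let_def)
  then show ?case unfolding Suc by (simp add: crack_set_def atMost_Suc Un_commute del: discrete_step.simps)
qed

lemma time_discrete_solution_exists:
  "\<exists>um \<gamma>m. time_discrete_solution C \<kappa> \<epsilon> Th \<Omega> \<Omega>' (\<lambda>t. interpolant Th (g t)) \<tau> um \<gamma>m"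
proof -
  let ?u = "\<lambda>m i. fst (fst (discrete_step (\<tau> m) i))" and ?\<gamma> = "\<lambda>m i. snd (fst (discrete_step (\<tau> m) i))"
  have "time_discrete_solution C \<kappa> \<epsilon> Th \<Omega> \<Omega>' (\<lambda>t. interpolant Th (g t)) \<tau> ?u ?\<gamma>"
    unfolding time_discrete_solution_def
  proof (intro conjI allI impI)
    fix m show "?u m 0 = ?u 0 0" "?\<gamma> m 0 = ?\<gamma> 0 0" by simp_all
    show "minimises (interpolant Th (g 0)) {} (?u m 0) (?\<gamma> m 0)"
      using discrete_step_minimizer[where i=0 and \<tau>="\<tau> m"] by simp
    fix i
    show "minimises (interpolant Th (g (\<tau> m (Suc i)))) (crack_set Th \<Omega>' (?\<gamma> m) i) (?u m (Suc i)) (?\<gamma> m (Suc i))"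
      using discrete_step_minimizer[where i="Suc i" and \<tau>="\<tau> m"] discrete_step_crack_set[where i=i and \<tau>="\<tau> m"] by (simp del: discrete_step.simps)
  qed
  then show ?thesis by blast
qed

end

locale fe_discrete = fe_loading Th \<Omega> \<Omega>' C \<kappa> \<epsilon> g g' + partitions I \<tau>
  for Th :: "(real ^ 'n) set set" and \<Omega> \<Omega>' C \<kappa> \<epsilon> g g' I \<tau> +
  fixes um :: "nat \<Rightarrow> nat \<Rightarrow> real ^ 'n \<Rightarrow> real" and \<gamma>m :: "nat \<Rightarrow> nat \<Rightarrow> real ^ 'n \<Rightarrow> real ^ 'n"
  assumes discrete: "time_discrete_solution C \<kappa> \<epsilon> Th \<Omega> \<Omega>' (\<lambda>t. interpolant Th (g t)) \<tau> um \<gamma>m"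
begin

definition cracked where "cracked m i = (\<Union>k\<le>i. support (\<gamma>m m k))"

lemma cracked_mono: "i \<le> j \<Longrightarrow> cracked m i \<subseteq> cracked m j"
  unfolding cracked_def by (intro UN_mono) auto

lemma cracked_Suc: "cracked m (Suc i) = cracked m i \<union> support (\<gamma>m m (Suc i))"
  by (simp add: cracked_def atMost_Suc Un_commute)

lemma initial_minimizer: "minimises (interpolant Th (g 0)) {} (um m 0) (\<gamma>m m 0)"
  using discrete by (auto simp: time_discrete_solution_def)

lemma step_minimizer:
  "i < m \<Longrightarrow> minimises (interpolant Th (g (\<tau> m (Suc i)))) (crack_set Th \<Omega>' (\<gamma>m m) i) (um m (Suc i)) (\<gamma>m m (Suc i))"
  using discrete by (auto simp: time_discrete_solution_def)

lemma initial_independent: "um m 0 = um 0 0" "\<gamma>m m 0 = \<gamma>m 0 0"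
  using discrete unfolding time_discrete_solution_def by metis+

lemma crack_set_closure:
  "i \<le> m \<Longrightarrow> closure (crack_set Th \<Omega>' (\<gamma>m m) i) = \<Union>(cracked m i) \<and> cracked m i \<in> cracks"
proof (induction i)
  case 0
  show ?case using minimizer_crack[OF initial_minimizer empty_crack(2,1), of m]
    by (simp add: crack_set_def cracked_def)
next
  case (Suc i)
  then have IH: "closure (crack_set Th \<Omega>' (\<gamma>m m) i) = \<Union>(cracked m i)" "cracked m i \<in> cracks" by auto
  have "crack_set Th \<Omega>' (\<gamma>m m) (Suc i) = crack_set Th \<Omega>' (\<gamma>m m) i \<union> nonzero_set Th \<Omega>' (\<gamma>m m (Suc i))"
    by (simp add: crack_set_def atMost_Suc Un_commute)
  then show ?case using minimizer_crack[OF step_minimizer IH] Suc.prems by (simp add: cracked_Suc)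
qed

lemma discrete_admissible:
  "i \<le> m \<Longrightarrow> (um m i, \<gamma>m m i) \<in> \<A> (interpolant Th (g (\<tau> m i)))"
  using initial_minimizer[of m] step_minimizer[of "i - 1" m] by (cases i) (auto simp: minimizer_def tau_0)

text \<open>
  Competitors at step \<open>i\<close> only have to contain the crack of the \<^emph>\<open>previous\<close> step. This gives the upper
  energy estimate, by comparison with that crack itself.
\<close>

lemma discrete_properties:
  assumes i: "i \<le> m"
  shows "\<E> (um m i) (\<gamma>m m i) (crack_set Th \<Omega>' (\<gamma>m m) i) = total (cracked m i) (g (\<tau> m i))" (is ?energy)
    and "\<forall>P'\<in>cracks. (case i of 0 \<Rightarrow> {} | Suc j \<Rightarrow> cracked m j) \<subseteq> P' \<longrightarrow>
      total (cracked m i) (g (\<tau> m i)) \<le> total P' (g (\<tau> m i))" (is ?stable)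
    and "\<forall>T\<in>cells. T \<inter> \<Omega> \<noteq> {} \<longrightarrow>
      slope (um m i) T - cell_value (\<gamma>m m i) T = strain (cracked m i) (g (\<tau> m i)) T" (is ?strain)
proof -
  note cl = crack_set_closure[OF i]
  have "?energy \<and> ?stable \<and> ?strain"
  proof (cases i)
    case 0
    have "cracked m 0 = {} \<union> support (\<gamma>m m 0)" by (simp add: cracked_def)
    note * = minimizer_properties[OF initial_minimizer empty_crack this]
    show ?thesis using *(3)[of "crack_set Th \<Omega>' (\<gamma>m m) 0"] *(4,5) cl 0 by (auto simp: tau_0)
  next
    case (Suc j)
    then have j: "j < m" "j \<le> m" using i by auto
    note clj = crack_set_closure[OF j(2)]
    note * = minimizer_properties[OF step_minimizer[OF j(1)] conjunct2[OF clj] conjunct1[OF clj] cracked_Suc]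
    show ?thesis using *(3)[of "crack_set Th \<Omega>' (\<gamma>m m) (Suc j)"] *(4,5) cl Suc by auto
  qed
  then show ?energy ?stable ?strain by blast+
qed

lemma discrete_stability:
  assumes i: "i \<le> m" and P': "P' \<in> cracks" "cracked m i \<subseteq> P'"
  shows "total (cracked m i) (g (\<tau> m i)) \<le> total P' (g (\<tau> m i))"
proof (rule discrete_properties(2)[OF i, rule_format, OF P'(1)])
  show "(case i of 0 \<Rightarrow> {} | Suc j \<Rightarrow> cracked m j) \<subseteq> P'"
    using P'(2) cracked_mono[of "i - 1" i m] by (cases i) auto
qed

text \<open>
  Keeping the old crack is allowed at each step and costs only the change of the elastic energy under the
  new datum.
\<close>

lemma discrete_energy_estimate:
  assumes L: "\<And>P s t. P \<in> cracks \<Longrightarrow> 0 \<le> s \<Longrightarrow> s \<le> t \<Longrightarrow> t \<le> 1 \<Longrightarrow> \<bar>elastic P (g t) - elastic P (g s)\<bar> \<le> L * (arc t - arc s)"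
    and ij: "i \<le> j" "j \<le> m"
  shows "total (cracked m j) (g (\<tau> m j)) \<le> total (cracked m i) (g (\<tau> m i)) + L * (arc (\<tau> m j) - arc (\<tau> m i))"
  using ij
proof (induction j rule: dec_induct)
  case base then show ?case by simp
next
  case (step j)
  have j: "j \<le> m" "Suc j \<le> m" using step by auto
  have "total (cracked m (Suc j)) (g (\<tau> m (Suc j))) \<le> total (cracked m j) (g (\<tau> m (Suc j)))"
    using crack_set_closure[OF j(1)] by (intro discrete_properties(2)[OF j(2), rule_format]) auto
  also have "\<dots> = total (cracked m j) (g (\<tau> m j)) + (elastic (cracked m j) (g (\<tau> m (Suc j))) - elastic (cracked m j) (g (\<tau> m j)))"
    by (simp add: total_def)
  also have "\<dots> \<le> total (cracked m j) (g (\<tau> m j)) + L * (arc (\<tau> m (Suc j)) - arc (\<tau> m j))"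
    using L[of "cracked m j" "\<tau> m j" "\<tau> m (Suc j)"] crack_set_closure[OF j(1)] tau_range[OF j(1)] tau_range[OF j(2)] tau_le[of j "Suc j" m] j
    by auto
  also have "\<dots> \<le> total (cracked m i) (g (\<tau> m i)) + L * (arc (\<tau> m j) - arc (\<tau> m i)) + L * (arc (\<tau> m (Suc j)) - arc (\<tau> m j))"
    using step j by simp
  finally show ?case by (simp add: algebra_simps)
qed

lemma limit_cracks_exist:
  "\<exists>r P. strict_mono r \<and> (\<forall>t\<in>{0..1}. \<forall>\<^sub>F n in sequentially. cracked (r n) (step_of \<tau> (r n) t) = P t)"
proof (rule helly_selection_finite_sets[where P="\<lambda>m t. cracked m (step_of \<tau> m t)"])
  show "finite cells" by (rule finite_cells)
  show "cracked m (step_of \<tau> m t) \<subseteq> cells" for m t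
    using support_subset by (auto simp: cracked_def)
  show "cracked m (step_of \<tau> m s) \<subseteq> cracked m (step_of \<tau> m t)" if "0 \<le> s" "s \<le> t" "t \<le> 1" for m s t
    using that by (intro cracked_mono step_of_mono)
qed

end

section \<open>The limiting crack and its energy\<close>

lemma set_integral_AE_eq_integral:
  fixes f F :: "real \<Rightarrow> real"
  assumes f: "f absolutely_integrable_on {0..1}" and AE: "AE s in lebesgue. s \<in> {0..1} \<longrightarrow> F s = f s"
  shows "set_integrable lebesgue {0..1} F"
    and "\<And>t. t \<in> {0..1} \<Longrightarrow> (LINT s:{0..t}|lebesgue. F s) = integral {0..t} f"
proof -
  have *: "set_integrable lebesgue {0..t} F \<and> (LINT s:{0..t}|lebesgue. F s) = integral {0..t} f" if t: "t \<in> {0..1}" for t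
  proof -
    have ft: "set_integrable lebesgue {0..t} f"
      by (rule set_integrable_subset[OF f]) (use t in auto)
    have ae: "AE s in lebesgue. indicat_real {0..t} s *\<^sub>R f s = indicat_real {0..t} s *\<^sub>R F s"
      using AE by eventually_elim (use t in \<open>auto simp: indicator_def\<close>)
    have mf: "(\<lambda>s. indicat_real {0..t} s *\<^sub>R f s) \<in> borel_measurable lebesgue"
      using ft by (auto simp: set_integrable_def)
    have mF: "(\<lambda>s. indicat_real {0..t} s *\<^sub>R F s) \<in> borel_measurable lebesgue"
      by (rule borel_measurable_AE[OF mf ae])
    have "set_integrable lebesgue {0..t} F"
      using ft integrable_cong_AE[OF mf mF ae] by (simp add: set_integrable_def)
    moreover have "(LINT s:{0..t}|lebesgue. F s) = (LINT s:{0..t}|lebesgue. f s)"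
      unfolding set_lebesgue_integral_def by (rule integral_cong_AE[OF mF mf]) (use ae in \<open>eventually_elim, simp only:\<close>)
    ultimately show ?thesis using set_lebesgue_integral_eq_integral(2)[OF ft] by simp
  qed
  show "set_integrable lebesgue {0..1} F" using *[of 1] by simp
  show "\<And>t. t \<in> {0..1} \<Longrightarrow> (LINT s:{0..t}|lebesgue. F s) = integral {0..t} f" using * by blast
qed

context fe_loading
begin

abbreviation load where "load \<equiv> \<lambda>t. interpolant Th (g t)"

lemma AE_dt_grad:
  assumes s: "s \<in> {0..1}" and d: "\<forall>v\<in>nodes. ((\<lambda>t. g t v) has_vector_derivative g' s v) (at s within {0..1})"
  shows "AE x in lebesgue. \<forall>T\<in>cells. x \<in> T \<longrightarrow> dt_grad load s x = nodal_slope (g' s) T"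
  using AE_interior_cells
proof eventually_elim
  case (elim x)
  show ?case
  proof (intro ballI impI)
    fix T assume T: "T \<in> cells" "x \<in> T"
    then have xi: "x \<in> interior T" using elim by blast
    have eq: "grad (load t) x = (\<Sum>v\<in>nodes. g t v *\<^sub>R nodal_slope (hat v) T)" for t
      using grad_affine_on_interior[OF interpolant_affine[OF cellsD[OF T(1)]] xi] nodal_slope_expand[OF T(1), of "g t"]
      by (simp add: nodal_slope_def)
    have "((\<lambda>t. \<Sum>v\<in>nodes. g t v *\<^sub>R nodal_slope (hat v) T) has_vector_derivative (\<Sum>v\<in>nodes. g' s v *\<^sub>R nodal_slope (hat v) T)) (at s within {0..1})"
      using d by (intro has_vector_derivative_sum bounded_linear.has_vector_derivative[OF bounded_linear_scaleR_left]) auto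
    then have "((\<lambda>t. grad (load t) x) has_vector_derivative nodal_slope (g' s) T) (at s within {0..1})"
      unfolding eq nodal_slope_expand[OF T(1), of "g' s"] .
    then show "dt_grad load s x = nodal_slope (g' s) T"
      unfolding dt_grad_def using s vector_derivative_within_cbox[of 0 1 s "\<lambda>t. grad (load t) x" "nodal_slope (g' s) T"] by simp
  qed
qed

text \<open>
  For a pair with the strain of an optimal one, the space integral in the energy balance is the finite sum
  \<open>power\<close>. Cells outside \<open>\<Omega>\<close>, where the strain is not determined, have volume zero.
\<close>

lemma power_integral:
  assumes u: "u \<in> V_space Th \<Omega>'" "\<gamma> \<in> W_space Th \<Omega>'" and s: "s \<in> {0..1}"
    and d: "\<forall>v\<in>nodes. ((\<lambda>t. g t v) has_vector_derivative g' s v) (at s within {0..1})"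
    and strain: "\<And>T. T \<in> cells \<Longrightarrow> T \<inter> \<Omega> \<noteq> {} \<Longrightarrow> slope u T - cell_value \<gamma> T = strain P (g s) T"
  shows "(LINT x:\<Omega>|lebesgue. (grad u x - \<gamma> x) \<bullet> (C *v dt_grad load s x)) = power P s"
proof -
  have "AE x in lebesgue. \<forall>T\<in>cells. x \<in> T \<longrightarrow> (grad u x - \<gamma> x) \<bullet> (C *v dt_grad load s x) =
      (slope u T - cell_value \<gamma> T) \<bullet> (C *v nodal_slope (g' s) T)"
    using AE_grad[OF u(1)] AE_cell_value[OF u(2)] AE_dt_grad[OF s d] by eventually_elim auto
  from piecewise_constant_integral(1)[OF this]
  have "(LINT x:\<Omega>|lebesgue. (grad u x - \<gamma> x) \<bullet> (C *v dt_grad load s x)) =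
     (\<Sum>T\<in>cells. vol T * ((slope u T - cell_value \<gamma> T) \<bullet> (C *v nodal_slope (g' s) T)))" .
  also have "\<dots> = (\<Sum>T\<in>cells. vol T * (strain P (g s) T \<bullet> (C *v nodal_slope (g' s) T)))"
  proof (rule sum.cong[OF refl])
    fix T assume T: "T \<in> cells"
    show "vol T * ((slope u T - cell_value \<gamma> T) \<bullet> (C *v nodal_slope (g' s) T)) = vol T * (strain P (g s) T \<bullet> (C *v nodal_slope (g' s) T))"
      using strain[OF T] vol_zero[of T] by (cases "T \<inter> \<Omega> = {}") auto
  qed
  also have "\<dots> = power P s" by (simp add: sum_stress power_def mult.commute)
  finally show ?thesis .
qed

lemma total_continuous: "P \<in> cracks \<Longrightarrow> continuous_on {0..1} (\<lambda>t. total P (g t))"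
  unfolding total_def by (intro continuous_on_add elastic_continuous continuous_on_const)

end

text \<open>
  A subsequence along which the discrete cracks stabilise at every time.
\<close>

locale fe_limit = fe_discrete Th \<Omega> \<Omega>' C \<kappa> \<epsilon> g g' I \<tau> um \<gamma>m
  for Th :: "(real ^ 'n) set set" and \<Omega> \<Omega>' C \<kappa> \<epsilon> g g' I \<tau> um \<gamma>m +
  fixes sub :: "nat \<Rightarrow> nat" and crack :: "real \<Rightarrow> (real ^ 'n) set set"
  assumes sub: "strict_mono sub"
    and crack_limit: "\<And>t. t \<in> {0..1} \<Longrightarrow> \<forall>\<^sub>F n in sequentially. cracked (sub n) (step_of \<tau> (sub n) t) = crack t"
begin

definition past where "past n t = \<tau> (sub n) (step_of \<tau> (sub n) t)"

lemma past_range: "t \<in> {0..1} \<Longrightarrow> past n t \<in> {0..1}"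
  unfolding past_def by (intro tau_range step_of(1)) auto

lemma past_tendsto: "t \<in> {0..1} \<Longrightarrow> (\<lambda>n. past n t) \<longlonglongrightarrow> t"
  using LIMSEQ_subseq_LIMSEQ[OF last_time_tendsto sub] by (simp add: past_def o_def)

lemma tendsto_past:
  assumes "continuous_on {0..1} f" "t \<in> {0..1}"
  shows "(\<lambda>n. f (past n t)) \<longlonglongrightarrow> f t"
  by (rule continuous_on_tendsto_compose[OF assms(1) past_tendsto[OF assms(2)] assms(2)])
     (simp add: past_range[OF assms(2)] del: atLeastAtMost_iff)

lemma crack_limitE:
  assumes "t \<in> {0..1}"
  obtains n where "cracked (sub n) (step_of \<tau> (sub n) t) = crack t"
  using crack_limit[OF assms] by (meson eventually_sequentially le_refl)

lemma crack_cracks: "t \<in> {0..1} \<Longrightarrow> crack t \<in> cracks"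
proof -
  assume t: "t \<in> {0..1}"
  obtain n where "cracked (sub n) (step_of \<tau> (sub n) t) = crack t" using crack_limitE[OF t] .
  moreover have "cracked (sub n) (step_of \<tau> (sub n) t) \<in> cracks"
    using crack_set_closure[of "step_of \<tau> (sub n) t" "sub n"] step_of(1)[of t "sub n"] t by simp
  ultimately show ?thesis by simp
qed

lemma crack_mono:
  assumes "0 \<le> s" "s \<le> t" "t \<le> 1"
  shows "crack s \<subseteq> crack t"
proof -
  have st: "s \<in> {0..1}" "t \<in> {0..1}" using assms by auto
  have "\<forall>\<^sub>F n in sequentially. crack s \<subseteq> crack t"
    using crack_limit[OF st(1)] crack_limit[OF st(2)]
  proof eventually_elim
    case (elim n)
    then show ?case using cracked_mono[OF step_of_mono[OF assms(1,2)], of "sub n" "sub n"] by simp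
  qed
  then show ?thesis by simp
qed

definition energy_at where "energy_at t = total (crack t) (g t)"

lemma discrete_total_tendsto:
  assumes t: "t \<in> {0..1}"
  shows "(\<lambda>n. total (cracked (sub n) (step_of \<tau> (sub n) t)) (g (past n t))) \<longlonglongrightarrow> energy_at t"
proof -
  have "(\<lambda>n. total (crack t) (g (past n t))) \<longlonglongrightarrow> energy_at t"
    unfolding energy_at_def by (rule tendsto_past[OF total_continuous[OF crack_cracks[OF t]] t])
  then show ?thesis
    by (rule Lim_transform_eventually) (use crack_limit[OF t] in eventually_elim, simp)
qed

lemma energy_stability:
  assumes t: "t \<in> {0..1}" and P': "P' \<in> cracks" "crack t \<subseteq> P'"
  shows "energy_at t \<le> total P' (g t)"
proof (rule tendsto_le[OF _ tendsto_past[OF total_continuous[OF P'(1)] t] discrete_total_tendsto[OF t]])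
  show "\<forall>\<^sub>F n in sequentially. total (cracked (sub n) (step_of \<tau> (sub n) t)) (g (past n t)) \<le> total P' (g (past n t))"
    using crack_limit[OF t]
  proof eventually_elim
    case (elim n)
    have "step_of \<tau> (sub n) t \<le> sub n" using step_of(1) t by simp
    from discrete_stability[OF this P'(1)] elim P'(2) show ?case by (simp add: past_def)
  qed
qed simp

text \<open>
  The upper bound is the limit of the discrete estimate. For the lower bound, the later crack is a
  competitor at the earlier time.
\<close>

lemma energy_lipschitz:
  "\<exists>L\<ge>0. \<forall>s t. 0 \<le> s \<longrightarrow> s \<le> t \<longrightarrow> t \<le> 1 \<longrightarrow> \<bar>energy_at t - energy_at s\<bar> \<le> L * (arc t - arc s)"
proof -
  obtain L where L: "L \<ge> 0" "\<And>P s t. P \<in> cracks \<Longrightarrow> 0 \<le> s \<Longrightarrow> s \<le> t \<Longrightarrow> t \<le> 1 \<Longrightarrow> \<bar>elastic P (g t) - elastic P (g s)\<bar> \<le> L * (arc t - arc s)"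
    using elastic_lipschitz by blast
  have "\<bar>energy_at t - energy_at s\<bar> \<le> L * (arc t - arc s)" if st: "0 \<le> s" "s \<le> t" "t \<le> 1" for s t
  proof -
    have s: "s \<in> {0..1}" and t: "t \<in> {0..1}" using st by auto
    have "energy_at t \<le> energy_at s + L * (arc t - arc s)"
    proof (rule tendsto_le[OF _ _ discrete_total_tendsto[OF t]])
      show "(\<lambda>n. total (cracked (sub n) (step_of \<tau> (sub n) s)) (g (past n s)) + L * (arc (past n t) - arc (past n s)))
          \<longlonglongrightarrow> energy_at s + L * (arc t - arc s)"
        by (intro tendsto_intros discrete_total_tendsto s tendsto_past[OF arc_continuous] t)
      show "\<forall>\<^sub>F n in sequentially. total (cracked (sub n) (step_of \<tau> (sub n) t)) (g (past n t)) \<le>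
         total (cracked (sub n) (step_of \<tau> (sub n) s)) (g (past n s)) + L * (arc (past n t) - arc (past n s))"
        unfolding past_def
        by (intro always_eventually allI discrete_energy_estimate L(2) step_of_mono st step_of(1)) (use st in auto)
    qed simp
    moreover have "energy_at s \<le> total (crack t) (g s)"
      by (rule energy_stability[OF s crack_cracks[OF t] crack_mono[OF st]])
    moreover have "\<bar>elastic (crack t) (g t) - elastic (crack t) (g s)\<bar> \<le> L * (arc t - arc s)"
      by (rule L(2)[OF crack_cracks[OF t] st])
    ultimately show ?thesis by (simp add: energy_at_def total_def abs_le_iff)
  qed
  then show ?thesis using L(1) by blast
qed

lemma energy_abs_continuous: "abs_continuous_on {0..1} energy_at"
proof -
  obtain L where L: "L \<ge> 0" "\<And>s t. 0 \<le> s \<Longrightarrow> s \<le> t \<Longrightarrow> t \<le> 1 \<Longrightarrow> \<bar>energy_at t - energy_at s\<bar> \<le> L * (arc t - arc s)"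
    using energy_lipschitz by blast
  show ?thesis
  proof (rule abs_continuous_on_if_dominated[OF total_rate_integrable rate_nonneg L(1)])
    fix s t :: real assume st: "0 \<le> s" "s \<le> t" "t \<le> 1"
    have "(LINT r:{s..t}|lebesgue. rate r) = arc t - arc s"
      unfolding arc_difference[OF st]
      by (rule set_lebesgue_integral_eq_integral(2)[OF sub_integrable(1)[OF total_rate_integrable st(1,3)]])
    then show "\<bar>energy_at t - energy_at s\<bar> \<le> L * (LINT r:{s..t}|lebesgue. rate r)"
      using L(2)[OF st] by simp
  qed
qed

lemma energy_continuous: "continuous_on {0..1} energy_at"
  unfolding continuous_on_def
proof
  fix t :: real assume t: "t \<in> {0..1}"
  obtain L where L: "L \<ge> 0" "\<And>s t. 0 \<le> s \<Longrightarrow> s \<le> t \<Longrightarrow> t \<le> 1 \<Longrightarrow> \<bar>energy_at t - energy_at s\<bar> \<le> L * (arc t - arc s)"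
    using energy_lipschitz by blast
  have "((\<lambda>s. L * \<bar>arc s - arc t\<bar>) \<longlongrightarrow> L * \<bar>arc t - arc t\<bar>) (at t within {0..1})"
    using arc_continuous t unfolding continuous_on_def by (intro tendsto_intros) blast
  then have lim: "((\<lambda>s. L * \<bar>arc s - arc t\<bar>) \<longlongrightarrow> 0) (at t within {0..1})" by simp
  have "((\<lambda>s. energy_at s - energy_at t) \<longlongrightarrow> 0) (at t within {0..1})"
  proof (rule Lim_null_comparison[OF _ lim])
    have "norm (energy_at s - energy_at t) \<le> L * \<bar>arc s - arc t\<bar>" if s: "s \<in> {0..1}" for s
    proof (cases "s \<le> t")
      case True
      have "\<bar>energy_at t - energy_at s\<bar> \<le> L * (arc t - arc s)" using L(2)[of s t] s t True by simp
      also have "\<dots> \<le> L * \<bar>arc s - arc t\<bar>" using L(1) by (intro mult_left_mono) auto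
      finally show ?thesis by simp
    next
      case False
      have "\<bar>energy_at s - energy_at t\<bar> \<le> L * (arc s - arc t)" using L(2)[of t s] s t False by simp
      also have "\<dots> \<le> L * \<bar>arc s - arc t\<bar>" using L(1) by (intro mult_left_mono) auto
      finally show ?thesis by simp
    qed
    then show "\<forall>\<^sub>F s in at t within {0..1}. norm (energy_at s - energy_at t) \<le> L * \<bar>arc s - arc t\<bar>"
      by (simp add: eventually_at_filter)
  qed
  then show "(energy_at \<longlongrightarrow> energy_at t) (at t within {0..1})" by (simp add: LIM_zero_iff)
qed

definition crack_times where "crack_times Q = {t\<in>{0..1}. crack t = Q}"

text \<open>
  Monotonicity of the crack makes each level set an interval, hence measurable.
\<close>

lemma crack_times_interval:
  assumes "s \<in> crack_times Q" "t \<in> crack_times Q" "s \<le> x" "x \<le> t"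
  shows "x \<in> crack_times Q"
  using assms crack_mono[of s x] crack_mono[of x t] by (auto simp: crack_times_def)

lemma actual_power_integrable: "(\<lambda>t. power (crack t) t) absolutely_integrable_on {0..1}"
proof -
  have J: "crack_times Q \<in> sets lebesgue" for Q
  proof -
    have "is_interval (crack_times Q)"
      unfolding is_interval_1 using crack_times_interval by blast
    then have "convex (crack_times Q)" by (simp add: is_interval_convex_1)
    moreover have "bounded (crack_times Q)"
      by (rule bounded_subset[of "{0..1}"]) (auto simp: crack_times_def)
    ultimately show ?thesis using measurable_convex fmeasurableD by blast
  qed
  have "(\<lambda>t. indicat_real (crack_times Q) t * power Q t) absolutely_integrable_on {0..1}" for Q
  proof (rule absolutely_integrable_bounded_measurable_product_real[OF _ _ _ power_integrable])
    have "indicat_real (crack_times Q) \<in> borel_measurable lebesgue" using J by (intro borel_measurable_indicator)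
    then show "indicat_real (crack_times Q) \<in> borel_measurable (lebesgue_on {0..1})"
      by (rule measurable_restrict_space1)
    show "bounded (indicat_real (crack_times Q) ` {0..1})"
      by (rule bounded_subset[of "{0..1}"]) (auto simp: indicator_def)
  qed simp
  then have i: "(\<lambda>t. \<Sum>Q\<in>cracks. indicat_real (crack_times Q) t * power Q t) absolutely_integrable_on {0..1}"
    by (intro absolutely_integrable_sum finite_cracks)
  have eq: "(\<Sum>Q\<in>cracks. indicat_real (crack_times Q) t * power Q t) = power (crack t) t" if t: "t \<in> {0..1}" for t
  proof -
    have "(\<Sum>Q\<in>cracks. indicat_real (crack_times Q) t * power Q t) = (\<Sum>Q\<in>cracks. if Q = crack t then power Q t else 0)"
      using t by (intro sum.cong) (auto simp: crack_times_def)
    then show ?thesis using crack_cracks[OF t] finite_cracks by simp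
  qed
  show ?thesis by (rule iffD1[OF set_integrable_cong[OF refl refl eq] i])
qed

text \<open>
  Off finitely many times, the endpoints of the intervals on which the crack is constant, the difference of
  both sides is locally constant; and it is continuous.
\<close>

lemma energy_balance:
  assumes t: "t \<in> {0..1}"
  shows "energy_at t = energy_at 0 + 2 * integral {0..t} (\<lambda>s. power (crack s) s)"
proof -
  let ?p = "\<lambda>s. power (crack s) s"
  define H where "H t = energy_at t - 2 * integral {0..t} ?p" for t
  (* all endpoints of the intervals on which the crack is constant *)
  define K where "K = {0, 1} \<union> (\<lambda>Q. Inf (crack_times Q)) ` cracks \<union> (\<lambda>Q. Sup (crack_times Q)) ` cracks"
  have "H t = H 0"
  proof (rule has_derivative_zero_unique_strong_interval[of K 0 1 H _ t])
    show "finite K" using finite_cracks by (simp add: K_def)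
    show "continuous_on {0..1} H" unfolding H_def
      by (intro continuous_on_diff energy_continuous continuous_on_mult continuous_on_const
           indefinite_integral_continuous[OF actual_power_integrable])
    show "t \<in> {0..1}" by (rule t)
    fix x assume x: "x \<in> {0..1} - K"
    define Q where "Q = crack x"
    have Q: "Q \<in> cracks" using x crack_cracks by (auto simp: Q_def)
    have xJ: "x \<in> crack_times Q" using x by (simp add: crack_times_def Q_def)
    have bd: "bdd_below (crack_times Q)" "bdd_above (crack_times Q)"
      by (auto simp: crack_times_def intro!: bdd_belowI[of _ 0] bdd_aboveI[of _ 1])
    have "Inf (crack_times Q) < x" "x < Sup (crack_times Q)"
      using cInf_lower[OF xJ bd(1)] cSup_upper[OF xJ bd(2)] x Q by (auto simp: K_def order_less_le)
    then obtain c d where c: "c \<in> crack_times Q" "c < x" and d: "d \<in> crack_times Q" "x < d"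
      using cInf_lessD[of "crack_times Q" x] less_cSupD[of "crack_times Q" x] xJ by blast
    have cd: "0 \<le> c" "d \<le> 1" using c d by (auto simp: crack_times_def)
    have const: "H c = H y" if y: "y \<in> {c<..<d}" for y
    proof -
      have cr: "crack z = Q" if "z \<in> {c..y}" for z
        using crack_times_interval[OF c(1) d(1), of z] that y by (simp add: crack_times_def)
      have "integral {0..c} ?p + integral {c..y} ?p = integral {0..y} ?p"
        by (rule Henstock_Kurzweil_Integration.integral_combine)
           (use sub_integrable(2)[OF actual_power_integrable] cd y in auto)
      moreover have "integral {c..y} ?p = integral {c..y} (power Q)"
        by (rule integral_cong) (simp add: cr)
      moreover have "elastic Q (g y) - elastic Q (g c) = 2 * integral {c..y} (power Q)"
        by (rule elastic_balance) (use cd y in auto)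
      moreover have "energy_at y - energy_at c = elastic Q (g y) - elastic Q (g c)"
        using cr[of y] cr[of c] y by (simp add: energy_at_def total_def)
      ultimately show ?thesis by (simp add: H_def)
    qed
    have "((\<lambda>_. H c) has_derivative (\<lambda>h. 0)) (at x)" by simp
    then have "(H has_derivative (\<lambda>h. 0)) (at x)"
      by (rule has_derivative_transform_within_open[of _ _ _ _ "{c<..<d}"]) (use c d const in auto)
    then show "(H has_derivative (\<lambda>h. 0)) (at x within {0..1})" by (rule has_derivative_at_withinI)
  qed simp
  then show ?thesis by (simp add: H_def)
qed

end

section \<open>The limiting evolution and convergence\<close>

context fe_mesh
begin

text \<open>
  The integrand is bounded by a function that is constant on cells, whose integral is a finite sum.
\<close>

lemma Lp_tendsto_cellwise:
  fixes f :: "nat \<Rightarrow> real ^ 'n \<Rightarrow> 'b :: real_normed_vector"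
  assumes R: "R \<subseteq> cells" and p: "0 < p"
    and bound: "\<And>n. AE x in lebesgue. x \<in> S \<longrightarrow> (\<exists>T\<in>R. x \<in> T \<and> norm (f n x - F x) \<le> \<delta> n T)"
    and \<delta>: "\<And>T. T \<in> R \<Longrightarrow> (\<lambda>n. \<delta> n T) \<longlonglongrightarrow> 0"
  shows "Lp_tendsto p S f F"
proof -
  have finR: "finite R" using R finite_cells by (rule finite_subset)
  have m: "T \<in> lmeasurable" if "T \<in> R" for T using lmeasurable_cell R that by blast
  let ?b = "\<lambda>n. \<Sum>T\<in>R. \<bar>\<delta> n T\<bar> ^ p * measure lebesgue T"
  have le: "(\<integral>\<^sup>+x\<in>S. ennreal (norm (f n x - F x) ^ p) \<partial>lebesgue) \<le> ennreal (?b n)" for n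
  proof -
    have "(\<integral>\<^sup>+x\<in>S. ennreal (norm (f n x - F x) ^ p) \<partial>lebesgue) \<le> (\<integral>\<^sup>+x. (\<Sum>T\<in>R. ennreal (\<bar>\<delta> n T\<bar> ^ p) * indicator T x) \<partial>lebesgue)"
    proof (rule nn_integral_mono_AE)
      show "AE x in lebesgue. ennreal (norm (f n x - F x) ^ p) * indicator S x \<le> (\<Sum>T\<in>R. ennreal (\<bar>\<delta> n T\<bar> ^ p) * indicator T x)"
        using bound[of n]
      proof eventually_elim
        case (elim x)
        show ?case
        proof (cases "x \<in> S")
          case True
          then obtain T where T: "T \<in> R" "x \<in> T" "norm (f n x - F x) \<le> \<delta> n T" using elim by blast
          have "ennreal (norm (f n x - F x) ^ p) \<le> ennreal (\<bar>\<delta> n T\<bar> ^ p)"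
            using T(3) by (intro ennreal_leI power_mono) auto
          also have "\<dots> = ennreal (\<bar>\<delta> n T\<bar> ^ p) * indicator T x" using T(2) by simp
          also have "\<dots> \<le> (\<Sum>T\<in>R. ennreal (\<bar>\<delta> n T\<bar> ^ p) * indicator T x)"
            using finR T(1) by (intro member_le_sum) auto
          finally show ?thesis using True by simp
        qed simp
      qed
    qed
    also have "\<dots> = (\<Sum>T\<in>R. (\<integral>\<^sup>+x. ennreal (\<bar>\<delta> n T\<bar> ^ p) * indicator T x \<partial>lebesgue))"
      using m by (intro nn_integral_sum) (auto simp: fmeasurableD)
    also have "\<dots> = (\<Sum>T\<in>R. ennreal (\<bar>\<delta> n T\<bar> ^ p * measure lebesgue T))"
    proof (rule sum.cong[OF refl])
      fix T assume T: "T \<in> R"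
      have "(\<integral>\<^sup>+x. ennreal (\<bar>\<delta> n T\<bar> ^ p) * indicator T x \<partial>lebesgue) = ennreal (\<bar>\<delta> n T\<bar> ^ p) * emeasure lebesgue T"
        by (rule nn_integral_cmult_indicator) (use m[OF T] in \<open>simp add: fmeasurableD\<close>)
      also have "emeasure lebesgue T = ennreal (measure lebesgue T)"
        by (rule emeasure_eq_measure2[OF m[OF T]])
      finally show "(\<integral>\<^sup>+x. ennreal (\<bar>\<delta> n T\<bar> ^ p) * indicator T x \<partial>lebesgue) = ennreal (\<bar>\<delta> n T\<bar> ^ p * measure lebesgue T)"
        by (simp only: ennreal_mult''[OF measure_nonneg])
    qed
    also have "\<dots> = ennreal (?b n)" by (rule sum_ennreal) simp
    finally show ?thesis .
  qed
  have "?b \<longlonglongrightarrow> (\<Sum>T\<in>R. \<bar>0\<bar> ^ p * measure lebesgue T)"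
    by (intro tendsto_intros \<delta>)
  then have "?b \<longlonglongrightarrow> 0" using p by (simp add: zero_power)
  then have "(\<lambda>n. ennreal (?b n)) \<longlonglongrightarrow> ennreal 0" by (rule tendsto_ennrealI)
  then have b0: "(\<lambda>n. ennreal (?b n)) \<longlonglongrightarrow> 0" by simp
  show ?thesis unfolding Lp_tendsto_def
    by (rule tendsto_sandwich[OF _ _ tendsto_const b0]) (use le in auto)
qed

end

context fe_loading
begin

lemma admissible_eq_load_on_clamped:
  assumes adm: "(u, \<gamma>) \<in> \<A> (interpolant Th f)" and T: "T \<in> cells" "clamped T" "x \<in> T"
  shows "u x = interpolant Th f x"
proof (rule affine_eq_if_eq_on_collar[OF T(1,2) _ _ _ T(3)])
  show "affine_fun_on T u" using adm T by (auto simp: admissible_pairs_def intro: V_space_affine)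
  show "affine_fun_on T (interpolant Th f)" using T by (intro interpolant_affine cellsD)
  show "\<forall>x\<in>\<Omega>' - closure \<Omega>. u x = interpolant Th f x" using adm by (auto simp: admissible_pairs_def)
qed

lemma admissible_slope_on_clamped:
  assumes adm: "(u, \<gamma>) \<in> \<A> (interpolant Th f)" and T: "T \<in> cells" "clamped T"
  shows "slope u T = nodal_slope f T"
  unfolding nodal_slope_def by (rule slope_cong) (rule admissible_eq_load_on_clamped[OF adm T])

lemma load_pointwise_continuous:
  "T \<in> cells \<Longrightarrow> x \<in> T \<Longrightarrow> continuous_on {0..1} (\<lambda>t. interpolant Th (g t) x)"
  by (subst interpolant_expand) (auto intro!: continuous_intros load_continuous)

lemma nodal_slope_continuous:
  "T \<in> cells \<Longrightarrow> continuous_on {0..1} (\<lambda>t. nodal_slope (g t) T)"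
  by (subst nodal_slope_expand) (auto intro!: continuous_intros load_continuous)

end

context fe_limit
begin

text \<open>
  At positive times any optimal pair for the limiting crack will do. At time \<open>0\<close> the discrete initial pair
  has to be kept, so that it is minimal with respect to the empty crack.
\<close>

definition disp where "disp t = (if t = 0 then um 0 0 else displacement (crack t) (g t))"

definition eig where "eig t = (if t = 0 then \<gamma>m 0 0 else eigenstrain (crack t) (displacement (crack t) (g t)))"

lemma crack_0: "crack 0 = support (\<gamma>m 0 0)"
proof -
  obtain n where "cracked (sub n) (step_of \<tau> (sub n) 0) = crack 0" using crack_limitE[of 0] by auto
  then show ?thesis using initial_independent(2)[of "sub n"] by (simp add: step_of_0 cracked_def)
qed

lemma closure_Union_crack: "t \<in> {0..1} \<Longrightarrow> closure (\<Union>(crack t)) = \<Union>(crack t)"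
proof -
  assume "t \<in> {0..1}"
  then have "crack t \<subseteq> cells" using crack_cracks by (auto simp: cracks_def)
  then show ?thesis using compact_Union_cells compact_imp_closed closure_closed by metis
qed

lemma limit_pair:
  assumes t: "t \<in> {0..1}"
  shows "(disp t, eig t) \<in> \<A> (load t)" (is ?adm)
    and "support (eig t) \<subseteq> crack t" (is ?supp)
    and "\<E> (disp t) (eig t) (\<Union>(crack t)) = energy_at t" (is ?energy)
    and "\<And>T. T \<in> cells \<Longrightarrow> T \<inter> \<Omega> \<noteq> {} \<Longrightarrow> slope (disp t) T - cell_value (eig t) T = strain (crack t) (g t) T"
proof -
  have "?adm \<and> ?supp \<and> ?energy \<and>
    (\<forall>T. T \<in> cells \<longrightarrow> T \<inter> \<Omega> \<noteq> {} \<longrightarrow> slope (disp t) T - cell_value (eig t) T = strain (crack t) (g t) T)"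
  proof (cases "t = 0")
    case True
    have "crack 0 = {} \<union> support (\<gamma>m 0 0)" by (simp add: crack_0)
    note * = minimizer_properties[OF initial_minimizer[of 0] empty_crack this]
    show ?thesis using *(3)[OF closure_Union_crack[of 0]] *(5) initial_minimizer[of 0] crack_0
      by (auto simp: True disp_def eig_def energy_at_def minimizer_def)
  next
    case False
    note cr = crack_cracks[OF t]
    then have sub: "crack t \<subseteq> cells" by (simp add: cracks_def)
    have "slope (displacement (crack t) (g t)) T - cell_value (eigenstrain (crack t) (displacement (crack t) (g t))) T
       = strain (crack t) (g t) T" if "T \<in> cells" for T
      using cell_value_eigenstrain[OF displacement_V sub that, of "crack t" "g t"]
      by (simp add: strain_def nodal_slope_def displacement_def)
    then show ?thesis
      using optimal_pair_admissible[OF cr, of "g t"] optimal_pair_support[OF cr, of "g t"]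
        optimal_pair_energy(2)[OF cr order_refl closure_Union_crack[OF t] refl, of "g t"]
      by (simp add: disp_def eig_def False energy_at_def)
  qed
  then show ?adm ?supp ?energy
    and "\<And>T. T \<in> cells \<Longrightarrow> T \<inter> \<Omega> \<noteq> {} \<Longrightarrow> slope (disp t) T - cell_value (eig t) T = strain (crack t) (g t) T"
    by blast+
qed

lemma limit_V: "t \<in> {0..1} \<Longrightarrow> disp t \<in> V_space Th \<Omega>'"
  and limit_W: "t \<in> {0..1} \<Longrightarrow> eig t \<in> W_space Th \<Omega>'"
  using limit_pair(1) by (auto simp: admissible_pairs_def)

lemma AE_actual_power:
  "AE s in lebesgue. s \<in> {0..1} \<longrightarrow>
     (LINT x:\<Omega>|lebesgue. (grad (disp s) x - eig s x) \<bullet> (C *v dt_grad load s x)) = power (crack s) s"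
  using AE_load_derivative
proof eventually_elim
  case (elim s)
  show ?case
  proof
    assume s: "s \<in> {0..1}"
    show "(LINT x:\<Omega>|lebesgue. (grad (disp s) x - eig s x) \<bullet> (C *v dt_grad load s x)) = power (crack s) s"
      by (rule power_integral[OF limit_V[OF s] limit_W[OF s] s _ limit_pair(4)[OF s]]) (use elim s in auto)
  qed
qed

theorem limit_is_quasistatic_evolution:
  "quasistatic_evolution C \<kappa> \<epsilon> Th \<Omega> \<Omega>' load disp eig (\<lambda>t. \<Union>(crack t))"
proof -
  have en: "\<E> (disp t) (eig t) (\<Union>(crack t)) = energy_at t" if "t \<in> {0..1}" for t
    by (rule limit_pair(3)[OF that])
  have en0: "\<E> (disp 0) (eig 0) {} = energy_at 0"
  proof -
    have "crack 0 = {} \<union> support (\<gamma>m 0 0)" by (simp add: crack_0)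
    from minimizer_properties(2)[OF initial_minimizer[of 0] empty_crack this]
    show ?thesis by (simp add: disp_def eig_def energy_at_def)
  qed
  have AD: "(disp t, eig t, \<Union>(crack t)) \<in> AD Th \<Omega> \<Omega>' (load t)" if t: "t \<in> {0..1}" for t
  proof -
    have "crack t \<subseteq> {T\<in>Th. T \<inter> \<Omega>' \<noteq> {}}" using crack_cracks[OF t] by (auto simp: cracks_def cells_def)
    moreover have "nonzero_set Th \<Omega>' (eig t) \<subseteq> \<Union>(crack t)"
      using nonzero_set_subset[OF limit_W[OF t]] limit_pair(2)[OF t] by blast
    ultimately show ?thesis using limit_pair(1)[OF t] by (auto simp: AD_def)
  qed
  have stable: "\<E> (disp t) (eig t) (\<Union>(crack t)) \<le> \<E> v \<eta> (\<Union>(crack t))"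
    if t: "t \<in> {0..1}" and adm: "(v, \<eta>) \<in> \<A> (load t)" for t v \<eta>
  proof -
    have cr: "crack t \<in> cracks" by (rule crack_cracks[OF t])
    have "energy_at t \<le> total (crack t \<union> support \<eta>) (g t)"
      by (rule energy_stability[OF t cracks_Un[OF cr support_cracks[OF adm]]]) simp
    also have "\<dots> \<le> \<E> v \<eta> (\<Union>(crack t))"
      using cr by (intro energy_ge_total[OF adm closure_Union_crack[OF t]]) (simp add: cracks_def)
    finally show ?thesis using en[OF t] by simp
  qed
  have ac: "abs_continuous_on {0..1} (\<lambda>t. \<E> (disp t) (eig t) (\<Union>(crack t)))"
    using en energy_abs_continuous by (rule abs_continuous_on_cong)
  note pow = set_integral_AE_eq_integral[OF actual_power_integrable AE_actual_power]
  show ?thesis unfolding quasistatic_evolution_def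
  proof (intro conjI ballI allI impI, goal_cases)
    case (1 t) then show ?case by (rule AD)
  next
    case 2 show ?case using initial_minimizer[of 0] by (simp add: disp_def eig_def)
  next
    case (3 s t) then show ?case using crack_mono[of s t] by blast
  next
    case (4 t p) then show ?case using stable[of t "fst p" "snd p"] by (cases p) auto
  next
    case 5 show ?case by (rule ac)
  next
    case 6 show ?case by (rule pow(1))
  next
    case (7 t)
    show ?case unfolding en[OF 7] en0 pow(2)[OF 7] by (rule energy_balance[OF 7])
  qed
qed

abbreviation "Ud t n \<equiv> um (sub n) (step_of \<tau> (sub n) t)"
abbreviation "Yd t n \<equiv> \<gamma>m (sub n) (step_of \<tau> (sub n) t)"
abbreviation "Qd t n \<equiv> cracked (sub n) (step_of \<tau> (sub n) t)"
abbreviation "Zd t n \<equiv> crack_set Th \<Omega>' (\<gamma>m (sub n)) (step_of \<tau> (sub n) t)"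

lemma discrete_pair:
  assumes t: "t \<in> {0..1}"
  shows "(Ud t n, Yd t n) \<in> \<A> (load (past n t))"
    and "Qd t n \<in> cracks" and "closure (Zd t n) = \<Union>(Qd t n)"
    and "\<E> (Ud t n) (Yd t n) (Zd t n) = total (Qd t n) (g (past n t))"
    and "\<And>T. T \<in> cells \<Longrightarrow> T \<inter> \<Omega> \<noteq> {} \<Longrightarrow> slope (Ud t n) T - cell_value (Yd t n) T = strain (Qd t n) (g (past n t)) T"
    and "support (Yd t n) \<subseteq> Qd t n"
proof -
  have i: "step_of \<tau> (sub n) t \<le> sub n" using step_of(1) t by simp
  show "(Ud t n, Yd t n) \<in> \<A> (load (past n t))"
    unfolding past_def by (rule discrete_admissible[OF i])
  show "Qd t n \<in> cracks" "closure (Zd t n) = \<Union>(Qd t n)" using crack_set_closure[OF i] by auto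
  show "\<E> (Ud t n) (Yd t n) (Zd t n) = total (Qd t n) (g (past n t))"
    unfolding past_def by (rule discrete_properties(1)[OF i])
  show "\<And>T. T \<in> cells \<Longrightarrow> T \<inter> \<Omega> \<noteq> {} \<Longrightarrow> slope (Ud t n) T - cell_value (Yd t n) T = strain (Qd t n) (g (past n t)) T"
    unfolding past_def by (rule discrete_properties(3)[OF i, rule_format])
  show "support (Yd t n) \<subseteq> Qd t n" by (auto simp: cracked_def)
qed

lemma energy_convergence:
  assumes "t \<in> {0..1}"
  shows "(\<lambda>n. \<E> (Ud t n) (Yd t n) (Zd t n)) \<longlonglongrightarrow> \<E> (disp t) (eig t) (\<Union>(crack t))"
  unfolding discrete_pair(4)[OF assms] limit_pair(3)[OF assms] by (rule discrete_total_tendsto[OF assms])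

text \<open>
  On cells meeting \<open>\<Omega>\<close> the discrete strain is the optimal one for the discrete crack, which is eventually
  the limiting crack; on clamped cells it is the slope of the datum.
\<close>

lemma strain_convergence:
  assumes t: "t \<in> {0..1}" and T: "T \<in> cells" "T \<inter> \<Omega> \<noteq> {} \<or> clamped T"
  shows "(\<lambda>n. if T \<in> Qd t n then 0 else slope (Ud t n) T) \<longlonglongrightarrow> slope (disp t) T - cell_value (eig t) T"
proof (cases "clamped T")
  case True
  have nQ: "T \<notin> Qd t n" for n using discrete_pair(2)[OF t, of n] True by (auto simp: cracks_def)
  have "T \<notin> support (eig t)" using limit_pair(2)[OF t] crack_cracks[OF t] True by (auto simp: cracks_def)
  then have "cell_value (eig t) T = 0" using T by (simp add: support_def)
  moreover have "slope (disp t) T = nodal_slope (g t) T" by (rule admissible_slope_on_clamped[OF limit_pair(1)[OF t] T(1) True])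
  moreover have "slope (Ud t n) T = nodal_slope (g (past n t)) T" for n
    by (rule admissible_slope_on_clamped[OF discrete_pair(1)[OF t] T(1) True])
  ultimately show ?thesis
    using nQ tendsto_past[OF nodal_slope_continuous[OF T(1)] t] by simp
next
  case False
  then have body: "T \<inter> \<Omega> \<noteq> {}" using T by blast
  have eq: "(if T \<in> Qd t n then 0 else slope (Ud t n) T) = strain (Qd t n) (g (past n t)) T" for n
  proof (cases "T \<in> Qd t n")
    case True then show ?thesis by (simp add: strain_def)
  next
    case False
    then have "T \<notin> support (Yd t n)" using discrete_pair(6)[OF t, of n] by blast
    then have "cell_value (Yd t n) T = 0" using T by (simp add: support_def)
    then show ?thesis using discrete_pair(5)[OF t T(1) body, of n] False by simp
  qed
  have "(\<lambda>n. strain (crack t) (g (past n t)) T) \<longlonglongrightarrow> strain (crack t) (g t) T"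
    by (rule tendsto_past[OF strain_continuous[OF T(1) body] t])
  then have "(\<lambda>n. strain (Qd t n) (g (past n t)) T) \<longlonglongrightarrow> strain (crack t) (g t) T"
    by (rule Lim_transform_eventually) (use crack_limit[OF t] in eventually_elim, simp)
  then show ?thesis unfolding eq limit_pair(4)[OF t T(1) body] .
qed

lemma gradient_convergence:
  assumes t: "t \<in> {0..1}"
  shows "Lp_tendsto 2 \<Omega>' (\<lambda>n x. indicat_real (- Zd t n) x *\<^sub>R grad (Ud t n) x) (\<lambda>x. grad (disp t) x - eig t x)"
proof (rule Lp_tendsto_cellwise[of "{T\<in>cells. T \<inter> \<Omega> \<noteq> {} \<or> clamped T}" _ _ _ _
      "\<lambda>n T. norm ((if T \<in> Qd t n then 0 else slope (Ud t n) T) - (slope (disp t) T - cell_value (eig t) T))"])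
  fix T assume "T \<in> {T\<in>cells. T \<inter> \<Omega> \<noteq> {} \<or> clamped T}"
  then have "(\<lambda>n. if T \<in> Qd t n then 0 else slope (Ud t n) T) \<longlonglongrightarrow> slope (disp t) T - cell_value (eig t) T"
    by (intro strain_convergence[OF t]) auto
  then show "(\<lambda>n. norm ((if T \<in> Qd t n then 0 else slope (Ud t n) T) - (slope (disp t) T - cell_value (eig t) T))) \<longlonglongrightarrow> 0"
    by (intro tendsto_norm_zero LIM_zero)
next
  fix n
  have Uv: "Ud t n \<in> V_space Th \<Omega>'" using discrete_pair(1)[OF t, of n] by (simp add: admissible_pairs_def)
  have nullf: "AE x in lebesgue. x \<notin> frontier \<Omega>"
    using null_boundary by (simp add: negligible_iff_null_sets AE_not_in)
  show "AE x in lebesgue. x \<in> \<Omega>' \<longrightarrow> (\<exists>T\<in>{T\<in>cells. T \<inter> \<Omega> \<noteq> {} \<or> clamped T}. x \<in> T \<and>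
     norm (indicat_real (- Zd t n) x *\<^sub>R grad (Ud t n) x - (grad (disp t) x - eig t x))
      \<le> norm ((if T \<in> Qd t n then 0 else slope (Ud t n) T) - (slope (disp t) T - cell_value (eig t) T)))"
    using AE_interior_cells AE_grad[OF Uv] AE_grad[OF limit_V[OF t]] AE_cell_value[OF limit_W[OF t]] nullf
  proof eventually_elim
    case (elim x)
    show ?case
    proof
      assume x: "x \<in> \<Omega>'"
      then obtain T where T: "T \<in> cells" "x \<in> T" using domain_cover[OF x] by blast
      have xi: "x \<in> interior T" using elim(1) T by blast
      have TR: "T \<inter> \<Omega> \<noteq> {} \<or> clamped T"
        using dangling_part[of T] x T elim(5) by blast
      have ind: "indicat_real (- Zd t n) x = (if T \<in> Qd t n then 0 else 1)"
      proof (cases "T \<in> Qd t n")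
        case True
        then obtain k where k: "k \<le> step_of \<tau> (sub n) t" "T \<in> support (\<gamma>m (sub n) k)" by (auto simp: cracked_def)
        have "k \<le> sub n" using k(1) step_of(1)[of t "sub n"] t by simp
        then have "\<gamma>m (sub n) k \<in> W_space Th \<Omega>'" using discrete_admissible[of k "sub n"] by (simp add: admissible_pairs_def)
        from interior_subset_nonzero_set[OF this k(2)] xi k(1) have "x \<in> Zd t n" by (auto simp: crack_set_def)
        then show ?thesis using True by simp
      next
        case False
        have "x \<notin> Zd t n"
        proof
          assume "x \<in> Zd t n"
          then have "x \<in> \<Union>(Qd t n)" using discrete_pair(3)[OF t, of n] closure_subset by blast
          then obtain T' where T': "T' \<in> Qd t n" "x \<in> T'" by blast
          have T'c: "T' \<in> cells" using T' discrete_pair(2)[OF t, of n] by (auto simp: cracks_def)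
          then have "x \<in> interior T'" using elim(1) T' by blast
          then have "T = T'" using interior_disjoint[OF cellsD[OF T(1)] cellsD[OF T'c] xi] by blast
          then show False using T' False by simp
        qed
        then show ?thesis using False by simp
      qed
      show "\<exists>T\<in>{T\<in>cells. T \<inter> \<Omega> \<noteq> {} \<or> clamped T}. x \<in> T \<and>
         norm (indicat_real (- Zd t n) x *\<^sub>R grad (Ud t n) x - (grad (disp t) x - eig t x))
          \<le> norm ((if T \<in> Qd t n then 0 else slope (Ud t n) T) - (slope (disp t) T - cell_value (eig t) T))"
        using T TR elim(2-4) unfolding ind by (intro bexI[of _ T]) auto
    qed
  qed
qed auto

text \<open>
  The cells on which the displacements converge cover a relatively closed part of the attached region
  \<open>G\<close>, and so do the others. A common point is impossible, since convergence at one point of a cell with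
  vanishing slopes spreads to the cell. So each component of \<open>G\<close> lies in one of the two parts, and it
  contains points of clamped cells, where convergence is known.
\<close>

lemma displacement_convergence:
  assumes t: "t \<in> {0..1}"
  shows "Lp_tendsto 1 (attached_part \<Omega> \<Omega>' (mesh_nbhd Th \<epsilon> (\<Union>(crack t)))) (Ud t) (disp t)"
proof -
  define G where "G = attached_part \<Omega> \<Omega>' (mesh_nbhd Th \<epsilon> (\<Union>(crack t)))"
  note G = attached_part_largest[where \<Omega>=\<Omega> and \<Omega>'=\<Omega>' and U="mesh_nbhd Th \<epsilon> (\<Union>(crack t))", folded G_def]
  define R where "R = {T\<in>cells. T \<inter> G \<noteq> {}}"
  let ?v = "\<lambda>n x. Ud t n x - disp t x"
  let ?d = "\<lambda>n T. slope (Ud t n) T - slope (disp t) T"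
  have Rc: "T \<in> cells" if "T \<in> R" for T using that by (simp add: R_def)
  have cover_G: "\<exists>T\<in>R. x \<in> T" if "x \<in> G" for x
    using domain_cover[of x] G(2) that by (auto simp: R_def)
  have not_cracked: "T \<notin> crack t" if "T \<in> R" for T
  proof
    assume Tc: "T \<in> crack t"
    have "T \<subseteq> mesh_nbhd Th \<epsilon> (\<Union>(crack t))"
    proof
      fix x assume x: "x \<in> T"
      then have "x \<in> \<Union>(crack t)" using Tc by blast
      then have "x \<in> closed_nbhd \<epsilon> (\<Union>(crack t))"
        using \<epsilon>_pos infdist_zero[of x "\<Union>(crack t)"] by (auto simp: closed_nbhd_def)
      then show "x \<in> mesh_nbhd Th \<epsilon> (\<Union>(crack t))"
        using x cellsD[OF Rc[OF that]] unfolding mesh_nbhd_def mesh_dom_def by blast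
    qed
    then show False using that G(3) by (auto simp: R_def)
  qed
  have relevant: "T \<inter> \<Omega> \<noteq> {} \<or> clamped T" if T: "T \<in> R" for T
  proof (rule ccontr)
    assume "\<not> ?thesis"
    then have "T \<inter> \<Omega>' \<subseteq> frontier \<Omega>" using dangling_part[of T] by blast
    then have "interior T \<inter> G \<subseteq> frontier \<Omega>" using interior_subset[of T] G(2) by blast
    then have "negligible (interior T \<inter> G)" using null_boundary negligible_subset by blast
    moreover have "interior T \<inter> G \<noteq> {}"
      using meets_interior[OF cellsD[OF Rc[OF T]] G(1)] T by (simp add: R_def)
    ultimately show False using open_not_negligible[of "interior T \<inter> G"] G(1) by blast
  qed
  have slopes: "(\<lambda>n. ?d n T) \<longlonglongrightarrow> 0" if T: "T \<in> R" for T
  proof -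
    have nc: "T \<notin> crack t" by (rule not_cracked[OF T])
    then have "cell_value (eig t) T = 0" using limit_pair(2)[OF t] Rc[OF T] by (auto simp: support_def)
    then have lim: "(\<lambda>n. if T \<in> Qd t n then 0 else slope (Ud t n) T) \<longlonglongrightarrow> slope (disp t) T"
      using strain_convergence[OF t Rc[OF T] relevant[OF T]] by simp
    have "(\<lambda>n. slope (Ud t n) T) \<longlonglongrightarrow> slope (disp t) T"
      by (rule Lim_transform_eventually[OF lim]) (use crack_limit[OF t] in eventually_elim, use nc in simp)
    then show ?thesis by (rule LIM_zero)
  qed
  have diff: "?v n x = ?v n y + ?d n T \<bullet> (x - y)" if "T \<in> R" "x \<in> T" "y \<in> T" for n x y T
  proof -
    have U: "affine_fun_on T (Ud t n)"
      using discrete_pair(1)[OF t, of n] Rc[OF that(1)] by (auto simp: admissible_pairs_def intro: V_space_affine)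
    have D: "affine_fun_on T (disp t)" by (rule V_space_affine[OF limit_V[OF t] Rc[OF that(1)]])
    show ?thesis using affine_fun_on_slope[OF U that(3,2)] affine_fun_on_slope[OF D that(3,2)]
      by (simp add: inner_diff_left)
  qed
  have spread: "(\<lambda>n. ?v n x) \<longlonglongrightarrow> 0" if "T \<in> R" "x \<in> T" "y \<in> T" and y: "(\<lambda>n. ?v n y) \<longlonglongrightarrow> 0" for x y T
  proof -
    have "(\<lambda>n. ?v n y + ?d n T \<bullet> (x - y)) \<longlonglongrightarrow> 0 + 0 \<bullet> (x - y)"
      by (intro tendsto_intros y slopes that)
    then show ?thesis unfolding diff[OF that(1-3), symmetric] by simp
  qed
  have clamped0: "(\<lambda>n. ?v n x) \<longlonglongrightarrow> 0" if "T \<in> R" "clamped T" "x \<in> T" for x T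
  proof -
    have "Ud t n x = interpolant Th (g (past n t)) x" for n
      by (rule admissible_eq_load_on_clamped[OF discrete_pair(1)[OF t] Rc[OF that(1)] that(2,3)])
    moreover have "disp t x = interpolant Th (g t) x"
      by (rule admissible_eq_load_on_clamped[OF limit_pair(1)[OF t] Rc[OF that(1)] that(2,3)])
    ultimately show ?thesis
      using LIM_zero[OF tendsto_past[OF load_pointwise_continuous[OF Rc[OF that(1)] that(3)] t]] by simp
  qed
  define good where "good T \<longleftrightarrow> (\<forall>x\<in>T. (\<lambda>n. ?v n x) \<longlonglongrightarrow> 0)" for T
  have all_good: "good T" if T: "T \<in> R" for T
  proof -
    obtain x where x: "x \<in> T" "x \<in> G" using T by (auto simp: R_def)
    define K where "K = connected_component_set G x"
    have K: "K \<in> components G" unfolding K_def using x(2) by (rule componentsI)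
    have KG: "K \<subseteq> G" using in_components_subset[OF K] .
    have conn: "connected K" using in_components_connected[OF K] .
    obtain z where z: "z \<in> K" "z \<in> \<Omega>' - closure \<Omega>" using G(4)[OF K] by blast
    let ?A = "\<Union>{T\<in>R. good T}" and ?B = "\<Union>{T\<in>R. \<not> good T}"
    have finR: "finite R" using finite_cells by (simp add: R_def)
    have cl: "closed ?A" "closed ?B"
      using finR simplex_facts(1)[OF cellsD[OF Rc]] by (auto intro!: closed_Union compact_imp_closed)
    have KAB: "K \<subseteq> ?A \<union> ?B" using KG cover_G by blast
    have disj: "?A \<inter> ?B \<inter> K = {}"
    proof (rule ccontr)
      assume "?A \<inter> ?B \<inter> K \<noteq> {}"
      then obtain y T1 T2 where y: "T1 \<in> R" "good T1" "T2 \<in> R" "\<not> good T2" "y \<in> T1" "y \<in> T2" by blast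
      have "(\<lambda>n. ?v n y) \<longlonglongrightarrow> 0" using y by (simp add: good_def)
      then have "good T2" unfolding good_def using spread[OF y(3) _ y(6)] by blast
      then show False using y by simp
    qed
    have AK: "?A \<inter> K \<noteq> {}"
    proof -
      obtain S where S: "S \<in> R" "z \<in> S" using cover_G[of z] KG z by blast
      have "clamped S" using S z by (auto simp: clamped_def)
      then have "good S" unfolding good_def using clamped0[OF S(1)] by blast
      then show ?thesis using S z by blast
    qed
    have BK: "?B \<inter> K = {}"
    proof (rule ccontr)
      assume "?B \<inter> K \<noteq> {}"
      with cl KAB disj AK have "\<exists>A B. closed A \<and> closed B \<and> K \<subseteq> A \<union> B \<and> A \<inter> B \<inter> K = {} \<and> A \<inter> K \<noteq> {} \<and> B \<inter> K \<noteq> {}"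
        by (intro exI[of _ ?A] exI[of _ ?B] conjI)
      then show False using conn unfolding connected_closed by (rule notE[rotated])
    qed
    have xK: "x \<in> K" unfolding K_def using x(2) by simp
    show ?thesis
    proof (rule ccontr)
      assume "\<not> good T"
      then have "T \<in> {T\<in>R. \<not> good T}" using T by simp
      then have "x \<in> ?B" using x(1) by (rule UnionI)
      then have "x \<in> ?B \<inter> K" using xK by (rule IntI)
      then show False unfolding BK by (rule emptyE)
    qed
  qed
  define y where "y T = (SOME x. x \<in> T)" for T :: "(real ^ 'n) set"
  have yT: "y T \<in> T" if "T \<in> R" for T 
  proof -
    have "T \<noteq> {}" using that by (auto simp: R_def)
    then show ?thesis unfolding y_def by (simp add: some_in_eq)
  qed
  have "Lp_tendsto 1 G (Ud t) (disp t)"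
  proof (rule Lp_tendsto_cellwise[of R _ _ _ _ "\<lambda>n T. \<bar>?v n (y T)\<bar> + norm (?d n T) * diameter T"])
    show "R \<subseteq> cells" using Rc by blast
    fix T assume T: "T \<in> R"
    have "(\<lambda>n. ?v n (y T)) \<longlonglongrightarrow> 0" using all_good[OF T] yT[OF T] by (simp add: good_def)
    then have "(\<lambda>n. \<bar>?v n (y T)\<bar> + norm (?d n T) * diameter T) \<longlonglongrightarrow> \<bar>0\<bar> + norm (0 :: real ^ 'n) * diameter T"
      by (intro tendsto_intros slopes T)
    then show "(\<lambda>n. \<bar>?v n (y T)\<bar> + norm (?d n T) * diameter T) \<longlonglongrightarrow> 0" by simp
  next
    fix n
    have "\<exists>T\<in>R. x \<in> T \<and> norm (Ud t n x - disp t x) \<le> \<bar>?v n (y T)\<bar> + norm (?d n T) * diameter T" if x: "x \<in> G" for x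
    proof -
      obtain T where T: "T \<in> R" "x \<in> T" using cover_G[OF x] by blast
      have b: "bounded T" using simplex_facts(1)[OF cellsD[OF Rc[OF T(1)]]] by (rule compact_imp_bounded)
      have "norm (?d n T \<bullet> (x - y T)) \<le> norm (?d n T) * norm (x - y T)"
        by (simp add: Cauchy_Schwarz_ineq2)
      also have "\<dots> \<le> norm (?d n T) * diameter T"
        using diameter_bounded_bound[OF b T(2) yT[OF T(1)]] by (intro mult_left_mono) (auto simp: dist_norm)
      finally have "norm (?v n x) \<le> \<bar>?v n (y T)\<bar> + norm (?d n T) * diameter T"
        unfolding diff[OF T(1,2) yT[OF T(1)]] by simp
      then show ?thesis using T by blast
    qed
    then show "AE x in lebesgue. x \<in> G \<longrightarrow> (\<exists>T\<in>R. x \<in> T \<and> norm (Ud t n x - disp t x) \<le> \<bar>?v n (y T)\<bar> + norm (?d n T) * diameter T)"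
      by (intro AE_I2) blast
  qed simp
  then show ?thesis unfolding G_def .
qed

end

theorem theorem2p1:
  fixes \<Omega> \<Omega>' :: "(real ^ 'n) set"
    and \<T> :: "real \<Rightarrow> (real ^ 'n) set set"
    and h :: "real \<Rightarrow> real"
    and C :: "real ^ 'n ^ 'n"
    and \<kappa> :: real
    and g :: "real \<Rightarrow> real ^ 'n \<Rightarrow> real"
    and I :: "real set"
    and \<tau> :: "nat \<Rightarrow> nat \<Rightarrow> real"
  assumes "lipschitz_domain \<Omega>" and "\<Omega> \<subseteq> \<Omega>'" and "lipschitz_set (\<Omega>' - closure \<Omega>)"
    and "\<And>\<eta>. 0 < \<eta> \<Longrightarrow> space_triangulation (\<T> \<eta>)"
    and "\<And>\<eta> T. 0 < \<eta> \<Longrightarrow> T \<in> \<T> \<eta> \<Longrightarrow> diameter T \<le> \<eta>"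
    and "\<And>\<epsilon>. 0 < \<epsilon> \<Longrightarrow> 0 < h \<epsilon>" and "((\<lambda>\<epsilon>. h \<epsilon> / \<epsilon>) \<longlongrightarrow> 0) (at_right 0)"
    and "transpose C = C" and "\<And>F. F \<noteq> 0 \<Longrightarrow> 0 < quad C F" and "0 < \<kappa>"
    and "g \<in> W11_W2inf"
    and "time_partitions I \<tau>"
  shows "\<forall>\<epsilon>>0. let Th = \<T> (h \<epsilon>); gh = (\<lambda>t. interpolant Th (g t)) in
    (\<exists>u \<gamma> \<Gamma>. quasistatic_evolution C \<kappa> \<epsilon> Th \<Omega> \<Omega>' gh u \<gamma> \<Gamma>) \<and>
    (\<exists>um \<gamma>m. time_discrete_solution C \<kappa> \<epsilon> Th \<Omega> \<Omega>' gh \<tau> um \<gamma>m) \<and>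
    (\<forall>um \<gamma>m. time_discrete_solution C \<kappa> \<epsilon> Th \<Omega> \<Omega>' gh \<tau> um \<gamma>m \<longrightarrow>
      (\<exists>r u \<gamma> \<Gamma>. strict_mono (r :: nat \<Rightarrow> nat) \<and>
        quasistatic_evolution C \<kappa> \<epsilon> Th \<Omega> \<Omega>' gh u \<gamma> \<Gamma> \<and>
        (\<forall>t\<in>{0..1}. \<forall>k. step_index \<tau> t k \<longrightarrow>
          (let U = (\<lambda>n. um (r n) (k (r n)));
               Y = (\<lambda>n. \<gamma>m (r n) (k (r n)));
               Z = (\<lambda>n. crack_set Th \<Omega>' (\<gamma>m (r n)) (k (r n)))
           in (\<lambda>n. energy C \<kappa> \<epsilon> Th \<Omega> \<Omega>' (U n) (Y n) (Z n))
                \<longlonglongrightarrow> energy C \<kappa> \<epsilon> Th \<Omega> \<Omega>' (u t) (\<gamma> t) (\<Gamma> t) \<and>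
              Lp_tendsto 1 (attached_part \<Omega> \<Omega>' (mesh_nbhd Th \<epsilon> (\<Gamma> t))) U (u t) \<and>
              Lp_tendsto 2 \<Omega>' (\<lambda>n x. indicat_real (- Z n) x *\<^sub>R grad (U n) x)
                (\<lambda>x. grad (u t) x - \<gamma> t x)))))"
  (is "\<forall>\<epsilon>>0. ?thesis_body \<epsilon>")
proof (intro allI impI)
  fix \<epsilon> :: real assume \<epsilon>: "0 < \<epsilon>"
  define Th where "Th = \<T> (h \<epsilon>)"
  obtain g' where g': "\<And>x. set_integrable lebesgue {0..1} (\<lambda>s. g' s x)"
    "\<And>t x. t \<in> {0..1} \<Longrightarrow> g t x = g 0 x + (LINT s:{0..t}|lebesgue. g' s x)"
    using W11_W2inf_pointwise[OF assms(11)] by metis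
  have lip: "lipschitz_set \<Omega>" using assms(1) by (simp add: lipschitz_domain_def)
  have bounded': "bounded \<Omega>'"
  proof (rule bounded_subset)
    show "bounded (closure \<Omega> \<union> (\<Omega>' - closure \<Omega>))"
      using lip assms(3) unfolding bounded_Un lipschitz_set_def by (simp add: bounded_closure)
    show "\<Omega>' \<subseteq> closure \<Omega> \<union> (\<Omega>' - closure \<Omega>)" by blast
  qed
  interpret fe_loading Th \<Omega> \<Omega>' C \<kappa> \<epsilon> g g'
  proof unfold_locales
    show "space_triangulation Th" unfolding Th_def using assms(4,6) \<epsilon> by blast
    show "open \<Omega>" using lip by (simp add: lipschitz_set_def)
    show "open (\<Omega>' - closure \<Omega>)" using assms(3) by (simp add: lipschitz_set_def)
    show "negligible (frontier \<Omega>)" by (rule lipschitz_set_null_frontier[OF lip])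
  qed (fact bounded' assms \<epsilon> g')+
  interpret partitions I \<tau> by unfold_locales (rule assms(12))
  have limit_exists: "\<exists>r P. fe_limit Th \<Omega> \<Omega>' C \<kappa> \<epsilon> g g' I \<tau> um \<gamma>m r P"
    if "time_discrete_solution C \<kappa> \<epsilon> Th \<Omega> \<Omega>' load \<tau> um \<gamma>m" for um \<gamma>m
  proof -
    interpret fe_discrete Th \<Omega> \<Omega>' C \<kappa> \<epsilon> g g' I \<tau> um \<gamma>m
      by unfold_locales (rule that)
    obtain r P where "strict_mono r"
      "\<forall>t\<in>{0..1}. \<forall>\<^sub>F n in sequentially. cracked (r n) (step_of \<tau> (r n) t) = P t"
      using limit_cracks_exist by blast
    then have "fe_limit Th \<Omega> \<Omega>' C \<kappa> \<epsilon> g g' I \<tau> um \<gamma>m r P"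
      by unfold_locales auto
    then show ?thesis by blast
  qed
  show "?thesis_body \<epsilon>"
    unfolding Let_def Th_def[symmetric]
  proof (intro conjI allI impI, goal_cases)
    case 1
    obtain um \<gamma>m where "time_discrete_solution C \<kappa> \<epsilon> Th \<Omega> \<Omega>' load \<tau> um \<gamma>m"
      using time_discrete_solution_exists by blast
    then obtain r P where "fe_limit Th \<Omega> \<Omega>' C \<kappa> \<epsilon> g g' I \<tau> um \<gamma>m r P"
      using limit_exists by blast
    then interpret fe_limit Th \<Omega> \<Omega>' C \<kappa> \<epsilon> g g' I \<tau> um \<gamma>m r P .
    show ?case using limit_is_quasistatic_evolution by blast
  next
    case 2
    show ?case by (rule time_discrete_solution_exists)
  next
    case (3 um \<gamma>m)
    obtain r P where "fe_limit Th \<Omega> \<Omega>' C \<kappa> \<epsilon> g g' I \<tau> um \<gamma>m r P"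
      using limit_exists[OF 3] by blast
    then interpret fe_limit Th \<Omega> \<Omega>' C \<kappa> \<epsilon> g g' I \<tau> um \<gamma>m r P .
    show ?case
    proof (intro exI[of _ r] exI[of _ disp] exI[of _ eig] exI[of _ "\<lambda>t. \<Union>(P t)"] conjI ballI allI impI
        sub limit_is_quasistatic_evolution, goal_cases)
      case (1 t k)
      then have "k m = step_of \<tau> m t" for m by (intro step_index_unique) auto
      then show ?case using energy_convergence[OF 1(1)] by simp
    next
      case (2 t k)
      then have "k m = step_of \<tau> m t" for m by (intro step_index_unique) auto
      then show ?case using displacement_convergence[OF 2(1)] by simp
    next
      case (3 t k)
      then have "k m = step_of \<tau> m t" for m by (intro step_index_unique) auto
      then show ?case using gradient_convergence[OF 3(1)] by simp
    qed
  qed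
qed

end
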